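(* Let $\mathcal{Q}=\{(s_{\mathrm{ph}},s_{\mathrm{el}})\in\mathbb{R}^2:s_{\mathrm{ph}}<s_{\mathrm{el}}\}$. Let $\rho:[0,\infty)\times\overline{\mathcal{Q}}\to[0,\infty)$ and $J=(J^1,J^2):[0,\infty)\times\overline{\mathcal{Q}}\to\mathbb{R}^2$ be locally Lipschitz continuous with: (1) $\partial_t\rho+\mathrm{div}\,J=0$ almost everywhere (Lebesgue); (2) $\rho>0$ whenever $\rho\neq0$; (3) $\int_{\mathcal{Q}}\rho(t,q)\,dq=1$ for all $t\ge0$; (4) there is $C>0$ with $|J|\le C\rho$; (5) $J$ and the first-order derivatives of $\rho$ (where they exist) are bounded on bounded sets; (6) $|J^1(t,q)-J^2(t,q)|=0$ for all $t\ge0$ and all $q\in\partial\mathcal{Q}$. Let $\mu_t(dq)=\rho(t,q)\,dq$. Then for $\mu_0$-almost every $q\in\mathcal{Q}$, the solution of $\frac{dQ}{dt}=\frac{J(t,Q)}{\rho(t,Q)}$ with $Q(0)=q$ exists for all $t\ge0$, satisfies $Q(t)\in\mathcal{Q}$ for all $t\ge0$, and the family of measures $(\mu_t)$ is equivariant.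
   Context: Let $\mathcal{N}_t=\{q:\rho(t,q)=0\}$. Away from the nodes the velocity field $J/\rho$ is locally Lipschitz, so for $q\in\mathcal{Q}\setminus\mathcal{N}_0$ there is a unique maximal solution $Q_q$ in $\mathcal{Q}\setminus\mathcal{N}_t$ with $Q_q(0)=q$ on a maximal interval $(\tau^-_q,\tau^+_q)$. Adjoin a "graveyard" point $\diamondsuit$ to $\mathcal{Q}$ and set $\varphi_t(q)=Q_q(t)$ for $t\in(\tau_q^-,\tau_q^+)$ and $\varphi_t(q)=\diamondsuit$ otherwise (also for $q\in\mathcal{N}_0$ and $t\neq0$, and when a trajectory reaches $\partial\mathcal{Q}$). The family $(\mu_t)$ is called equivariant if $\mu_0\circ\varphi_t^{-1}=\mu_t$ for all $t\ge0$ (as measures on $\mathcal{Q}$). *)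

theory Defs
  imports "HOL-Analysis.Analysis"
begin

type_synonym pt = "real \<times> real"

definition QQ :: "pt set" where
  "QQ = {(a, b). a < b}"

definition locally_lipschitz_on :: "'a::metric_space set \<Rightarrow> ('a \<Rightarrow> 'b::metric_space) \<Rightarrow> bool" where
  "locally_lipschitz_on S f \<longleftrightarrow>
     (\<forall>x\<in>S. \<exists>e>0. \<exists>L. L-lipschitz_on (ball x e \<inter> S) f)"

definition cont_eq_at :: "(real \<Rightarrow> pt \<Rightarrow> real) \<Rightarrow> (real \<Rightarrow> pt \<Rightarrow> pt) \<Rightarrow> real \<Rightarrow> real \<Rightarrow> real \<Rightarrow> bool" where
  "cont_eq_at \<rho> J t x y \<longleftrightarrow>
     (\<exists>a b c. ((\<lambda>s. \<rho> s (x, y)) has_real_derivative a) (at t)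
            \<and> ((\<lambda>u. fst (J t (u, y))) has_real_derivative b) (at x)
            \<and> ((\<lambda>v. snd (J t (x, v))) has_real_derivative c) (at y)
            \<and> a + b + c = 0)"

definition is_sol :: "(real \<Rightarrow> pt \<Rightarrow> real) \<Rightarrow> (real \<Rightarrow> pt \<Rightarrow> pt) \<Rightarrow> pt \<Rightarrow> real \<Rightarrow> (real \<Rightarrow> pt) \<Rightarrow> bool" where
  "is_sol \<rho> J q T X \<longleftrightarrow> X 0 = q \<and>
     (\<forall>t\<in>{0..<T}. X t \<in> QQ \<and> \<rho> t (X t) \<noteq> 0 \<and>
        (X has_vector_derivative ((1 / \<rho> t (X t)) *\<^sub>R J t (X t))) (at t within {0..<T}))"

text \<open>The flow map phi_t; None plays the role of the graveyard point.\<close>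
definition flow :: "(real \<Rightarrow> pt \<Rightarrow> real) \<Rightarrow> (real \<Rightarrow> pt \<Rightarrow> pt) \<Rightarrow> real \<Rightarrow> pt \<Rightarrow> pt option" where
  "flow \<rho> J t q =
     (if t = 0 \<and> q \<in> QQ then Some q
      else if (\<exists>T X. t < T \<and> is_sol \<rho> J q T X)
      then Some (THE y. \<exists>T X. t < T \<and> is_sol \<rho> J q T X \<and> X t = y)
      else None)"

definition mu :: "(real \<Rightarrow> pt \<Rightarrow> real) \<Rightarrow> real \<Rightarrow> pt measure" where
  "mu \<rho> t = density lebesgue (\<lambda>q. ennreal (indicator QQ q * \<rho> t q))"

definition equivariant :: "(real \<Rightarrow> pt \<Rightarrow> real) \<Rightarrow> (real \<Rightarrow> pt \<Rightarrow> pt) \<Rightarrow> bool" where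
  "equivariant \<rho> J \<longleftrightarrow>
     (\<forall>t\<ge>0. \<forall>A\<in>sets lebesgue. A \<subseteq> QQ \<longrightarrow>
        {q. flow \<rho> J t q \<in> Some ` A} \<in> sets (mu \<rho> 0) \<and>
        emeasure (mu \<rho> 0) {q. flow \<rho> J t q \<in> Some ` A} = emeasure (mu \<rho> t) A)"

end

theory Submission
  imports Defs
begin

text \<open>
  Fix \<open>n\<close>. Restricting \<open>\<rho>\<close> and \<open>J\<close> to a compact box and bounding \<open>\<rho>\<close> below by \<open>1 / n\<close> turns
  \<open>J / \<rho>\<close> into a globally Lipschitz field, bounded by \<open>C\<close>, with a bi-Lipschitz flow. Mass is
  conserved along this flow while trajectories stay in the good set \<open>\<rho> > 1 / n\<close>: for a Lipschitz
  function transported by the flow, its integral against \<open>\<rho> t\<close> changes by \<open>o(h)\<close> in time \<open>h\<close>, because it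
  may be replaced by its average against a smooth bump up to a commutator of size \<open>\<epsilon> h\<close>, and for the
  bump the continuity equation can be integrated by parts. No Jacobian and no differentiability
  theorem for Lipschitz maps is needed.

  Conservation of mass makes the expectation of \<open>\<integral> 1 / \<rho>\<close> along the trajectory, up to the exit time, at
  most the volume of a bounded space-time region, uniformly in \<open>n\<close>. As \<open>\<rho>\<close> is Lipschitz along
  trajectories, finiteness of this integral keeps \<open>\<rho>\<close> away from \<open>0\<close>; the boundary is not reached because
  the normal component of \<open>J\<close> vanishes there. Hence almost every trajectory survives. The transported
  measure is at most \<open>\<mu> t\<close> and both have total mass \<open>1\<close>, so they agree.
\<close>

section \<open>Flows of bounded Lipschitz fields\<close>

text \<open>The order of limits closes the argument. With a bump of width \<open>e\<close>, a time
  step of length \<open>h\<close> costs \<open>A * e * h + K * h\<^sup>2\<close>, where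
  \<open>A\<close> does not depend on \<open>e\<close> while \<open>K\<close> may blow up as
  \<open>e\<close> shrinks. Over \<open>T / h\<close> steps, \<open>h\<close> tends to 0 first and
  \<open>e\<close> afterwards, which leaves exact conservation.

  The equation holds almost everywhere and only for partial derivatives, so it enters through
  forward difference quotients: Lipschitz continuity bounds them, dominated convergence removes
  them, and shift invariance of Lebesgue measure stands in for integration by parts.

  The Lipschitz constant of the regularised velocity grows with \<open>n\<close>, so Gronwall
  estimates do not pass to the limit. The residence integral does: the density carried by the flow
  cancels its own inverse, and a volume free of \<open>n\<close> remains. The integrand still
  depends on \<open>n\<close>; Fatou's lemma yields, for almost every point, one bound valid for
  infinitely many \<open>n\<close>. One large \<open>n\<close> among them suffices, because survival
  for a single \<open>n\<close> already produces a genuine solution.\<close>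

lemma gronwall_pair:
  fixes z z' :: "real \<Rightarrow> 'a::euclidean_space"
  assumes ab: "a \<le> b" and cont: "continuous_on {a..b} z"
    and deriv: "\<And>t. a < t \<Longrightarrow> t < b \<Longrightarrow> (z has_vector_derivative z' t) (at t)"
    and bound: "\<And>t. a < t \<Longrightarrow> t < b \<Longrightarrow> norm (z' t) \<le> L * norm (z t)"
  shows "norm (z b) \<le> exp (L * (b - a)) * norm (z a)"
    and "norm (z a) \<le> exp (L * (b - a)) * norm (z b)"
proof -
  have cs: "\<bar>z' t \<bullet> z t\<bar> \<le> L * (z t \<bullet> z t)" if "a < t" "t < b" for t
  proof -
    have "\<bar>z' t \<bullet> z t\<bar> \<le> norm (z' t) * norm (z t)" by (rule Cauchy_Schwarz_ineq2)
    also have "\<dots> \<le> (L * norm (z t)) * norm (z t)"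
      by (intro mult_right_mono bound that) auto
    also have "\<dots> = L * (z t \<bullet> z t)"
      by (simp add: power2_norm_eq_inner[symmetric] power2_eq_square)
    finally show ?thesis .
  qed
  \<comment> \<open>Used with \<open>K = - 2 * L\<close>, where the weighted square decreases, and
    with \<open>K = 2 * L\<close>, where it increases; the two-sided bound \<open>cs\<close> serves
    both directions.\<close>
  have der: "((\<lambda>t. exp (K * t) * (z t \<bullet> z t)) has_real_derivative
      exp (K * t) * (K * (z t \<bullet> z t) + 2 * (z' t \<bullet> z t))) (at t)" if "a < t" "t < b" for K t
  proof -
    have "(z has_derivative (\<lambda>h. h *\<^sub>R z' t)) (at t)"
      using deriv[OF that] by (simp add: has_vector_derivative_def)
    then have "((\<lambda>t. z t \<bullet> z t) has_derivative (\<lambda>h. z t \<bullet> (h *\<^sub>R z' t) + (h *\<^sub>R z' t) \<bullet> z t)) (at t)"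
      by (intro derivative_intros)
    then have "((\<lambda>t. z t \<bullet> z t) has_real_derivative 2 * (z' t \<bullet> z t)) (at t)"
      by (simp add: has_field_derivative_def inner_commute algebra_simps mult_commute_abs)
    then show ?thesis
      by (auto intro!: derivative_eq_intros simp: algebra_simps)
  qed
  have contK: "continuous_on {a..b} (\<lambda>t. exp (K * t) * (z t \<bullet> z t))" for K
    by (intro continuous_intros cont)
  have "exp (- 2 * L * b) * (z b \<bullet> z b) \<le> exp (- 2 * L * a) * (z a \<bullet> z a)"
  proof (rule DERIV_nonpos_imp_decreasing_open[OF ab _ contK], intro exI conjI)
    fix t assume t: "a < t" "t < b"
    show "exp (- 2 * L * t) * (- 2 * L * (z t \<bullet> z t) + 2 * (z' t \<bullet> z t)) \<le> 0"
      using cs[OF t] by (intro mult_nonneg_nonpos) auto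
  qed (rule der)
  then have "z b \<bullet> z b \<le> exp (2 * L * b) * (exp (- 2 * L * a) * (z a \<bullet> z a))"
    by (simp add: exp_minus field_simps)
  also have "\<dots> = (exp (L * (b - a)))\<^sup>2 * (z a \<bullet> z a)"
    unfolding mult.assoc[symmetric] exp_add[symmetric] exp_double[symmetric] by (simp add: right_diff_distrib)
  finally have "(norm (z b))\<^sup>2 \<le> (exp (L * (b - a)) * norm (z a))\<^sup>2"
    by (simp add: power_mult_distrib power2_norm_eq_inner)
  then show "norm (z b) \<le> exp (L * (b - a)) * norm (z a)"
    by (rule power2_le_imp_le) auto
  have "exp (2 * L * a) * (z a \<bullet> z a) \<le> exp (2 * L * b) * (z b \<bullet> z b)"
  proof (rule DERIV_nonneg_imp_increasing_open[OF ab _ contK], intro exI conjI)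
    fix t assume t: "a < t" "t < b"
    show "0 \<le> exp (2 * L * t) * (2 * L * (z t \<bullet> z t) + 2 * (z' t \<bullet> z t))"
      using cs[OF t] by (intro mult_nonneg_nonneg) auto
  qed (rule der)
  then have "z a \<bullet> z a \<le> exp (- 2 * L * a) * (exp (2 * L * b) * (z b \<bullet> z b))"
    by (simp add: exp_minus field_simps)
  also have "\<dots> = (exp (L * (b - a)))\<^sup>2 * (z b \<bullet> z b)"
    unfolding mult.assoc[symmetric] exp_add[symmetric] exp_double[symmetric] by (simp add: right_diff_distrib)
  finally have "(norm (z a))\<^sup>2 \<le> (exp (L * (b - a)) * norm (z b))\<^sup>2"
    by (simp add: power_mult_distrib power2_norm_eq_inner)
  then show "norm (z a) \<le> exp (L * (b - a)) * norm (z b)"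
    by (rule power2_le_imp_le) auto
qed

lemma
  fixes U :: "'a::euclidean_space \<Rightarrow> real"
  assumes "\<And>p q. \<bar>U p - U q\<bar> \<le> K * norm (p - q)"
  shows lipschitz_const_nonneg: "0 \<le> K"
    and continuous_on_lipschitz_compose: "continuous_on X f \<Longrightarrow> continuous_on X (\<lambda>x. U (f x))"
proof -
  obtain i :: 'a where "i \<in> Basis" using nonempty_Basis by blast
  then show K: "0 \<le> K" using assms[of i 0] by simp
  have "K-lipschitz_on UNIV U"
    by (rule lipschitz_onI) (use assms K in \<open>auto simp: dist_norm\<close>)
  then show "continuous_on X f \<Longrightarrow> continuous_on X (\<lambda>x. U (f x))"
    by (rule continuous_on_compose2[OF lipschitz_on_continuous_on]) auto
qed

lemma continuous_on_lipschitz_pair: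
  fixes f :: "real \<Rightarrow> 'a::real_normed_vector \<Rightarrow> 'b::real_normed_vector"
  assumes "0 \<le> K" "\<And>s p t q. norm (f s p - f t q) \<le> K * (\<bar>s - t\<bar> + norm (p - q))"
  shows "continuous_on S (\<lambda>z. f (fst z) (snd z))"
proof (rule lipschitz_on_continuous_on[of "2 * K"], rule lipschitz_onI)
  fix x y :: "real \<times> 'a"
  have "\<bar>fst x - fst y\<bar> \<le> dist x y" "norm (snd x - snd y) \<le> dist x y"
    using dist_fst_le[of x y] dist_snd_le[of x y] by (auto simp: dist_norm)
  then have "K * (\<bar>fst x - fst y\<bar> + norm (snd x - snd y)) \<le> K * (2 * dist x y)"
    using assms(1) by (intro mult_left_mono) auto
  with assms(2)[of "fst x" "snd x" "fst y" "snd y"]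
  show "dist (f (fst x) (snd x)) (f (fst y) (snd y)) \<le> 2 * K * dist x y"
    by (simp add: dist_norm)
qed (use assms(1) in auto)

text \<open>Lipschitz dependence on time as well as on space gives an Euler step an error of second
  order. The bound \<open>C\<close> limits displacements and keeps the weighted Picard iterates
  bounded.\<close>

locale lipschitz_field =
  fixes w :: "real \<Rightarrow> 'a::euclidean_space \<Rightarrow> 'a" and L C :: real
  assumes L_pos: "0 < L" and C_nonneg: "0 \<le> C"
    and w_lip: "norm (w s x - w t y) \<le> L * (\<bar>s - t\<bar> + norm (x - y))"
    and w_bound: "norm (w t x) \<le> C"
begin

lemma norm_step_le: "0 \<le> h \<Longrightarrow> norm (h *\<^sub>R w t q) \<le> h * C"
  using w_bound[of t q] by (simp add: mult_left_mono)

lemma continuous_on_w: "continuous_on S (\<lambda>z. w (fst z) (snd z))"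
  by (rule continuous_on_lipschitz_pair[OF less_imp_le[OF L_pos] w_lip])

lemma continuous_on_w_comp [continuous_intros]:
  "continuous_on S f \<Longrightarrow> continuous_on S g \<Longrightarrow> continuous_on S (\<lambda>r. w (f r) (g r))"
  using continuous_on_compose2[OF continuous_on_w[of UNIV], of S "\<lambda>r. (f r, g r)"]
  by (auto intro: continuous_intros)

text \<open>Picard iteration contracts in the norm weighted with \<open>exp (- 2 L t)\<close>, on the whole half-line.\<close>

lemma forward_solution_exists:
  "\<exists>x. x 0 = q \<and> (\<forall>t\<ge>0. (x has_vector_derivative w t (x t)) (at t within {0..}))"
proof -
  \<comment> \<open>The unknown \<open>y\<close> is the displacement \<open>x - q\<close> divided by
    \<open>exp (2 * L * r)\<close>, so the sup norm of \<open>y\<close> is the weighted norm of the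
    displacement.\<close>
  define f where "f y r = w r (q + exp (2 * L * r) *\<^sub>R apply_bcontfun y r)" for y :: "real \<Rightarrow>\<^sub>C 'a" and r
  define I where "I y t = integral {0..t} (f y)" for y t
  \<comment> \<open>Bounded continuous functions live on the whole line; \<open>max 0 t\<close>
    extends the iterate to negative times by its value at time 0.\<close>
  define K where "K y t = exp (- 2 * L * max 0 t) *\<^sub>R I y (max 0 t)" for y t
  have cf: "continuous_on S (f y)" for y S
    unfolding f_def by (intro continuous_intros continuous_on_apply_bcontfun)
  have Ider: "(I y has_vector_derivative f y t) (at t within {0..})" if "0 \<le> t" for y t
  proof -
    have "(I y has_vector_derivative f y t) (at t within {0..t+1})"
      unfolding I_def using that by (intro integral_has_vector_derivative cf) auto
    also have "at t within {0..t+1} = at t within {0..}"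
      by (rule at_within_nhd[of t "{..<t+1}"]) auto
    finally show ?thesis .
  qed
  have Ibound: "norm (I y t) \<le> C * t" if "0 \<le> t" for y t
    using integral_bound[OF that cf, where B = C] w_bound by (simp add: I_def f_def)
  have Kcont: "continuous_on UNIV (K y)" for y
  proof -
    have "continuous_on {0..} (I y)"
      using Ider by (auto intro!: has_vector_derivative_continuous simp: continuous_on_eq_continuous_within)
    then have "continuous_on UNIV (\<lambda>t. I y (max 0 t))"
      by (rule continuous_on_compose2) (auto intro!: continuous_intros)
    then show ?thesis unfolding K_def by (intro continuous_intros)
  qed
  have Kbound: "norm (K y t) \<le> C / (2 * L)" for y t
  proof -
    define u where "u = max 0 t"
    have u: "0 \<le> u" by (simp add: u_def)
    have "2 * L * u \<le> exp (2 * L * u)" using exp_ge_add_one_self[of "2 * L * u"] by linarith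
    then have "exp (- (2 * L * u)) * (2 * L * u) \<le> 1" by (simp add: exp_minus field_simps)
    have "norm (K y t) \<le> exp (- (2 * L * u)) * (C * u)"
      using Ibound[OF u] by (simp add: K_def u_def)
    also have "\<dots> = (exp (- (2 * L * u)) * (2 * L * u)) * (C / (2 * L))"
      using L_pos by (simp add: field_simps)
    also have "\<dots> \<le> 1 * (C / (2 * L))"
      using L_pos C_nonneg \<open>exp (- (2 * L * u)) * (2 * L * u) \<le> 1\<close> by (intro mult_right_mono) auto
    finally show ?thesis by simp
  qed
  define T where "T y = Bcontfun (K y)" for y
  have T: "apply_bcontfun (T y) = K y" for y
    unfolding T_def by (rule Bcontfun_inverse) (rule bcontfun_normI[OF Kcont Kbound])
  \<comment> \<open>Integrating \<open>L * exp (2 * L * r)\<close> gives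
    \<open>(exp (2 * L * u) - 1) / 2\<close>; the weight cancels the exponential and leaves the
    factor 1/2, whatever the length of the time interval.\<close>
  have contr: "dist (T y) (T z) \<le> (1/2) * dist y z" for y z
  proof (rule dist_bound)
    fix t :: real
    define u where "u = max 0 t"
    have u: "0 \<le> u" by (simp add: u_def)
    have der: "((\<lambda>r. exp (2 * L * r) / 2 * dist y z) has_vector_derivative L * exp (2 * L * r) * dist y z)
        (at r within {0..u})" for r
      by (auto intro!: derivative_eq_intros simp: has_real_derivative_iff_has_vector_derivative[symmetric])
    have hi: "((\<lambda>r. L * exp (2 * L * r) * dist y z) has_integral
        (exp (2 * L * u) / 2 * dist y z - exp (2 * L * 0) / 2 * dist y z)) {0..u}"
      by (rule fundamental_theorem_of_calculus[OF u der])
    have "norm (I y u - I z u) = norm (integral {0..u} (\<lambda>r. f y r - f z r))"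
      unfolding I_def by (subst Henstock_Kurzweil_Integration.integral_diff) (auto intro!: integrable_continuous_real cf)
    also have "\<dots> \<le> integral {0..u} (\<lambda>r. L * exp (2 * L * r) * dist y z)"
    proof (rule Henstock_Kurzweil_Integration.integral_norm_bound_integral)
      show "(\<lambda>r. f y r - f z r) integrable_on {0..u}"
        by (intro integrable_continuous_real continuous_intros cf)
      show "(\<lambda>r. L * exp (2 * L * r) * dist y z) integrable_on {0..u}" using hi by blast
      fix r
      have "norm (f y r - f z r) \<le> L * norm (exp (2 * L * r) *\<^sub>R y r - exp (2 * L * r) *\<^sub>R z r)"
        using w_lip[of r "q + exp (2 * L * r) *\<^sub>R y r" r "q + exp (2 * L * r) *\<^sub>R z r"] by (simp add: f_def)
      also have "\<dots> = L * exp (2 * L * r) * dist (y r) (z r)"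
        by (simp add: scaleR_diff_right[symmetric] dist_norm)
      also have "\<dots> \<le> L * exp (2 * L * r) * dist y z"
        using L_pos by (intro mult_left_mono dist_bounded) auto
      finally show "norm (f y r - f z r) \<le> L * exp (2 * L * r) * dist y z" .
    qed
    also have "\<dots> = (exp (2 * L * u) - 1) / 2 * dist y z"
      using integral_unique[OF hi] by (simp add: field_simps)
    finally have "norm (I y u - I z u) \<le> exp (2 * L * u) / 2 * dist y z"
      by (rule order_trans) (intro mult_right_mono, auto)
    then have "exp (- (2 * L * u)) * norm (I y u - I z u) \<le> dist y z / 2"
      by (simp add: exp_minus field_simps)
    then show "dist (T y t) (T z t) \<le> (1/2) * dist y z"
      by (simp add: T K_def u_def[symmetric] dist_norm scaleR_diff_right[symmetric])
  qed
  obtain y where y: "T y = y"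
    using banach_fix_type[of "1/2" T] contr by auto
  define x where "x t = q + I y t" for t
  have "(x has_vector_derivative w t (x t)) (at t within {0..})" if "0 \<le> t" for t
  proof -
    have "apply_bcontfun y t = exp (- 2 * L * t) *\<^sub>R I y t"
      using T[of y] that unfolding y by (simp add: K_def max_def)
    then have "exp (2 * L * t) *\<^sub>R apply_bcontfun y t = I y t" by (simp add: exp_minus)
    then have "f y t = w t (x t)" by (simp add: f_def x_def)
    then show ?thesis
      using Ider[OF that, of y] unfolding x_def by (auto intro!: derivative_eq_intros)
  qed
  moreover have "x 0 = q" by (simp add: x_def I_def)
  ultimately show ?thesis by blast
qed

text \<open>The past is the forward problem for the reversed field \<open>- w (s - r)\<close>. The
  two halves agree in value and in one-sided derivative at time \<open>s\<close>, so they glue to a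
  solution on the whole line.\<close>

lemma solution_exists:
  "\<exists>x. x s = q \<and> (\<forall>t. (x has_vector_derivative w t (x t)) (at t))"
proof -
  interpret F: lipschitz_field "\<lambda>r. w (s + r)" L C
    using w_lip[of "s + _" _ "s + _"] by unfold_locales (auto simp: L_pos C_nonneg w_bound)
  interpret B: lipschitz_field "\<lambda>r x. - w (s - r) x" L C
  proof
    fix r x r' y
    show "norm (- w (s - r) x - - w (s - r') y) \<le> L * (\<bar>r - r'\<bar> + norm (x - y))"
      using w_lip[of "s - r" x "s - r'" y] by (simp add: norm_minus_commute abs_minus_commute)
  qed (auto simp: L_pos C_nonneg w_bound)
  obtain x where x: "x 0 = q" "\<And>t. 0 \<le> t \<Longrightarrow> (x has_vector_derivative w (s + t) (x t)) (at t within {0..})"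
    using F.forward_solution_exists by blast
  obtain y where y: "y 0 = q" "\<And>t. 0 \<le> t \<Longrightarrow> (y has_vector_derivative - w (s - t) (y t)) (at t within {0..})"
    using B.forward_solution_exists by blast
  define z where "z t = (if t \<in> {s..} then x (t - s) else y (s - t))" for t
  have X: "((\<lambda>t. x (t - s)) has_vector_derivative w t (x (t - s))) (at t within {s..})" if "s \<le> t" for t
  proof -
    have "((x \<circ> (\<lambda>t. t - s)) has_vector_derivative (1 *\<^sub>R w (s + (t - s)) (x (t - s)))) (at t within {s..})"
    proof (rule vector_diff_chain_within)
      show "((\<lambda>t. t - s) has_vector_derivative 1) (at t within {s..})"
        by (auto intro!: derivative_eq_intros)
      show "(x has_vector_derivative w (s + (t - s)) (x (t - s))) (at (t - s) within (\<lambda>t. t - s) ` {s..})"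
        by (rule has_vector_derivative_within_subset[OF x(2)]) (use that in auto)
    qed
    then show ?thesis by (simp add: o_def)
  qed
  have Y: "((\<lambda>t. y (s - t)) has_vector_derivative w t (y (s - t))) (at t within {..s})" if "t \<le> s" for t
  proof -
    have "((y \<circ> (\<lambda>t. s - t)) has_vector_derivative ((-1) *\<^sub>R (- w (s - (s - t)) (y (s - t))))) (at t within {..s})"
    proof (rule vector_diff_chain_within)
      show "((\<lambda>t. s - t) has_vector_derivative -1) (at t within {..s})"
        by (auto intro!: derivative_eq_intros)
      show "(y has_vector_derivative - w (s - (s - t)) (y (s - t))) (at (s - t) within (\<lambda>t. s - t) ` {..s})"
        by (rule has_vector_derivative_within_subset[OF y(2)]) (use that in auto)
    qed
    then show ?thesis by (simp add: o_def)
  qed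
  have "(z has_vector_derivative (if t \<in> {s..} then w t (x (t - s)) else w t (y (s - t)))) (at t within UNIV)" for t
    unfolding z_def
  proof (rule has_vector_derivative_If_within_closures[where T = "{..s}"])
    have S: "{s..} \<union> (closure {s..} \<inter> closure {..s}) = {s..}"
      and T: "{..s} \<union> (closure {s..} \<inter> closure {..s}) = {..s}" by auto
    show "((\<lambda>t. x (t - s)) has_vector_derivative w t (x (t - s))) (at t within {s..} \<union> (closure {s..} \<inter> closure {..s}))"
      if "t \<in> {s..} \<union> (closure {s..} \<inter> closure {..s})"
      using X[of t] that unfolding S by simp
    show "((\<lambda>t. y (s - t)) has_vector_derivative w t (y (s - t))) (at t within {..s} \<union> (closure {s..} \<inter> closure {..s}))"
      if "t \<in> {..s} \<union> (closure {s..} \<inter> closure {..s})"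
      using Y[of t] that unfolding T by simp
  qed (use x(1) y(1) in auto)
  moreover have "(if t \<in> {s..} then w t (x (t - s)) else w t (y (s - t))) = w t (z t)" for t
    by (simp add: z_def)
  ultimately have "(z has_vector_derivative w t (z t)) (at t)" for t
    by simp
  moreover have "z s = q" by (simp add: z_def x)
  ultimately show ?thesis by blast
qed

text \<open>Both the starting time and the final time are free, since test functions are pulled back
  along \<open>fl t 0\<close>. The choice is harmless because Gronwall makes the solution
  unique.\<close>

definition fl :: "real \<Rightarrow> real \<Rightarrow> 'a \<Rightarrow> 'a" where
  "fl s t q = (SOME x. x s = q \<and> (\<forall>t. (x has_vector_derivative w t (x t)) (at t))) t"

lemma fl_self [simp]: "fl s s q = q"
  unfolding fl_def using someI_ex[OF solution_exists[of s q]] by simp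

lemma fl_has_vector_derivative: "((\<lambda>t. fl s t q) has_vector_derivative w t (fl s t q)) (at t within S)"
  unfolding fl_def
  by (rule has_vector_derivative_at_within) (use someI_ex[OF solution_exists[of s q]] in simp)

lemma continuous_on_fl_time: "continuous_on S (\<lambda>t. fl s t q)"
  unfolding continuous_on_eq_continuous_within
  by (intro ballI has_vector_derivative_continuous[OF fl_has_vector_derivative])

lemma solution_gronwall:
  assumes ab: "a \<le> b" and cx: "continuous_on {a..b} x" and cy: "continuous_on {a..b} y"
    and dx: "\<And>t. a < t \<Longrightarrow> t < b \<Longrightarrow> (x has_vector_derivative w t (x t)) (at t)"
    and dy: "\<And>t. a < t \<Longrightarrow> t < b \<Longrightarrow> (y has_vector_derivative w t (y t)) (at t)"
  shows "norm (x b - y b) \<le> exp (L * (b - a)) * norm (x a - y a)"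
    and "norm (x a - y a) \<le> exp (L * (b - a)) * norm (x b - y b)"
proof -
  have *: "norm (w t (x t) - w t (y t)) \<le> L * norm (x t - y t)" for t
    using w_lip[of t "x t" t "y t"] by simp
  note d = has_vector_derivative_diff[OF dx dy]
  show "norm (x b - y b) \<le> exp (L * (b - a)) * norm (x a - y a)"
    by (rule gronwall_pair(1)[OF ab continuous_on_diff[OF cx cy] d *])
  show "norm (x a - y a) \<le> exp (L * (b - a)) * norm (x b - y b)"
    by (rule gronwall_pair(2)[OF ab continuous_on_diff[OF cx cy] d *])
qed

lemma fl_lipschitz: "norm (fl s t p - fl s t q) \<le> exp (L * \<bar>t - s\<bar>) * norm (p - q)"
proof (cases "s \<le> t")
  case True
  from solution_gronwall(1)[OF this continuous_on_fl_time[of _ s p] continuous_on_fl_time[of _ s q]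
      fl_has_vector_derivative fl_has_vector_derivative]
  show ?thesis using True by simp
next
  case False
  then have "t \<le> s" by simp
  from solution_gronwall(2)[OF this continuous_on_fl_time[of _ s p] continuous_on_fl_time[of _ s q]
      fl_has_vector_derivative fl_has_vector_derivative]
  show ?thesis using False by simp
qed

text \<open>The equation is asked for only in the open interval, so the one-sided derivative that a
  solution has at its initial time does no harm.\<close>

lemma fl_unique:
  assumes "s \<le> t" "continuous_on {s..t} x" "x s = q"
    and "\<And>r. s < r \<Longrightarrow> r < t \<Longrightarrow> (x has_vector_derivative w r (x r)) (at r)"
  shows "x t = fl s t q"
  using solution_gronwall(1)[OF assms(1,2) continuous_on_fl_time[of _ s q] assms(4) fl_has_vector_derivative]
    assms(3) by simp

text \<open>Both sides solve the equation in \<open>u\<close> and agree at \<open>u = t\<close>. For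
  \<open>u < t\<close> the backward Gronwall estimate takes the place of forward uniqueness.\<close>

lemma fl_trans: "fl t u (fl s t q) = fl s u q"
proof (cases "t \<le> u")
  case True
  show ?thesis
    using fl_unique[OF True continuous_on_fl_time[of _ s q] refl fl_has_vector_derivative] by simp
next
  case False
  then have "u \<le> t" by simp
  from solution_gronwall(2)[OF this continuous_on_fl_time[of _ t "fl s t q"] continuous_on_fl_time[of _ s q]
      fl_has_vector_derivative fl_has_vector_derivative]
  show ?thesis by simp
qed

lemma fl_inverse [simp]: "fl t s (fl s t q) = q"
  by (simp add: fl_trans)

lemma fl_time_lipschitz: "norm (fl s t q - fl s u q) \<le> C * \<bar>t - u\<bar>"
proof -
  have "norm (fl s t q - fl s u q) \<le> C * norm (t - u)"
  proof (rule differentiable_bound[where S = UNIV])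
    show "((\<lambda>t. fl s t q) has_derivative (\<lambda>h. h *\<^sub>R w r (fl s r q))) (at r within UNIV)" for r
      using fl_has_vector_derivative by (simp add: has_vector_derivative_def)
    show "onorm (\<lambda>h. h *\<^sub>R w r (fl s r q)) \<le> C" for r
    proof (rule onorm_le)
      fix h :: real
      show "norm (h *\<^sub>R w r (fl s r q)) \<le> C * norm h"
        using mult_right_mono[OF w_bound, of "norm h" r "fl s r q"] by (simp add: mult.commute)
    qed
  qed auto
  then show ?thesis by simp
qed

lemma fl_bound: "norm (fl s t q - q) \<le> C * \<bar>t - s\<bar>"
  using fl_time_lipschitz[of s t q s] by simp

text \<open>The trajectory minus its tangent line has derivative
  \<open>w r (fl t r q) - w t q\<close>. Over time \<open>h\<close> the trajectory moves by at most
  \<open>C * h\<close>, so this is at most \<open>L * (1 + C) * h\<close>, and the mean value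
  inequality supplies the other factor \<open>h\<close>.\<close>

lemma fl_first_order: "0 \<le> h \<Longrightarrow> norm (fl t (t + h) q - q - h *\<^sub>R w t q) \<le> L * (1 + C) * h\<^sup>2"
proof -
  assume h: "0 \<le> h"
  define g where "g r = fl t r q - (r - t) *\<^sub>R w t q" for r
  have "norm (g (t + h) - g t) \<le> (L * (1 + C) * h) * norm ((t + h) - t)"
  proof (rule differentiable_bound[where S = "{t..t+h}"])
    fix r assume r: "r \<in> {t..t+h}"
    have "(g has_vector_derivative w r (fl t r q) - w t q) (at r within {t..t+h})"
      unfolding g_def by (auto intro!: derivative_eq_intros fl_has_vector_derivative)
    then show "(g has_derivative (\<lambda>k. k *\<^sub>R (w r (fl t r q) - w t q))) (at r within {t..t+h})"
      by (simp add: has_vector_derivative_def)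
    have "norm (w r (fl t r q) - w t q) \<le> L * (\<bar>r - t\<bar> + norm (fl t r q - q))" by (rule w_lip)
    also have "\<dots> \<le> L * (h + C * h)"
    proof (intro mult_left_mono add_mono)
      show "norm (fl t r q - q) \<le> C * h"
        using fl_bound[of t r q] r C_nonneg mult_left_mono[of "\<bar>r - t\<bar>" h C] by auto
    qed (use r L_pos in auto)
    also have "\<dots> = L * (1 + C) * h" by (simp add: algebra_simps)
    finally have *: "norm (w r (fl t r q) - w t q) \<le> L * (1 + C) * h" .
    show "onorm (\<lambda>k. k *\<^sub>R (w r (fl t r q) - w t q)) \<le> L * (1 + C) * h"
    proof (rule onorm_le)
      fix k :: real
      show "norm (k *\<^sub>R (w r (fl t r q) - w t q)) \<le> L * (1 + C) * h * norm k"
        using mult_right_mono[OF *, of "norm k"] by (simp add: mult.commute mult.left_commute)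
    qed
  qed (use h in auto)
  then show ?thesis using h by (simp add: g_def power2_eq_square algebra_simps)
qed

lemma continuous_on_fl: "continuous_on S (\<lambda>z. fl s (fst z) (snd z))"
proof -
  have "isCont (\<lambda>z. fl s (fst z) (snd z)) z" for z
  proof -
    have "((\<lambda>y. exp (L * \<bar>fst y - s\<bar>) * norm (snd y - snd z) + C * \<bar>fst y - fst z\<bar>)
        \<longlongrightarrow> exp (L * \<bar>fst z - s\<bar>) * norm (snd z - snd z) + C * \<bar>fst z - fst z\<bar>) (at z)"
      by (intro tendsto_intros)
    then have lim: "((\<lambda>y. exp (L * \<bar>fst y - s\<bar>) * norm (snd y - snd z) + C * \<bar>fst y - fst z\<bar>) \<longlongrightarrow> 0) (at z)"
      by simp
    have "((\<lambda>y. fl s (fst y) (snd y) - fl s (fst z) (snd z)) \<longlongrightarrow> 0) (at z)"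
    proof (rule Lim_null_comparison[OF _ lim])
      show "\<forall>\<^sub>F y in at z. norm (fl s (fst y) (snd y) - fl s (fst z) (snd z)) \<le>
          exp (L * \<bar>fst y - s\<bar>) * norm (snd y - snd z) + C * \<bar>fst y - fst z\<bar>"
      proof (rule always_eventually, rule allI)
        fix y :: "real \<times> 'a"
        have "norm (fl s (fst y) (snd y) - fl s (fst z) (snd z))
          \<le> norm (fl s (fst y) (snd y) - fl s (fst y) (snd z)) + norm (fl s (fst y) (snd z) - fl s (fst z) (snd z))"
          by norm
        with fl_lipschitz[of s "fst y" "snd y" "snd z"] fl_time_lipschitz[of s "fst y" "snd z" "fst z"]
        show "norm (fl s (fst y) (snd y) - fl s (fst z) (snd z)) \<le>
          exp (L * \<bar>fst y - s\<bar>) * norm (snd y - snd z) + C * \<bar>fst y - fst z\<bar>" by linarith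
      qed
    qed
    then show ?thesis by (simp add: isCont_def LIM_zero_iff)
  qed
  then show ?thesis by (simp add: continuous_at_imp_continuous_on)
qed

lemma continuous_on_fl_comp [continuous_intros]:
  "continuous_on S f \<Longrightarrow> continuous_on S g \<Longrightarrow> continuous_on S (\<lambda>r. fl s (f r) (g r))"
  using continuous_on_compose2[OF continuous_on_fl[of UNIV], of S "\<lambda>r. (f r, g r)"]
  by (auto intro: continuous_intros)

end

section \<open>A compactly supported bump\<close>

lemma lborel_integral_shift:
  fixes f :: "'a::euclidean_space \<Rightarrow> real"
  assumes "f \<in> borel_measurable borel"
  shows "(LBINT x. f (x + a)) = (LBINT x. f x)"
proof -
  have "(LBINT x. f x) = (\<integral>x. f x \<partial>distr lborel borel ((+) a))"
    by (simp only: lborel_distr_plus)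
  also have "\<dots> = (LBINT x. f (a + x))"
    by (rule integral_distr) (use assms in auto)
  finally show ?thesis by (simp add: add.commute)
qed

lemma measure_lborel_cball_center:
  "measure lborel (cball (b::'a::euclidean_space) r) = measure lborel (cball (0::'a) r)"
proof -
  have "measure lborel (cball b r) = (LBINT x. indicator (cball b r) x)" by simp
  also have "\<dots> = (LBINT x. indicator (cball b r) (x + b))"
    by (rule lborel_integral_shift[symmetric]) (intro borel_measurable_indicator; simp)
  also have "\<dots> = (LBINT x. indicator (cball (0::'a) r) x)"
    by (intro Bochner_Integration.integral_cong) (auto simp: indicator_def dist_norm norm_minus_commute)
  finally show ?thesis by simp
qed

text \<open>The ball in the bound is centred at 0 rather than at \<open>b\<close>, which makes later
  estimates uniform in the centre of the test function.\<close>

lemma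
  fixes f :: "'a::euclidean_space \<Rightarrow> real"
  assumes f: "f \<in> borel_measurable borel" and le: "\<And>x. \<bar>f x\<bar> \<le> c"
    and supp: "\<And>x. r < norm (x - b) \<Longrightarrow> f x = 0"
  shows integrable_bounded_support: "integrable lborel f"
    and integral_bounded_support: "\<bar>LBINT x. f x\<bar> \<le> c * measure lborel (cball (0::'a) r)"
proof -
  have g: "integrable lborel (\<lambda>x. c * indicator (cball b r) x)"
    using emeasure_compact_finite[OF compact_cball, of b r]
    by (intro integrable_mult_right integrable_real_indicator) auto
  have le': "\<bar>f x\<bar> \<le> c * indicator (cball b r) x" for x
    using le[of x] supp[of x] by (auto simp: indicator_def dist_norm norm_minus_commute not_le)
  show 1: "integrable lborel f"
    by (rule Bochner_Integration.integrable_bound[OF g]) (use f le' order_trans[OF le' abs_ge_self] in auto)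
  have "\<bar>LBINT x. f x\<bar> \<le> (LBINT x. \<bar>f x\<bar>)" by (rule integral_abs_bound)
  also have "\<dots> \<le> (LBINT x. c * indicator (cball b r) x)"
    by (rule integral_mono) (use 1 g le' in auto)
  also have "\<dots> = c * measure lborel (cball (0::'a) r)"
    using measure_lborel_cball_center[of b r] by simp
  finally show "\<bar>LBINT x. f x\<bar> \<le> c * measure lborel (cball (0::'a) r)" .
qed

text \<open>Squaring the positive part makes the bump continuously differentiable with Lipschitz
  gradient, enough for a Taylor estimate with quadratic remainder. It is not normalised; its
  integral is divided out where averages are taken.\<close>

definition bump :: "real \<Rightarrow> 'a::euclidean_space \<Rightarrow> real" where
  "bump e q = (max 0 (1 - (norm q / e)\<^sup>2))\<^sup>2"

definition bump_grad :: "real \<Rightarrow> 'a::euclidean_space \<Rightarrow> 'a" where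
  "bump_grad e q = (- (4 / e\<^sup>2) * max 0 (1 - (norm q / e)\<^sup>2)) *\<^sub>R q"

text \<open>The Taylor constant: the first summand is the square of a Lipschitz constant of
  \<open>1 - (norm q / e)\<^sup>2\<close> near the support, the second comes from the quadratic term
  of that polynomial times the derivative of the squared cutoff.\<close>

definition bump_const :: "real \<Rightarrow> real" where
  "bump_const e = ((2 * e + 3) / e\<^sup>2)\<^sup>2 + 2 / e\<^sup>2"

lemma bump_const_nonneg: "0 \<le> bump_const e"
  by (simp add: bump_const_def)

lemma cutoff_outside:
  assumes "0 < e" "e \<le> norm q"
  shows "max 0 (1 - (norm q / e)\<^sup>2) = 0"
proof -
  have "1 \<le> norm q / e" using assms by simp
  then show ?thesis by (simp add: one_le_power)
qed

lemma bump_outside: "0 < e \<Longrightarrow> e \<le> norm q \<Longrightarrow> bump e q = 0"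
  unfolding bump_def by (simp only: cutoff_outside) simp

lemma bump_grad_outside: "0 < e \<Longrightarrow> e \<le> norm q \<Longrightarrow> bump_grad e q = 0"
  unfolding bump_grad_def by (simp only: cutoff_outside) simp

lemma bump_nonneg [simp]: "0 \<le> bump e q"
  by (simp add: bump_def)

lemma bump_le_1: "bump e q \<le> 1"
  unfolding bump_def by (intro power_le_one) (auto simp: max_def)

lemma bump_minus [simp]: "bump e (- q) = bump e q"
  by (simp add: bump_def)

lemma continuous_on_bump [continuous_intros]:
  "continuous_on S f \<Longrightarrow> continuous_on S (\<lambda>x. bump e (f x))"
  unfolding bump_def divide_inverse by (intro continuous_intros)

lemma continuous_on_bump_grad [continuous_intros]:
  "continuous_on S f \<Longrightarrow> continuous_on S (\<lambda>x. bump_grad e (f x))"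
  unfolding bump_grad_def divide_inverse[of "norm _"] by (intro continuous_intros)

lemma norm_bump_grad_le:
  assumes "0 < e" shows "norm (bump_grad e q) \<le> 4 / e"
proof (cases "e \<le> norm q")
  case True
  then show ?thesis using assms by (simp add: bump_grad_outside)
next
  case False
  have "norm (bump_grad e q) = (4 / e\<^sup>2) * max 0 (1 - (norm q / e)\<^sup>2) * norm q"
    by (simp add: bump_grad_def abs_mult)
  also have "\<dots> \<le> (4 / e\<^sup>2) * 1 * e"
    using False assms by (intro mult_mono) auto
  also have "\<dots> = 4 / e" using assms by (simp add: power2_eq_square)
  finally show ?thesis .
qed

text \<open>The derivative \<open>2 * max 0 s\<close> of the squared positive part is 2-Lipschitz,
  hence the remainder. Cases on the signs avoid the second derivative, which is missing at
  0.\<close>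

lemma square_cutoff_taylor:
  fixes s s' :: real
  shows "\<bar>(max 0 s')\<^sup>2 - (max 0 s)\<^sup>2 - 2 * max 0 s * (s' - s)\<bar> \<le> (s' - s)\<^sup>2"
proof -
  consider "0 \<le> s" "0 \<le> s'" | "0 \<le> s" "s' < 0" | "s < 0" "0 \<le> s'" | "s < 0" "s' < 0" by linarith
  then show ?thesis
  proof cases
    case 1
    then have "(max 0 s')\<^sup>2 - (max 0 s)\<^sup>2 - 2 * max 0 s * (s' - s) = (s' - s)\<^sup>2"
      by (simp add: power2_eq_square algebra_simps max_def)
    then show ?thesis by simp
  next
    case 2
    have "s * s' \<le> 0" using 2 by (simp add: mult_nonneg_nonpos)
    moreover have "(max 0 s')\<^sup>2 - (max 0 s)\<^sup>2 - 2 * max 0 s * (s' - s) = s * s - 2 * (s * s')"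
      using 2 by (simp add: power2_eq_square algebra_simps max_def)
    moreover have "(s' - s)\<^sup>2 = s * s - 2 * (s * s') + s' * s'"
      by (simp add: power2_eq_square algebra_simps)
    moreover have "0 \<le> s * s" "0 \<le> s' * s'" by simp_all
    ultimately show ?thesis by linarith
  next
    case 3
    have "s * s' \<le> 0" using 3 by (simp add: mult_nonpos_nonneg)
    moreover have "(max 0 s')\<^sup>2 - (max 0 s)\<^sup>2 - 2 * max 0 s * (s' - s) = s' * s'"
      using 3 by (simp add: power2_eq_square algebra_simps max_def)
    moreover have "(s' - s)\<^sup>2 = s * s - 2 * (s * s') + s' * s'"
      by (simp add: power2_eq_square algebra_simps)
    moreover have "0 \<le> s * s" "0 \<le> s' * s'" by simp_all
    ultimately show ?thesis by linarith
  qed (simp add: max_def)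
qed

lemma bump_taylor:
  assumes e: "0 < e" and d: "norm d \<le> 1"
  shows "\<bar>bump e (q + d) - bump e q - bump_grad e q \<bullet> d\<bar> \<le> bump_const e * (norm d)\<^sup>2"
proof (cases "e + 1 \<le> norm q")
  \<comment> \<open>Since \<open>norm d \<le> 1\<close>, neither \<open>q\<close> nor
    \<open>q + d\<close> can then lie inside the support.\<close>
  case True
  then have "e \<le> norm (q + d)" using d norm_diff_ineq[of q d] by linarith
  moreover have "e \<le> norm q" using True by simp
  ultimately show ?thesis using e by (simp add: bump_outside bump_grad_outside bump_const_nonneg)
next
  case False
  define s where "s = 1 - (norm q / e)\<^sup>2"
  define s' where "s' = 1 - (norm (q + d) / e)\<^sup>2"
  have eq: "s' - s = - (2 * (q \<bullet> d) + (norm d)\<^sup>2) / e\<^sup>2"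
    using e by (simp add: s_def s'_def power_divide power2_norm_eq_inner inner_add_left inner_add_right
        inner_commute diff_divide_distrib add_divide_distrib)
  have "\<bar>s' - s\<bar> = \<bar>2 * (q \<bullet> d) + (norm d)\<^sup>2\<bar> / e\<^sup>2"
    unfolding eq by (simp only: abs_divide abs_minus_cancel) simp
  also have "\<dots> \<le> (2 * (norm q * norm d) + 1 * norm d) / e\<^sup>2"
  proof (rule divide_right_mono)
    have "(norm d)\<^sup>2 \<le> 1 * norm d" unfolding power2_eq_square using d by (intro mult_right_mono) auto
    with Cauchy_Schwarz_ineq2[of q d]
    show "\<bar>2 * (q \<bullet> d) + (norm d)\<^sup>2\<bar> \<le> 2 * (norm q * norm d) + 1 * norm d"
      by (smt (verit) zero_le_power2)
  qed simp
  also have "\<dots> = (2 * norm q + 1) * norm d / e\<^sup>2" by (simp add: algebra_simps)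
  \<comment> \<open>Here \<open>norm q < e + 1\<close>, which gives
    \<open>2 * norm q + 1 \<le> 2 * e + 3\<close>.\<close>
  also have "\<dots> \<le> (2 * e + 3) * norm d / e\<^sup>2"
    using False by (intro divide_right_mono mult_right_mono) auto
  finally have 1: "\<bar>s' - s\<bar> \<le> (2 * e + 3) / e\<^sup>2 * norm d" by simp
  have "(s' - s)\<^sup>2 \<le> ((2 * e + 3) / e\<^sup>2 * norm d)\<^sup>2"
    using power_mono[OF 1, of 2] by simp
  then have 2: "(s' - s)\<^sup>2 \<le> ((2 * e + 3) / e\<^sup>2)\<^sup>2 * (norm d)\<^sup>2" by (simp only: power_mult_distrib)
  have "2 * max 0 s * (s' - s) = bump_grad e q \<bullet> d - 2 * max 0 s * (norm d)\<^sup>2 / e\<^sup>2"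
    unfolding eq bump_grad_def s_def[symmetric]
    by (simp add: algebra_simps diff_divide_distrib add_divide_distrib)
  moreover have "2 * max 0 s * (norm d)\<^sup>2 / e\<^sup>2 \<le> 2 * 1 * (norm d)\<^sup>2 / e\<^sup>2"
    by (intro divide_right_mono mult_right_mono mult_left_mono) (auto simp: s_def)
  moreover have "0 \<le> 2 * max 0 s * (norm d)\<^sup>2 / e\<^sup>2" by simp
  moreover have "bump_const e * (norm d)\<^sup>2 = ((2 * e + 3) / e\<^sup>2)\<^sup>2 * (norm d)\<^sup>2 + 2 * 1 * (norm d)\<^sup>2 / e\<^sup>2"
    by (simp add: bump_const_def algebra_simps)
  ultimately show ?thesis
    using square_cutoff_taylor[of s' s] 2
    unfolding bump_def s_def[symmetric] s'_def[symmetric] by linarith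
qed

lemma borel_measurable_bump [measurable]: "bump e \<in> borel_measurable borel"
  by (intro borel_measurable_continuous_onI continuous_on_bump continuous_on_id)

lemma integral_bump_pos:
  assumes e: "0 < e"
  shows "0 < (LBINT q. bump e (q::'a::euclidean_space))"
proof -
  have int: "integrable lborel (bump e :: 'a \<Rightarrow> real)"
    by (rule integrable_bounded_support[where c = 1 and r = e and b = 0])
       (use e bump_le_1[of e] in \<open>auto intro: bump_outside\<close>)
  \<comment> \<open>On the ball of half the radius the cutoff is at least \<open>1 - 1/4\<close>,
    and its square is at least 9/16.\<close>
  have "0 < (9/16) * measure lborel (cball (0::'a) (e/2))"
    using content_cball_pos[of "e/2" "0::'a"] e by simp
  also have "\<dots> = (LBINT q. (9/16) * indicator (cball (0::'a) (e/2)) q)" by simp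
  also have "\<dots> \<le> (LBINT q. bump e (q::'a))"
  proof (rule integral_mono[OF _ int])
    show "integrable lborel (\<lambda>q::'a. (9/16) * indicator (cball 0 (e/2)) q :: real)"
      using emeasure_compact_finite[OF compact_cball, of "0::'a" "e/2"]
      by (intro integrable_mult_right integrable_real_indicator) auto
    fix q :: 'a
    show "(9/16) * indicator (cball 0 (e/2)) q \<le> bump e q"
    proof (cases "norm q \<le> e / 2")
      case True
      then have "norm q / e \<le> 1/2" using e by (simp add: field_simps)
      then have "(norm q / e)\<^sup>2 \<le> (1/2)\<^sup>2" using e by (intro power_mono) auto
      then have "3/4 \<le> 1 - (norm q / e)\<^sup>2" unfolding power_divide by simp
      then have "3/4 \<le> max 0 (1 - (norm q / e)\<^sup>2)" by (rule max.coboundedI2)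
      then have "(3/4)\<^sup>2 \<le> bump e q" unfolding bump_def by (rule power_mono) simp
      then show ?thesis using True by (simp add: power2_eq_square)
    qed (simp add: indicator_def)
  qed
  finally show ?thesis .
qed

text \<open>A fundamental theorem of calculus for Lipschitz functions that never differentiates
  \<open>m\<close>. With an antiderivative \<open>g\<close>, the integral becomes the mean of
  \<open>m\<close> over \<open>{t+h..t+h+k}\<close> minus its mean over \<open>{t..t+k}\<close>, and
  each mean is within \<open>K * k\<close> of the value at the left end.\<close>

lemma difference_quotient_integral:
  fixes m :: "real \<Rightarrow> real"
  assumes lip: "\<And>x y. \<bar>m x - m y\<bar> \<le> K * \<bar>x - y\<bar>" and h: "0 \<le> h" and k: "0 < k"
  shows "\<bar>integral {t..t+h} (\<lambda>s. (m (s + k) - m s) / k) - (m (t + h) - m t)\<bar> \<le> 2 * K * k"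
proof -
  have "0 \<le> K" using lip[of 0 1] by simp
  have "K-lipschitz_on UNIV m" by (rule lipschitz_onI) (use lip \<open>0 \<le> K\<close> in \<open>auto simp: dist_real_def\<close>)
  then have cont: "continuous_on S m" for S
    by (meson continuous_on_subset lipschitz_on_continuous_on subset_UNIV)
  \<comment> \<open>The margin 1 on both sides makes all relevant points interior, so the
    derivatives of \<open>g\<close> there are two-sided.\<close>
  obtain g where g: "\<And>x. x \<in> {t - 1..t + h + k + 1} \<Longrightarrow>
      (g has_vector_derivative m x) (at x within {t - 1..t + h + k + 1})"
    by (rule antiderivative_continuous[OF cont]) blast
  have gd: "(g has_real_derivative m x) (at x)" if "t \<le> x" "x \<le> t + h + k" for x
  proof -
    have "at x within {t - 1..t + h + k + 1} = at x"
      using that by (intro at_within_interior) (auto simp: interior_atLeastAtMost_real)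
    then show ?thesis using g[of x] that by (simp add: has_real_derivative_iff_has_vector_derivative)
  qed
  have diff: "\<bar>(g (x + k) - g x) / k - m x\<bar> \<le> K * k" if x: "t \<le> x" "x \<le> t + h" for x
  proof -
    obtain z where z: "x < z" "z < x + k" "g (x + k) - g x = (x + k - x) * m z"
      using MVT2[of x "x + k" g m] gd x k by auto
    have "\<bar>m z - m x\<bar> \<le> K * \<bar>z - x\<bar>" by (rule lip)
    also have "\<dots> \<le> K * k" using z \<open>0 \<le> K\<close> by (intro mult_left_mono) auto
    finally show ?thesis using z k by simp
  qed
  have "((\<lambda>s. (m (s + k) - m s) / k) has_integral
      ((g (t + h + k) - g (t + h)) / k - (g (t + k) - g t) / k)) {t..t+h}"
  proof (rule fundamental_theorem_of_calculus[where f = "\<lambda>s. (g (s + k) - g s) / k"])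
    fix x assume x: "x \<in> {t..t+h}"
    have "((\<lambda>s. g (s + k)) has_real_derivative m (x + k)) (at x)"
      using gd[of "x + k"] x k by (simp add: DERIV_shift[symmetric])
    then have "((\<lambda>s. (g (s + k) - g s) / k) has_real_derivative (m (x + k) - m x) / k) (at x)"
      using gd[of x] x k by (intro DERIV_cdivide DERIV_diff) auto
    then show "((\<lambda>s. (g (s + k) - g s) / k) has_vector_derivative (m (x + k) - m x) / k) (at x within {t..t + h})"
      unfolding has_real_derivative_iff_has_vector_derivative by (rule has_vector_derivative_at_within)
  qed (use h in simp)
  then have "integral {t..t+h} (\<lambda>s. (m (s + k) - m s) / k) =
      (g (t + h + k) - g (t + h)) / k - (g (t + k) - g t) / k"
    by (rule integral_unique)
  then have "integral {t..t+h} (\<lambda>s. (m (s + k) - m s) / k) - (m (t + h) - m t) =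
      ((g (t + h + k) - g (t + h)) / k - m (t + h)) - ((g (t + k) - g t) / k - m t)" by simp
  moreover have "\<bar>(g (t + h + k) - g (t + h)) / k - m (t + h)\<bar> \<le> K * k" using diff[of "t + h"] h by simp
  moreover have "\<bar>(g (t + k) - g t) / k - m t\<bar> \<le> K * k" using diff[of t] h by simp
  ultimately show ?thesis by linarith
qed

section \<open>The continuity equation in weak form\<close>

text \<open>The continuity equation is recorded along the sequence of increments
  \<open>1 / Suc k\<close>, the form in which dominated convergence consumes it; it is known for
  times below \<open>N\<close> and points of \<open>\<Omega>\<close>. Velocity and current are tied
  only where the density exceeds the threshold \<open>d\<close>, because below it the velocity is
  regularised.\<close>

locale transport = lipschitz_field w L C
  for w :: "real \<Rightarrow> 'a::euclidean_space \<Rightarrow> 'a" and L C :: real +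
  fixes R :: "real \<Rightarrow> 'a \<Rightarrow> real" and Jv :: "real \<Rightarrow> 'a \<Rightarrow> 'a"
    and LR BR LJ BJ d N :: real and \<Omega> :: "'a set"
  assumes R_lip: "\<bar>R s p - R t q\<bar> \<le> LR * (\<bar>s - t\<bar> + norm (p - q))"
    and R_nonneg: "0 \<le> R t q" and R_le: "R t q \<le> BR"
    and J_lip: "norm (Jv s p - Jv t q) \<le> LJ * (\<bar>s - t\<bar> + norm (p - q))"
    and J_le: "norm (Jv t q) \<le> BJ"
    and R_w: "d < R t q \<Longrightarrow> R t q *\<^sub>R w t q = Jv t q"
    and open_\<Omega>: "open \<Omega>"
    and continuity_eq: "AE z in lborel. 0 < fst z \<and> fst z < N \<and> snd z \<in> \<Omega> \<longrightarrow>
      (\<lambda>k. (R (fst z + 1 / Suc k) (snd z) - R (fst z) (snd z)) / (1 / Suc k)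
        + (\<Sum>i\<in>Basis. (Jv (fst z) (snd z + (1 / Suc k) *\<^sub>R i) \<bullet> i - Jv (fst z) (snd z) \<bullet> i) / (1 / Suc k)))
      \<longlonglongrightarrow> 0"
begin

lemma LR_nonneg: "0 \<le> LR"
  using R_lip[of 0 0 1 0] by simp

lemma LJ_nonneg: "0 \<le> LJ"
  using order_trans[OF norm_ge_zero J_lip[of 0 0 1 0]] by simp

lemma BR_nonneg: "0 \<le> BR"
  using R_nonneg[of 0 0] R_le[of 0 0] by simp

lemma BJ_nonneg: "0 \<le> BJ"
  using order_trans[OF norm_ge_zero J_le[of 0 0]] .

lemma continuous_on_R: "continuous_on S (\<lambda>z. R (fst z) (snd z))"
  by (rule continuous_on_lipschitz_pair[OF LR_nonneg]) (simp add: R_lip)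

lemma continuous_on_R_comp [continuous_intros]:
  "continuous_on S f \<Longrightarrow> continuous_on S g \<Longrightarrow> continuous_on S (\<lambda>r. R (f r) (g r))"
  using continuous_on_compose2[OF continuous_on_R[of UNIV], of S "\<lambda>r. (f r, g r)"]
  by (auto intro: continuous_on_Pair)

lemma continuous_on_J: "continuous_on S (\<lambda>z. Jv (fst z) (snd z))"
  by (rule continuous_on_lipschitz_pair[OF LJ_nonneg J_lip])

lemma continuous_on_J_comp [continuous_intros]:
  "continuous_on S f \<Longrightarrow> continuous_on S g \<Longrightarrow> continuous_on S (\<lambda>r. Jv (f r) (g r))"
  using continuous_on_compose2[OF continuous_on_J[of UNIV], of S "\<lambda>r. (f r, g r)"]
  by (auto intro: continuous_on_Pair)

definition vol :: "real \<Rightarrow> real" where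
  "vol r = measure lborel (cball (0::'a) r)"

lemma vol_nonneg: "0 \<le> vol r"
  by (simp add: vol_def)

text \<open>Freezing the flux at the initial time of a step of length \<open>h\<close> costs a
  multiple of \<open>h\<close>, hence a multiple of \<open>h\<^sup>2\<close> after integration over
  the step.\<close>

lemma bump_flux_variation:
  assumes e: "0 < e"
  shows "\<bar>(LBINT q. bump_grad e (q - b) \<bullet> Jv s q) - (LBINT q. bump_grad e (q - b) \<bullet> Jv t q)\<bar>
    \<le> 4 / e * LJ * \<bar>s - t\<bar> * vol e"
proof -
  have int: "integrable lborel (\<lambda>q. bump_grad e (q - b) \<bullet> Jv s q)" for s
  proof (rule integrable_bounded_support[where c = "4 / e * BJ" and b = b and r = e])
    show "(\<lambda>q. bump_grad e (q - b) \<bullet> Jv s q) \<in> borel_measurable borel"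
      by (intro borel_measurable_continuous_onI continuous_intros)
    show "\<bar>bump_grad e (q - b) \<bullet> Jv s q\<bar> \<le> 4 / e * BJ" for q
      by (rule order_trans[OF Cauchy_Schwarz_ineq2])
         (intro mult_mono norm_bump_grad_le J_le e BJ_nonneg norm_ge_zero, use e in auto)
  qed (use e in \<open>simp add: bump_grad_outside\<close>)
  have "(LBINT q. bump_grad e (q - b) \<bullet> Jv s q) - (LBINT q. bump_grad e (q - b) \<bullet> Jv t q)
      = (LBINT q. bump_grad e (q - b) \<bullet> (Jv s q - Jv t q))"
    unfolding inner_diff_right by (rule Bochner_Integration.integral_diff[symmetric]) (rule int)+
  also have "\<bar>\<dots>\<bar> \<le> 4 / e * (LJ * \<bar>s - t\<bar>) * vol e"
    unfolding vol_def
  proof (rule integral_bounded_support[where b = b])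
    show "(\<lambda>q. bump_grad e (q - b) \<bullet> (Jv s q - Jv t q)) \<in> borel_measurable borel"
      by (intro borel_measurable_continuous_onI continuous_intros)
    show "\<bar>bump_grad e (q - b) \<bullet> (Jv s q - Jv t q)\<bar> \<le> 4 / e * (LJ * \<bar>s - t\<bar>)" for q
      by (rule order_trans[OF Cauchy_Schwarz_ineq2], intro mult_mono norm_bump_grad_le e)
         (use J_lip[of s q t q] e in auto)
  qed (use e in \<open>simp add: bump_grad_outside\<close>)
  finally show ?thesis by simp
qed

lemma bump_mass_lipschitz:
  assumes e: "0 < e"
  shows "integrable lborel (\<lambda>q. bump e (q - b) * R s q)"
    and "\<bar>(LBINT q. bump e (q - b) * R s q) - (LBINT q. bump e (q - b) * R t q)\<bar>
      \<le> LR * vol e * \<bar>s - t\<bar>"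
proof -
  have bd: "\<bar>bump e (q - b) * x\<bar> \<le> y" if "\<bar>x\<bar> \<le> y" for q x y
    using mult_mono[OF bump_le_1[of e "q - b"] that] by (simp add: abs_mult)
  show int: "integrable lborel (\<lambda>q. bump e (q - b) * R s q)" for s
  proof (rule integrable_bounded_support[where c = BR and b = b and r = e])
    show "(\<lambda>q. bump e (q - b) * R s q) \<in> borel_measurable borel"
      by (intro borel_measurable_continuous_onI continuous_intros)
    show "\<bar>bump e (q - b) * R s q\<bar> \<le> BR" for q
      by (rule bd) (use R_nonneg R_le in auto)
  qed (use e in \<open>simp add: bump_outside\<close>)
  have "(LBINT q. bump e (q - b) * R s q) - (LBINT q. bump e (q - b) * R t q)
      = (LBINT q. bump e (q - b) * (R s q - R t q))"
    unfolding right_diff_distrib by (rule Bochner_Integration.integral_diff[symmetric]) (rule int)+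
  also have "\<bar>\<dots>\<bar> \<le> (LR * \<bar>s - t\<bar>) * vol e"
    unfolding vol_def
  proof (rule integral_bounded_support[where b = b])
    show "(\<lambda>q. bump e (q - b) * (R s q - R t q)) \<in> borel_measurable borel"
      by (intro borel_measurable_continuous_onI continuous_intros)
    show "\<bar>bump e (q - b) * (R s q - R t q)\<bar> \<le> LR * \<bar>s - t\<bar>" for q
      by (rule bd) (use R_lip[of s q t q] in simp)
  qed (use e in \<open>simp add: bump_outside\<close>)
  finally show "\<bar>(LBINT q. bump e (q - b) * R s q) - (LBINT q. bump e (q - b) * R t q)\<bar>
      \<le> LR * vol e * \<bar>s - t\<bar>" by (simp add: mult_ac)
qed

definition dquot :: "real \<Rightarrow> real \<Rightarrow> 'a \<Rightarrow> real" where
  "dquot k t q = (R (t + k) q - R t q) / k + (\<Sum>i\<in>Basis. (Jv t (q + k *\<^sub>R i) \<bullet> i - Jv t q \<bullet> i) / k)"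

text \<open>The bound is free of \<open>k\<close>, so it dominates the whole sequence of difference
  quotients.\<close>

lemma dquot_le:
  assumes k: "0 < k"
  shows "\<bar>dquot k t q\<bar> \<le> LR + DIM('a) * LJ"
proof -
  have "\<bar>(R (t + k) q - R t q) / k\<bar> \<le> LR"
    using R_lip[of "t + k" q t q] k by (simp add: field_simps)
  moreover have "\<bar>\<Sum>i\<in>Basis. (Jv t (q + k *\<^sub>R i) \<bullet> i - Jv t q \<bullet> i) / k\<bar> \<le> DIM('a) * LJ"
  proof (rule order_trans[OF sum_abs], rule sum_bounded_above)
    fix i :: 'a assume i: "i \<in> Basis"
    have "\<bar>(Jv t (q + k *\<^sub>R i) - Jv t q) \<bullet> i\<bar> \<le> norm (Jv t (q + k *\<^sub>R i) - Jv t q)"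
      using i by (rule Basis_le_norm)
    also have "\<dots> \<le> LJ * k"
      using J_lip[of t "q + k *\<^sub>R i" t q] i k by simp
    finally show "\<bar>(Jv t (q + k *\<^sub>R i) \<bullet> i - Jv t q \<bullet> i) / k\<bar> \<le> LJ"
      using k by (simp add: inner_diff_left field_simps)
  qed
  ultimately show ?thesis unfolding dquot_def by linarith
qed

lemma continuous_on_dquot [continuous_intros]:
  "continuous_on S f \<Longrightarrow> continuous_on S g \<Longrightarrow> continuous_on S (\<lambda>x. dquot k (f x) (g x))"
  unfolding dquot_def divide_inverse by (intro continuous_intros)

text \<open>Summation by parts moves the spatial differences from \<open>Jv\<close> to the bump.\<close>

lemma bump_dquot_integral:
  assumes e: "0 < e" and k: "0 < k" "k \<le> 1"
  shows "\<bar>(LBINT q. bump e (q - b) * dquot k s q)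
      - ((LBINT q. bump e (q - b) * R (s + k) q) - (LBINT q. bump e (q - b) * R s q)) / k
      + (LBINT q. bump_grad e (q - b) \<bullet> Jv s q)\<bar>
    \<le> DIM('a) * (bump_const e * BJ * vol (e + 1)) * k"
proof -
  have intJ: "integrable lborel (\<lambda>q. bump e (q - b) * (Jv s (q + c) \<bullet> i))" if i: "i \<in> Basis" for c i
  proof (rule integrable_bounded_support[where c = BJ and b = b and r = e])
    show "(\<lambda>q. bump e (q - b) * (Jv s (q + c) \<bullet> i)) \<in> borel_measurable borel"
      by (intro borel_measurable_continuous_onI continuous_intros)
    show "\<bar>bump e (q - b) * (Jv s (q + c) \<bullet> i)\<bar> \<le> BJ" for q
      using mult_mono[OF bump_le_1[of e "q - b"] order_trans[OF Basis_le_norm[OF i] J_le[of s "q + c"]]]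
      by (simp add: abs_mult)
  qed (use e in \<open>simp add: bump_outside\<close>)
  have intS: "integrable lborel (\<lambda>q. bump e (q - b - k *\<^sub>R i) * (Jv s q \<bullet> i))" if i: "i \<in> Basis" for i
  proof (rule integrable_bounded_support[where c = BJ and b = "b + k *\<^sub>R i" and r = e])
    show "(\<lambda>q. bump e (q - b - k *\<^sub>R i) * (Jv s q \<bullet> i)) \<in> borel_measurable borel"
      by (intro borel_measurable_continuous_onI continuous_intros)
    show "\<bar>bump e (q - b - k *\<^sub>R i) * (Jv s q \<bullet> i)\<bar> \<le> BJ" for q
      using mult_mono[OF bump_le_1[of e "q - b - k *\<^sub>R i"] order_trans[OF Basis_le_norm[OF i] J_le[of s q]]]
      by (simp add: abs_mult)
  qed (use e in \<open>simp add: bump_outside diff_diff_eq\<close>)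
  have intG: "integrable lborel (\<lambda>q. (bump_grad e (q - b) \<bullet> i) * (Jv s q \<bullet> i))" if i: "i \<in> Basis" for i
  proof (rule integrable_bounded_support[where c = "4 / e * BJ" and b = b and r = e])
    show "(\<lambda>q. (bump_grad e (q - b) \<bullet> i) * (Jv s q \<bullet> i)) \<in> borel_measurable borel"
      by (intro borel_measurable_continuous_onI continuous_intros)
    show "\<bar>(bump_grad e (q - b) \<bullet> i) * (Jv s q \<bullet> i)\<bar> \<le> 4 / e * BJ" for q
      unfolding abs_mult
      by (intro mult_mono order_trans[OF Basis_le_norm[OF i] J_le]
          order_trans[OF Basis_le_norm[OF i] norm_bump_grad_le] e) (use e in auto)
  qed (use e in \<open>simp add: bump_grad_outside\<close>)
  \<comment> \<open>The error of replacing the backward difference quotient of the bump by minus its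
    partial derivative; the Taylor estimate makes it a multiple of \<open>k\<close>, and the unit
    step keeps its support within radius \<open>e + 1\<close>.\<close>
  define T where "T i q = ((bump e (q - b - k *\<^sub>R i) - bump e (q - b)) / k + bump_grad e (q - b) \<bullet> i) * (Jv s q \<bullet> i)"
    for i q
  have T: "\<bar>LBINT q. T i q\<bar> \<le> (bump_const e * k * BJ) * vol (e + 1)" if i: "i \<in> Basis" for i
    unfolding vol_def
  proof (rule integral_bounded_support[where b = b])
    show "(\<lambda>q. T i q) \<in> borel_measurable borel"
      unfolding T_def divide_inverse by (intro borel_measurable_continuous_onI continuous_intros)
    show "T i q = 0" if "e + 1 < norm (q - b)" for q
    proof -
      have "e \<le> norm (q - b - k *\<^sub>R i)"
        using that norm_triangle_ineq2[of "q - b" "k *\<^sub>R i"] i k by simp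
      with that e show ?thesis by (simp add: T_def bump_outside bump_grad_outside)
    qed
    fix q
    have "\<bar>bump e (q - b + (- k) *\<^sub>R i) - bump e (q - b) - bump_grad e (q - b) \<bullet> ((- k) *\<^sub>R i)\<bar>
        \<le> bump_const e * (norm ((- k) *\<^sub>R i))\<^sup>2"
      using i k by (intro bump_taylor e) auto
    then have "\<bar>k * ((bump e (q - b - k *\<^sub>R i) - bump e (q - b)) / k + bump_grad e (q - b) \<bullet> i)\<bar> \<le> bump_const e * k\<^sup>2"
      using i k by (simp add: distrib_left)
    then have "\<bar>(bump e (q - b - k *\<^sub>R i) - bump e (q - b)) / k + bump_grad e (q - b) \<bullet> i\<bar> \<le> bump_const e * k"
      using k by (simp add: abs_mult power2_eq_square mult.left_commute[of k])
    then show "\<bar>T i q\<bar> \<le> bump_const e * k * BJ"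
      unfolding T_def abs_mult
      by (intro mult_mono order_trans[OF Basis_le_norm[OF i] J_le]) (use k bump_const_nonneg in auto)
  qed
  have shift: "(LBINT q. bump e (q - b) * ((Jv s (q + k *\<^sub>R i) \<bullet> i - Jv s q \<bullet> i) / k))
      = (LBINT q. T i q) - (LBINT q. (bump_grad e (q - b) \<bullet> i) * (Jv s q \<bullet> i))" if i: "i \<in> Basis" for i
  proof -
    have "(LBINT q. bump e (q - b) * (Jv s (q + k *\<^sub>R i) \<bullet> i))
        = (LBINT q. bump e (q + k *\<^sub>R i - b - k *\<^sub>R i) * (Jv s (q + k *\<^sub>R i) \<bullet> i))"
      by (simp add: algebra_simps)
    also have "\<dots> = (LBINT q. bump e (q - b - k *\<^sub>R i) * (Jv s q \<bullet> i))"
      by (rule lborel_integral_shift[of "\<lambda>q. bump e (q - b - k *\<^sub>R i) * (Jv s q \<bullet> i)" "k *\<^sub>R i"])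
         (intro borel_measurable_continuous_onI continuous_intros)
    finally have sh: "(LBINT q. bump e (q - b) * (Jv s (q + k *\<^sub>R i) \<bullet> i))
        = (LBINT q. bump e (q - b - k *\<^sub>R i) * (Jv s q \<bullet> i))" .
    have "(LBINT q. T i q) = (LBINT q. (bump e (q - b - k *\<^sub>R i) * (Jv s q \<bullet> i) - bump e (q - b) * (Jv s (q + 0) \<bullet> i)) / k
        + (bump_grad e (q - b) \<bullet> i) * (Jv s q \<bullet> i))"
      unfolding T_def by (intro Bochner_Integration.integral_cong refl) (simp add: algebra_simps diff_divide_distrib)
    also have "\<dots> = ((LBINT q. bump e (q - b - k *\<^sub>R i) * (Jv s q \<bullet> i))
        - (LBINT q. bump e (q - b) * (Jv s (q + 0) \<bullet> i))) / k
        + (LBINT q. (bump_grad e (q - b) \<bullet> i) * (Jv s q \<bullet> i))"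
      by (simp only: Bochner_Integration.integral_add Bochner_Integration.integral_diff integral_divide_zero
          intS[OF i] intJ[OF i] intG[OF i] Bochner_Integration.integrable_diff integrable_divide_zero simp_thms)
    finally have 1: "(LBINT q. T i q) = ((LBINT q. bump e (q - b - k *\<^sub>R i) * (Jv s q \<bullet> i))
        - (LBINT q. bump e (q - b) * (Jv s (q + 0) \<bullet> i))) / k
        + (LBINT q. (bump_grad e (q - b) \<bullet> i) * (Jv s q \<bullet> i))" .
    have "(LBINT q. bump e (q - b) * ((Jv s (q + k *\<^sub>R i) \<bullet> i - Jv s q \<bullet> i) / k))
        = (LBINT q. (bump e (q - b) * (Jv s (q + k *\<^sub>R i) \<bullet> i) - bump e (q - b) * (Jv s (q + 0) \<bullet> i)) / k)"
      by (intro Bochner_Integration.integral_cong refl) (simp add: algebra_simps diff_divide_distrib)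
    also have "\<dots> = ((LBINT q. bump e (q - b) * (Jv s (q + k *\<^sub>R i) \<bullet> i))
        - (LBINT q. bump e (q - b) * (Jv s (q + 0) \<bullet> i))) / k"
      by (simp only: Bochner_Integration.integral_diff integral_divide_zero
          intJ[OF i] Bochner_Integration.integrable_diff simp_thms)
    finally show ?thesis unfolding 1 sh by simp
  qed
  have intR: "integrable lborel (\<lambda>q. bump e (q - b) * R s q)" for s
    by (rule bump_mass_lipschitz(1)[OF e])
  have intD: "integrable lborel (\<lambda>q. bump e (q - b) * ((Jv s (q + k *\<^sub>R i) \<bullet> i - Jv s q \<bullet> i) / k))"
    if i: "i \<in> Basis" for i
  proof -
    have "integrable lborel (\<lambda>q. (bump e (q - b) * (Jv s (q + k *\<^sub>R i) \<bullet> i) - bump e (q - b) * (Jv s (q + 0) \<bullet> i)) / k)"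
      by (intro integrable_divide_zero Bochner_Integration.integrable_diff intJ[OF i])
    then show ?thesis
      by (rule Bochner_Integration.integrable_cong[THEN iffD1, rotated 2]) (auto simp: algebra_simps diff_divide_distrib)
  qed
  have "(LBINT q. bump e (q - b) * dquot k s q)
      = (LBINT q. (bump e (q - b) * R (s + k) q - bump e (q - b) * R s q) / k
         + (\<Sum>i\<in>Basis. bump e (q - b) * ((Jv s (q + k *\<^sub>R i) \<bullet> i - Jv s q \<bullet> i) / k)))"
    unfolding dquot_def
    by (intro Bochner_Integration.integral_cong refl)
       (simp add: distrib_left sum_distrib_left right_diff_distrib diff_divide_distrib)
  also have "\<dots> = ((LBINT q. bump e (q - b) * R (s + k) q) - (LBINT q. bump e (q - b) * R s q)) / k
      + (\<Sum>i\<in>Basis. (LBINT q. bump e (q - b) * ((Jv s (q + k *\<^sub>R i) \<bullet> i - Jv s q \<bullet> i) / k)))"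
    by (subst Bochner_Integration.integral_add)
       (auto intro!: Bochner_Integration.integrable_sum Bochner_Integration.integrable_diff intR intD
         simp: Bochner_Integration.integral_sum Bochner_Integration.integral_diff intR intD simp del: times_divide_eq_right)
  also have "(\<Sum>i\<in>Basis. (LBINT q. bump e (q - b) * ((Jv s (q + k *\<^sub>R i) \<bullet> i - Jv s q \<bullet> i) / k)))
      = (\<Sum>i\<in>Basis. (LBINT q. T i q)) - (\<Sum>i\<in>Basis. (LBINT q. (bump_grad e (q - b) \<bullet> i) * (Jv s q \<bullet> i)))"
    unfolding sum_subtractf[symmetric] by (rule sum.cong[OF refl shift])
  also have "(\<Sum>i\<in>Basis. (LBINT q. (bump_grad e (q - b) \<bullet> i) * (Jv s q \<bullet> i)))
      = (LBINT q. bump_grad e (q - b) \<bullet> Jv s q)"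
    by (subst euclidean_inner) (rule Bochner_Integration.integral_sum[symmetric], rule intG)
  finally have "(LBINT q. bump e (q - b) * dquot k s q)
      - ((LBINT q. bump e (q - b) * R (s + k) q) - (LBINT q. bump e (q - b) * R s q)) / k
      + (LBINT q. bump_grad e (q - b) \<bullet> Jv s q) = (\<Sum>i\<in>Basis. (LBINT q. T i q))" by simp
  also have "\<bar>\<dots>\<bar> \<le> of_nat DIM('a) * ((bump_const e * k * BJ) * vol (e + 1))"
    by (rule order_trans[OF sum_abs], rule sum_bounded_above) (rule T)
  finally show ?thesis by (simp add: mult_ac)
qed

end

lemma integrable_compact_support:
  fixes f :: "'a::euclidean_space \<Rightarrow> real"
  assumes "continuous_on UNIV f" "compact K" "\<And>z. z \<notin> K \<Longrightarrow> f z = 0"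
  shows "integrable lborel f"
proof -
  have "integrable lborel (\<lambda>x. indicator K x *\<^sub>R f x)"
    by (rule borel_integrable_compact) (use assms continuous_on_subset[OF assms(1)] in auto)
  also have "(\<lambda>x. indicator K x *\<^sub>R f x) = f"
    using assms(3) by (auto simp: indicator_def fun_eq_iff)
  finally show ?thesis .
qed

context transport
begin

text \<open>The space-time integral of the bump times \<open>dquot\<close> tends to 0 by dominated
  convergence. Fubini and summation by parts turn the same integral into the increment of the bump
  mass minus \<open>h\<close> times the flux at time \<open>t\<close>, up to errors that vanish with
  \<open>ka k\<close> and the cost of freezing the flux.\<close>

lemma weak_continuity_step:
  assumes e: "0 < e" and ball: "cball b e \<subseteq> \<Omega>" and t: "0 \<le> t" and h: "0 \<le> h" and N: "t + h \<le> N"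
  shows "\<bar>((LBINT q. bump e (q - b) * R (t + h) q) - (LBINT q. bump e (q - b) * R t q))
      - h * (LBINT q. bump_grad e (q - b) \<bullet> Jv t q)\<bar> \<le> 4 / e * LJ * vol e * h\<^sup>2"
proof -
  define m where "m s = (LBINT q. bump e (q - b) * R s q)" for s
  define D where "D s = (LBINT q. bump_grad e (q - b) \<bullet> Jv s q)" for s
  define ka where "ka k = 1 / real (Suc k)" for k
  have ka: "0 < ka k" "ka k \<le> 1" for k by (auto simp: ka_def)
  define X where "X k s = (LBINT q. bump e (q - b) * dquot (ka k) s q)" for k s
  define Q where "Q k s = (m (s + ka k) - m s) / ka k" for k s
  \<comment> \<open>The interval is open because the continuity equation is known only at strictly
    positive times below \<open>N\<close>, while \<open>t = 0\<close> and \<open>t + h = N\<close>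
    must be allowed.\<close>
  define f where "f k z = indicator ({t<..<t+h} \<times> UNIV) z * (bump e (snd z - b) * dquot (ka k) (fst z) (snd z))" for k z
  define c where "c = LR + DIM('a) * LJ"
  have c: "0 \<le> c" using LR_nonneg LJ_nonneg by (simp add: c_def)
  have fm: "f k \<in> borel_measurable borel" for k
    unfolding f_def
    by (intro borel_measurable_times borel_measurable_indicator borel_measurable_continuous_onI continuous_intros)
       (intro borel_open open_Times; simp)
  have f_le: "\<bar>f k z\<bar> \<le> c * indicator ({t..t+h} \<times> cball b e) z" for k z
  proof -
    have "\<bar>bump e (snd z - b) * dquot (ka k) (fst z) (snd z)\<bar> \<le> 1 * c"
      unfolding abs_mult c_def by (intro mult_mono dquot_le ka) (auto simp: bump_le_1)
    then show ?thesis
      using c bump_outside[OF e, of "snd z - b"]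
      by (cases z) (auto simp: f_def indicator_def dist_norm norm_minus_commute abs_mult)
  qed
  have box: "compact ({t..t+h} \<times> cball b e)" by (intro compact_Times) auto
  have ibox: "integrable lborel (\<lambda>z. c * indicator ({t..t+h} \<times> cball b e) z)"
    using emeasure_compact_finite[OF box] borel_compact[OF box]
    by (intro integrable_mult_right integrable_real_indicator) auto
  have AE: "AE z in lborel. (\<lambda>k. f k z) \<longlonglongrightarrow> 0"
    using continuity_eq
  proof eventually_elim
    case (elim z)
    show ?case
    proof (cases "z \<in> {t<..<t+h} \<times> cball b e")
      case True
      then have "0 < fst z \<and> fst z < N \<and> snd z \<in> \<Omega>" using t N ball by auto
      with elim have "(\<lambda>k. dquot (ka k) (fst z) (snd z)) \<longlonglongrightarrow> 0"
        unfolding dquot_def ka_def by blast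
      then have "(\<lambda>k. (indicator ({t<..<t+h} \<times> UNIV) z * bump e (snd z - b)) * dquot (ka k) (fst z) (snd z)) \<longlonglongrightarrow> 0"
        by (rule tendsto_mult_right_zero)
      then show ?thesis by (simp add: f_def mult.assoc)
    next
      case False
      then have "f k z = 0" for k
        using bump_outside[OF e, of "snd z - b"]
        by (cases z) (auto simp: f_def indicator_def dist_norm norm_minus_commute)
      then show ?thesis by simp
    qed
  qed
  have lim: "(\<lambda>k. LBINT z. f k z) \<longlonglongrightarrow> (\<integral>z. 0 \<partial>(lborel :: (real \<times> 'a) measure))"
    by (rule integral_dominated_convergence[OF _ _ ibox AE]) (use fm f_le in auto)
  have fint: "integrable (lborel \<Otimes>\<^sub>M lborel) (f k)" for k
    unfolding lborel_prod
    by (rule Bochner_Integration.integrable_bound[OF ibox]) (use fm f_le order_trans[OF f_le abs_ge_self] in auto)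
  have inner: "(LBINT q. f k (s, q)) = indicator {t<..<t+h} s * X k s" for k s
    by (simp add: f_def X_def indicator_times)
  have fX: "(LBINT z. f k z) = (LBINT s. indicator {t<..<t+h} s * X k s)" for k
    using lborel_pair.integral_fst'[OF fint[of k]] by (simp add: inner lborel_prod)
  have iX: "integrable lborel (\<lambda>s. indicator {t<..<t+h} s * X k s)" for k
    using lborel_pair.integrable_fst'[OF fint[of k]] by (simp add: inner)
  have m_lip: "\<bar>m x - m y\<bar> \<le> LR * vol e * \<bar>x - y\<bar>" for x y
    unfolding m_def by (rule bump_mass_lipschitz(2)[OF e])
  have "(LR * vol e)-lipschitz_on UNIV m"
    by (rule lipschitz_onI) (use m_lip LR_nonneg vol_nonneg in \<open>auto simp: dist_real_def\<close>)
  then have m_cont: "continuous_on UNIV m" by (rule lipschitz_on_continuous_on)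
  have "continuous_on {t..t+h} (Q k)" for k
    unfolding Q_def divide_inverse by (intro continuous_intros continuous_on_compose2[OF m_cont]) auto
  then have "set_integrable lborel {t..t+h} (Q k)" for k
    unfolding set_integrable_def by (intro borel_integrable_compact) auto
  then have sQ: "set_integrable lborel {t<..<t+h} (Q k)" for k
    by (rule set_integrable_subset) auto
  then have iQ: "integrable lborel (\<lambda>s. indicator {t<..<t+h} s * Q k s)" for k
    by (simp add: set_integrable_def)
  have Qint: "\<bar>(LBINT s. indicator {t<..<t+h} s * Q k s) - (m (t + h) - m t)\<bar> \<le> 2 * (LR * vol e) * ka k" for k
  proof -
    have "(LBINT s. indicator {t<..<t+h} s * Q k s) = integral {t<..<t+h} (Q k)"
      using set_borel_integral_eq_integral(2)[OF sQ[of k]] by (simp add: set_lebesgue_integral_def)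
    also have "\<dots> = integral {t..t+h} (\<lambda>s. (m (s + ka k) - m s) / ka k)"
      unfolding integral_open_interval_real Q_def[abs_def] ..
    finally show ?thesis
      using difference_quotient_integral[OF m_lip h ka(1), of t k] by simp
  qed
  \<comment> \<open>The first summand disappears in the limit. The second comes from replacing
    \<open>D s\<close> by \<open>D t\<close> and, multiplied by the length \<open>h\<close>, is the
    final error.\<close>
  define K where "K k = DIM('a) * (bump_const e * BJ * vol (e + 1)) * ka k + 4 / e * LJ * h * vol e" for k
  have near: "\<bar>X k s - Q k s + D t\<bar> \<le> K k" if s: "t < s" "s < t + h" for k s
  proof -
    have "\<bar>X k s - Q k s + D s\<bar> \<le> DIM('a) * (bump_const e * BJ * vol (e + 1)) * ka k"
      unfolding X_def Q_def m_def D_def by (rule bump_dquot_integral[OF e ka])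
    moreover have "\<bar>D s - D t\<bar> \<le> 4 / e * LJ * \<bar>s - t\<bar> * vol e"
      unfolding D_def by (rule bump_flux_variation[OF e])
    moreover have "4 / e * LJ * \<bar>s - t\<bar> * vol e \<le> 4 / e * LJ * h * vol e"
      using s e LJ_nonneg vol_nonneg by (intro mult_right_mono mult_left_mono) auto
    ultimately show ?thesis unfolding K_def by linarith
  qed
  have "\<bar>(LBINT z. f k z) - (m (t + h) - m t) + h * D t\<bar> \<le> 2 * (LR * vol e) * ka k + K k * h" for k
  proof -
    have iD: "integrable lborel (\<lambda>s. indicator {t<..<t+h} s * x)" for x :: real
      by (intro integrable_mult_left integrable_real_indicator) (use h in auto)
    have "(LBINT s. indicator {t<..<t+h} s * (X k s - Q k s + D t))
        = (LBINT s. indicator {t<..<t+h} s * X k s - indicator {t<..<t+h} s * Q k s + indicator {t<..<t+h} s * D t)"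
      by (simp add: algebra_simps)
    also have "\<dots> = (LBINT s. indicator {t<..<t+h} s * X k s)
        - (LBINT s. indicator {t<..<t+h} s * Q k s) + (LBINT s. indicator {t<..<t+h} s * D t)"
      by (simp only: Bochner_Integration.integral_add Bochner_Integration.integral_diff iX iQ iD
          Bochner_Integration.integrable_diff simp_thms)
    also have "(LBINT s. indicator {t<..<t+h} s * D t) = h * D t" using h by simp
    finally have eq: "(LBINT s. indicator {t<..<t+h} s * (X k s - Q k s + D t))
        = (LBINT s. indicator {t<..<t+h} s * X k s)
        - (LBINT s. indicator {t<..<t+h} s * Q k s) + h * D t" .
    have "integrable lborel (\<lambda>s. indicator {t<..<t+h} s * X k s - indicator {t<..<t+h} s * Q k s + indicator {t<..<t+h} s * D t)"
      by (intro Bochner_Integration.integrable_add Bochner_Integration.integrable_diff iX iQ iD)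
    then have i: "integrable lborel (\<lambda>s. indicator {t<..<t+h} s * (X k s - Q k s + D t))"
      by (simp add: algebra_simps)
    have "\<bar>LBINT s. indicator {t<..<t+h} s * (X k s - Q k s + D t)\<bar>
        \<le> (LBINT s. \<bar>indicator {t<..<t+h} s * (X k s - Q k s + D t)\<bar>)"
      by (rule integral_abs_bound)
    also have "\<dots> \<le> (LBINT s. indicator {t<..<t+h} s * K k)"
      by (rule integral_mono[OF _ iD]) (use i near in \<open>auto simp: indicator_def\<close>)
    also have "\<dots> = K k * h" using h by simp
    finally show ?thesis using Qint[of k] unfolding eq fX by linarith
  qed
  moreover have "(\<lambda>k. \<bar>(LBINT z. f k z) - (m (t + h) - m t) + h * D t\<bar>) \<longlonglongrightarrow> \<bar>0 - (m (t + h) - m t) + h * D t\<bar>"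
    using lim by (intro tendsto_intros) simp
  moreover have "ka \<longlonglongrightarrow> 0"
    unfolding ka_def by (rule LIMSEQ_Suc[OF lim_1_over_n])
  then have "(\<lambda>k. 2 * (LR * vol e) * ka k + K k * h) \<longlonglongrightarrow>
      2 * (LR * vol e) * 0 + (DIM('a) * (bump_const e * BJ * vol (e + 1)) * 0 + 4 / e * LJ * h * vol e) * h"
    unfolding K_def by (intro tendsto_intros)
  ultimately have "\<bar>0 - (m (t + h) - m t) + h * D t\<bar> \<le>
      2 * (LR * vol e) * 0 + (DIM('a) * (bump_const e * BJ * vol (e + 1)) * 0 + 4 / e * LJ * h * vol e) * h"
    by (intro LIMSEQ_le) auto
  then show ?thesis
    unfolding m_def[symmetric] D_def[symmetric] by (simp add: power2_eq_square mult_ac abs_minus_commute abs_le_iff)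
qed

text \<open>The defect in mass balance of one Euler step of the flow, tested with \<open>U\<close>.\<close>

definition defect :: "real \<Rightarrow> real \<Rightarrow> ('a \<Rightarrow> real) \<Rightarrow> real" where
  "defect t h U = (LBINT q. U q * (R (t + h) q - R t q) - (U (q + h *\<^sub>R w t q) - U q) * R t q)"

text \<open>The error of \<open>weak_continuity_step\<close> plus the Taylor error of the bump under
  a displacement of length at most \<open>h * C\<close>, integrated against a density bounded by
  \<open>BR\<close>.\<close>

definition defect_const :: "real \<Rightarrow> real" where
  "defect_const e = 4 / e * LJ * vol e + bump_const e * C\<^sup>2 * BR * vol (e + 1)"

lemma defect_const_nonneg: "0 < e \<Longrightarrow> 0 \<le> defect_const e"
  unfolding defect_const_def
  using LJ_nonneg vol_nonneg bump_const_nonneg BR_nonneg by simp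

text \<open>Above the threshold \<open>R t q *\<^sub>R w t q\<close> equals \<open>Jv t q\<close>.
  Hence the first-order change of the bump under the Euler step is exactly \<open>h\<close> times
  the flux, which the weak continuity equation balances against the change of density.\<close>

lemma defect_bump:
  assumes e: "0 < e" and ball: "cball b e \<subseteq> \<Omega>" and pos: "\<And>q. q \<in> cball b e \<Longrightarrow> d < R t q"
    and t: "0 \<le> t" and h: "0 \<le> h" "h * C \<le> 1" and N: "t + h \<le> N"
  shows "\<bar>defect t h (\<lambda>q. bump e (q - b))\<bar> \<le> defect_const e * h\<^sup>2"
proof -
  have hw: "norm (h *\<^sub>R w t q) \<le> h * C" for q
    by (rule norm_step_le[OF h(1)])
  define T where "T q = (bump e (q - b + h *\<^sub>R w t q) - bump e (q - b) - bump_grad e (q - b) \<bullet> (h *\<^sub>R w t q)) * R t q" for q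
  have T0: "T q = 0" if "e + 1 < norm (q - b)" for q
  proof -
    have "e \<le> norm (q - b + h *\<^sub>R w t q)"
      using that norm_diff_ineq[of "q - b" "h *\<^sub>R w t q"] hw[of q] h(2) by linarith
    with that e show ?thesis by (simp add: T_def bump_outside bump_grad_outside)
  qed
  have Tc: "continuous_on UNIV T"
    unfolding T_def by (intro continuous_intros)
  have iT: "integrable lborel T"
    by (rule integrable_compact_support[OF Tc compact_cball[of b "e+1"]])
       (use T0 in \<open>auto simp: dist_norm norm_minus_commute\<close>)
  have "\<bar>LBINT q. T q\<bar> \<le> (bump_const e * (h * C)\<^sup>2 * BR) * vol (e + 1)"
    unfolding vol_def
  proof (rule integral_bounded_support[OF borel_measurable_continuous_onI[OF Tc] _ T0])
    fix q
    have "\<bar>bump e (q - b + h *\<^sub>R w t q) - bump e (q - b) - bump_grad e (q - b) \<bullet> (h *\<^sub>R w t q)\<bar>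
      \<le> bump_const e * (norm (h *\<^sub>R w t q))\<^sup>2"
      by (rule bump_taylor[OF e order_trans[OF hw h(2)]])
    also have "\<dots> \<le> bump_const e * (h * C)\<^sup>2"
      by (intro mult_left_mono power_mono hw bump_const_nonneg) simp
    finally show "\<bar>T q\<bar> \<le> bump_const e * (h * C)\<^sup>2 * BR"
      unfolding T_def abs_mult using R_le R_nonneg bump_const_nonneg by (intro mult_mono) auto
  qed
  have iG: "integrable lborel (\<lambda>q. bump_grad e (q - b) \<bullet> Jv t q)"
    by (rule integrable_compact_support[of _ "cball b e"])
       (auto intro!: continuous_intros simp: dist_norm norm_minus_commute bump_grad_outside[OF e])
  have "defect t h (\<lambda>q. bump e (q - b)) = (LBINT q. bump e (q - b) * R (t + h) q - bump e (q - b) * R t q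
      - h * (bump_grad e (q - b) \<bullet> Jv t q) - T q)"
    unfolding defect_def
  proof (rule Bochner_Integration.integral_cong[OF refl])
    fix q
    have "(bump_grad e (q - b) \<bullet> w t q) * R t q = bump_grad e (q - b) \<bullet> Jv t q"
    \<comment> \<open>Inside the ball the density exceeds the threshold; outside, both sides vanish
      with the gradient.\<close>
    proof (cases "q \<in> cball b e")
      case True
      then show ?thesis using R_w[OF pos[OF True]] by (metis inner_scaleR_right mult.commute)
    next
      case False
      then show ?thesis using bump_grad_outside[OF e, of "q - b"] by (simp add: dist_norm norm_minus_commute)
    qed
    then have "(bump_grad e (q - b) \<bullet> (h *\<^sub>R w t q)) * R t q = h * (bump_grad e (q - b) \<bullet> Jv t q)"
      by (simp only: inner_scaleR_right mult.assoc)
    then have "T q = (bump e (q - b + h *\<^sub>R w t q) - bump e (q - b)) * R t q - h * (bump_grad e (q - b) \<bullet> Jv t q)"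
      unfolding T_def by (simp only: left_diff_distrib)
    then show "bump e (q - b) * (R (t + h) q - R t q) - (bump e (q + h *\<^sub>R w t q - b) - bump e (q - b)) * R t q =
      bump e (q - b) * R (t + h) q - bump e (q - b) * R t q - h * (bump_grad e (q - b) \<bullet> Jv t q) - T q"
      by (simp add: algebra_simps)
  qed
  also have "\<dots> = (LBINT q. bump e (q - b) * R (t + h) q) - (LBINT q. bump e (q - b) * R t q)
      - h * (LBINT q. bump_grad e (q - b) \<bullet> Jv t q) - (LBINT q. T q)"
    using bump_mass_lipschitz(1)[OF e] iG iT by simp
  finally show ?thesis
    using weak_continuity_step[OF e ball t h(1) N] \<open>\<bar>LBINT q. T q\<bar> \<le> _\<close>
    unfolding defect_const_def by (simp add: power_mult_distrib algebra_simps abs_le_iff)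
qed

end

section \<open>Mass balance of one step of the flow\<close>

lemma
  fixes f :: "'a::euclidean_space \<times> 'b::euclidean_space \<Rightarrow> real"
  assumes f: "continuous_on UNIV f" "compact K" "\<And>z. z \<notin> K \<Longrightarrow> f z = 0"
  shows integrable_inner_compact_support: "integrable lborel (\<lambda>x. LBINT y. f (x, y))"
    and Fubini_compact_support:
      "(LBINT x. (LBINT y. f (x, y))) = (LBINT y. (LBINT x. f (x, y)))"
proof -
  have i: "integrable (lborel \<Otimes>\<^sub>M lborel) f"
    unfolding lborel_prod by (rule integrable_compact_support[OF f])
  show "integrable lborel (\<lambda>x. LBINT y. f (x, y))"
    by (rule lborel_pair.integrable_fst'[OF i])
  show "(LBINT x. (LBINT y. f (x, y))) = (LBINT y. (LBINT x. f (x, y)))"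
    by (rule lborel_pair.Fubini_integral[symmetric]) (use i in simp)
qed

text \<open>With \<open>n\<close> equal steps the total change is at most
  \<open>A * T * e + K * T\<^sup>2 / n\<close>. As \<open>n\<close> grows before \<open>e\<close>
  shrinks, \<open>K\<close> and \<open>h0\<close> may depend on \<open>e\<close>, while
  \<open>A\<close> must not.\<close>

lemma zero_increments_imp_eq:
  fixes F :: "real \<Rightarrow> real"
  assumes T: "0 \<le> T" and e0: "0 < e0"
    and inc: "\<And>e. 0 < e \<Longrightarrow> e < e0 \<Longrightarrow> \<exists>K. \<exists>h0>0. \<forall>t h. 0 \<le> t \<longrightarrow> 0 \<le> h \<longrightarrow> h < h0 \<longrightarrow> t + h \<le> T \<longrightarrow>
      \<bar>F (t + h) - F t\<bar> \<le> A * e * h + K * h\<^sup>2"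
  shows "F T = F 0"
proof -
  have small: "\<bar>F T - F 0\<bar> \<le> A * T * e" if e: "0 < e" "e < e0" for e
  proof -
    obtain K h0 where h0: "0 < h0" and K: "\<And>t h. 0 \<le> t \<Longrightarrow> 0 \<le> h \<Longrightarrow> h < h0 \<Longrightarrow> t + h \<le> T \<Longrightarrow>
      \<bar>F (t + h) - F t\<bar> \<le> A * e * h + K * h\<^sup>2"
      using inc[OF e] by blast
    have "\<bar>F T - F 0\<bar> \<le> A * T * e + K * T\<^sup>2 * (1 / real n)" if n: "T / h0 < real n" for n
    proof -
      have n0: "0 < real n" using n T h0 by (meson divide_nonneg_pos order_le_less_trans)
      define h where "h = T / n"
      have h: "0 \<le> h" "h < h0" using n n0 T h0 by (auto simp: h_def field_simps)
      have "\<bar>F (real j * h) - F 0\<bar> \<le> real j * (A * e * h + K * h\<^sup>2)" if "j \<le> n" for j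
        using that
      proof (induction j)
        case (Suc j)
        have "real j * h + h = real (Suc j) * h" by (simp add: algebra_simps)
        moreover have "real (Suc j) * h \<le> real n * h"
          using Suc.prems h by (intro mult_right_mono) auto
        moreover have "real n * h = T" using n0 by (simp add: h_def)
        ultimately have "\<bar>F (real (Suc j) * h) - F (real j * h)\<bar> \<le> A * e * h + K * h\<^sup>2"
          using K[of "real j * h" h] h by simp
        moreover have "\<bar>F (real j * h) - F 0\<bar> \<le> real j * (A * e * h + K * h\<^sup>2)"
          using Suc by simp
        moreover have "real (Suc j) * (A * e * h + K * h\<^sup>2) = real j * (A * e * h + K * h\<^sup>2) + (A * e * h + K * h\<^sup>2)"
          by (simp add: algebra_simps)
        ultimately show ?case by linarith
      qed simp
      from this[of n] have "\<bar>F T - F 0\<bar> \<le> real n * (A * e * h + K * h\<^sup>2)"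
        using n0 by (simp add: h_def)
      also have "\<dots> = A * T * e + K * T\<^sup>2 * (1 / real n)"
        using n0 by (simp add: h_def power2_eq_square field_simps)
      finally show ?thesis .
    qed
    moreover have "T / h0 < real n" if "nat \<lceil>T / h0\<rceil> + 1 \<le> n" for n
      using that real_nat_ceiling_ge[of "T / h0"] by linarith
    ultimately have "eventually (\<lambda>n. \<bar>F T - F 0\<bar> \<le> A * T * e + K * T\<^sup>2 * (1 / real n)) sequentially"
      by (intro eventually_sequentiallyI[of "nat \<lceil>T / h0\<rceil> + 1"]) blast
    moreover have "(\<lambda>n. A * T * e + K * T\<^sup>2 * (1 / real n)) \<longlonglongrightarrow> A * T * e + K * T\<^sup>2 * 0"
      by (intro tendsto_intros lim_1_over_n)
    ultimately have "\<bar>F T - F 0\<bar> \<le> A * T * e + K * T\<^sup>2 * 0"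
      by (intro tendsto_lowerbound[OF _ _ trivial_limit_sequentially])
    then show ?thesis by simp
  qed
  have "eventually (\<lambda>e. \<bar>F T - F 0\<bar> \<le> A * T * e) (at_right 0)"
    unfolding eventually_at_right[OF e0] using small e0 by blast
  moreover have "((\<lambda>e. A * T * e) \<longlongrightarrow> A * T * 0) (at_right 0)"
    by (intro tendsto_intros)
  ultimately have "\<bar>F T - F 0\<bar> \<le> A * T * 0"
    by (intro tendsto_lowerbound[of "\<lambda>e. A * T * e" _ "at_right 0"]) auto
  then show ?thesis by simp
qed

section \<open>Averaging the defect of a Lipschitz test function over bumps\<close>

context transport
begin

text \<open>Shifting commutes with the flow map up to second order; only translation
  invariance of Lebesgue measure is needed, no Jacobian.\<close>

lemma defect_shift:
  assumes e: "e \<le> 1" and a: "norm a \<le> e"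
    and U_lip: "\<And>p q. \<bar>U p - U q\<bar> \<le> Lu * norm (p - q)"
    and supp: "\<And>q. M < norm q \<Longrightarrow> U q = 0"
    and h: "0 \<le> h" "h * C \<le> 1"
  shows "\<bar>defect t h U - defect t h (\<lambda>q. U (q + a))\<bar> \<le> Lu * (LR + L * BR + C * LR) * e * h * vol (M + 2)"
proof -
  have Lu: "0 \<le> Lu" by (rule lipschitz_const_nonneg[OF U_lip])
  have Uc [continuous_intros]: "continuous_on X f \<Longrightarrow> continuous_on X (\<lambda>x. U (f x))" for X and f :: "'a \<Rightarrow> 'a"
    by (rule continuous_on_lipschitz_compose[OF U_lip])
  have hw: "norm (h *\<^sub>R w t q) \<le> h * C" for q
    by (rule norm_step_le[OF h(1)])
  have far: "U (q + b) = 0" if "M + 2 < norm q" "norm b \<le> 2" for q b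
    by (rule supp) (use norm_diff_ineq[of q b] that in linarith)
  have far0: "U q = 0" if "M + 2 < norm q" for q using far[OF that, of 0] by simp
  have fara: "U (q + a) = 0" if "M + 2 < norm q" for q using far[OF that, of a] a e by simp
  have farw: "U (q + h *\<^sub>R w t p) = 0" if "M + 2 < norm q" for q p
    by (rule far[OF that]) (use hw[of p] h in linarith)
  have farwa: "U (q + h *\<^sub>R w t p + a) = 0" if "M + 2 < norm q" for q p
    using far[OF that, of "h *\<^sub>R w t p + a"] norm_triangle_ineq[of "h *\<^sub>R w t p" a] hw[of p] h a e
    by (simp add: add.assoc)
  have int: "integrable lborel f" if "continuous_on UNIV f" "\<And>q. M + 2 < norm q \<Longrightarrow> f q = 0" for f :: "'a \<Rightarrow> real"
    by (rule integrable_compact_support[OF that(1) compact_cball[of 0 "M + 2"]]) (use that(2) in auto)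
  define A where "A q = (U q - U (q + a)) * (R (t + h) q - R t q)" for q
  \<comment> \<open>Translating \<open>G\<close> by \<open>a\<close> gives the displacement term for
    the shifted test function. Thus \<open>G - P\<close> compares velocity and density at
    \<open>q - a\<close> with those at \<open>q\<close>, and each comparison gains a factor
    \<open>e\<close>.\<close>
  define G where "G q = (U (q + h *\<^sub>R w t (q - a)) - U q) * R t (q - a)" for q
  define P where "P q = (U (q + h *\<^sub>R w t q) - U q) * R t q" for q
  have iA: "integrable lborel A" unfolding A_def
    by (rule int) (intro continuous_intros, simp add: far0 fara)
  have iP: "integrable lborel P" unfolding P_def
    by (rule int) (intro continuous_intros, simp add: far0 farw)
  have iG: "integrable lborel G" unfolding G_def
    by (rule int) (intro continuous_intros, simp add: far0 farw)
  have Ga: "G (q + a) = (U (q + h *\<^sub>R w t q + a) - U (q + a)) * R t q" for q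
    by (simp add: G_def add.assoc add.commute[of a])
  have iGa: "integrable lborel (\<lambda>q. G (q + a))" unfolding Ga
    by (rule int) (intro continuous_intros, simp add: fara farwa)
  have i1: "integrable lborel (\<lambda>q. U q * (R (t + h) q - R t q))"
    by (rule int) (intro continuous_intros, simp add: far0)
  have i2: "integrable lborel (\<lambda>q. U (q + a) * (R (t + h) q - R t q))"
    by (rule int) (intro continuous_intros, simp add: fara)
  have "defect t h U = (LBINT q. U q * (R (t + h) q - R t q)) - (LBINT q. P q)"
    unfolding defect_def P_def[symmetric] by (rule Bochner_Integration.integral_diff[OF i1 iP])
  moreover have "defect t h (\<lambda>q. U (q + a)) = (LBINT q. U (q + a) * (R (t + h) q - R t q)) - (LBINT q. G (q + a))"
    using Bochner_Integration.integral_diff[OF i2 iGa] unfolding defect_def Ga by simp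
  moreover have "(LBINT q. G (q + a)) = (LBINT q. G q)"
    by (rule lborel_integral_shift) (use iG in \<open>simp add: borel_measurable_integrable\<close>)
  moreover have "(LBINT q. A q) = (LBINT q. U q * (R (t + h) q - R t q)) - (LBINT q. U (q + a) * (R (t + h) q - R t q))"
    unfolding A_def left_diff_distrib[of "U _"] by (rule Bochner_Integration.integral_diff[OF i1 i2])
  ultimately have eq: "defect t h U - defect t h (\<lambda>q. U (q + a)) = (LBINT q. A q + (G q - P q))"
    using iA iG iP by simp
  show ?thesis unfolding eq vol_def
  proof (rule integral_bounded_support[where b = 0])
    show "(\<lambda>q. A q + (G q - P q)) \<in> borel_measurable borel"
      using iA iG iP borel_measurable_integrable by (simp add: borel_measurable_integrable)
    show "A q + (G q - P q) = 0" if "M + 2 < norm (q - 0)" for q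
      using that by (simp add: A_def G_def P_def far0 fara farw)
    fix q
    have "\<bar>A q\<bar> \<le> (Lu * e) * (LR * h)"
      unfolding A_def abs_mult
    proof (intro mult_mono)
      show "\<bar>U q - U (q + a)\<bar> \<le> Lu * e"
        using U_lip[of q "q + a"] mult_left_mono[OF a Lu] by simp
      show "\<bar>R (t + h) q - R t q\<bar> \<le> LR * h" using R_lip[of "t + h" q t q] h by simp
    qed (use Lu a order_trans[OF norm_ge_zero a] in auto)
    moreover have "\<bar>(U (q + h *\<^sub>R w t (q - a)) - U (q + h *\<^sub>R w t q)) * R t q\<bar> \<le> (Lu * (h * (L * e))) * BR"
      unfolding abs_mult
    proof (intro mult_mono)
      have "norm (h *\<^sub>R w t (q - a) - h *\<^sub>R w t q) \<le> h * (L * norm a)"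
        using w_lip[of t "q - a" t q] h by (simp add: scaleR_diff_right[symmetric] mult_left_mono)
      also have "\<dots> \<le> h * (L * e)" using h a L_pos by (intro mult_left_mono) auto
      finally show "\<bar>U (q + h *\<^sub>R w t (q - a)) - U (q + h *\<^sub>R w t q)\<bar> \<le> Lu * (h * (L * e))"
        using U_lip[of "q + h *\<^sub>R w t (q - a)" "q + h *\<^sub>R w t q"] Lu
        by (simp add: order_trans[OF _ mult_left_mono])
      show "\<bar>R t q\<bar> \<le> BR" using R_le R_nonneg by simp
    qed (use Lu h L_pos order_trans[OF norm_ge_zero a] in auto)
    moreover have "\<bar>(U (q + h *\<^sub>R w t (q - a)) - U q) * (R t (q - a) - R t q)\<bar> \<le> (Lu * (h * C)) * (LR * e)"
      unfolding abs_mult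
    proof (intro mult_mono)
      show "\<bar>U (q + h *\<^sub>R w t (q - a)) - U q\<bar> \<le> Lu * (h * C)"
        using U_lip[of "q + h *\<^sub>R w t (q - a)" q] mult_left_mono[OF hw[of "q - a"] Lu] by simp
      show "\<bar>R t (q - a) - R t q\<bar> \<le> LR * e"
        using R_lip[of t "q - a" t q] mult_left_mono[OF a LR_nonneg] by simp
    qed (use Lu h C_nonneg in auto)
    moreover have "G q - P q = (U (q + h *\<^sub>R w t (q - a)) - U (q + h *\<^sub>R w t q)) * R t q
        + (U (q + h *\<^sub>R w t (q - a)) - U q) * (R t (q - a) - R t q)"
      by (simp add: G_def P_def algebra_simps)
    \<comment> \<open>The three summands stem from shifting \<open>U\<close> against the time
      increment of \<open>R\<close>, from the variation of the velocity, and from the variation of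
      the density in space.\<close>
    moreover have "Lu * (LR + L * BR + C * LR) * e * h =
        (Lu * e) * (LR * h) + (Lu * (h * (L * e))) * BR + (Lu * (h * C)) * (LR * e)"
      by (simp add: algebra_simps)
    ultimately show "\<bar>A q + (G q - P q)\<bar> \<le> Lu * (LR + L * BR + C * LR) * e * h" by linarith
  qed
qed

text \<open>By Fubini, averaging the defects of the translates of \<open>U\<close> with weight
  \<open>bump e a\<close> equals integrating the defects of the bumps centred at \<open>b\<close>
  with weight \<open>U b\<close>. By \<open>defect_shift\<close> the former is near \<open>Z\<close>
  times the defect of \<open>U\<close>; by \<open>defect_bump\<close> the latter is of order
  \<open>h\<^sup>2\<close>.\<close>

lemma defect_lipschitz:
  assumes e: "0 < e" "e \<le> 1"
    and U_lip: "\<And>p q. \<bar>U p - U q\<bar> \<le> Lu * norm (p - q)" and U_le: "\<And>q. \<bar>U q\<bar> \<le> B"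
    and supp: "\<And>q. q \<notin> S \<Longrightarrow> U q = 0" and S: "S \<subseteq> cball 0 M"
    and ball: "\<And>b. b \<in> S \<Longrightarrow> cball b e \<subseteq> \<Omega>" and pos: "\<And>b q. b \<in> S \<Longrightarrow> q \<in> cball b e \<Longrightarrow> d < R t q"
    and t: "0 \<le> t" and h: "0 \<le> h" "h * C \<le> 1" and N: "t + h \<le> N"
  shows "\<bar>defect t h U\<bar> \<le> Lu * (LR + L * BR + C * LR) * e * h * vol (M + 2)
    + B * vol M * defect_const e / (LBINT q. bump e (q::'a)) * h\<^sup>2"
proof -
  define Z where "Z = (LBINT q. bump e (q::'a))"
  have Z: "0 < Z" unfolding Z_def by (rule integral_bump_pos[OF e(1)])
  have B: "0 \<le> B" using order_trans[OF abs_ge_zero U_le[of 0]] .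
  have Lu: "0 \<le> Lu" by (rule lipschitz_const_nonneg[OF U_lip])
  have Uc: "continuous_on X f \<Longrightarrow> continuous_on X (\<lambda>x. U (f x))" for X and f :: "'c::topological_space \<Rightarrow> 'a"
    by (rule continuous_on_lipschitz_compose[OF U_lip])
  have hw: "norm (h *\<^sub>R w t q) \<le> 1" for q
    using h w_bound[of t q] mult_left_mono[of "norm (w t q)" C h] by simp
  have suppM: "U q = 0" if "M < norm q" for q
    using that S by (intro supp) auto
  have bump0: "bump e x = 0" if "e < norm x" for x :: 'a
    using bump_outside[OF e(1), of x] that by simp
  define K1 where "K1 = Lu * (LR + L * BR + C * LR) * e * h * vol (M + 2)"
  \<comment> \<open>The pairs are (shift, point) for \<open>f\<close> and (point, centre) for
    \<open>g\<close>. Both functions are continuous with compact support, so integrals may be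
    exchanged; the displacement of at most 1 and the shift of at most 1 explain the radius
    \<open>M + 2\<close>.\<close>
  define f where "f z = bump e (fst z) * (U (snd z + fst z) * (R (t + h) (snd z) - R t (snd z))
      - (U (snd z + h *\<^sub>R w t (snd z) + fst z) - U (snd z + fst z)) * R t (snd z))" for z :: "'a \<times> 'a"
  define g where "g z = U (snd z) * (bump e (fst z - snd z) * (R (t + h) (fst z) - R t (fst z))
      - (bump e (fst z + h *\<^sub>R w t (fst z) - snd z) - bump e (fst z - snd z)) * R t (fst z))" for z :: "'a \<times> 'a"
  have fc: "continuous_on UNIV f" and gc: "continuous_on UNIV g"
    unfolding f_def g_def by (intro continuous_intros Uc)+
  have f0: "f z = 0" if "z \<notin> cball 0 1 \<times> cball 0 (M + 2)" for z
  proof (cases "norm (fst z) \<le> e")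
    case False
    then show ?thesis by (simp add: f_def bump0)
  next
    case True
    then have big: "M + 2 < norm (snd z)" using that e by (cases z) auto
    have "U (snd z + fst z) = 0"
      by (rule suppM) (use norm_diff_ineq[of "snd z" "fst z"] True e big in linarith)
    moreover have "U (snd z + h *\<^sub>R w t (snd z) + fst z) = 0"
      by (rule suppM)
         (use norm_diff_ineq[of "snd z + h *\<^sub>R w t (snd z)" "fst z"] norm_diff_ineq[of "snd z" "h *\<^sub>R w t (snd z)"]
           hw[of "snd z"] True e big in linarith)
    ultimately show ?thesis by (simp add: f_def)
  qed
  have g0: "g z = 0" if "z \<notin> cball 0 (M + 2) \<times> cball 0 M" for z
  proof (cases "norm (snd z) \<le> M")
    case False
    then show ?thesis by (simp add: g_def suppM)
  next
    case True
    then have big: "M + 2 < norm (fst z)" using that by (cases z) auto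
    have "e < norm (fst z - snd z)"
      using norm_triangle_ineq2[of "fst z" "snd z"] True e big by linarith
    moreover have "e < norm (fst z + h *\<^sub>R w t (fst z) - snd z)"
      using norm_triangle_ineq2[of "fst z + h *\<^sub>R w t (fst z)" "snd z"] norm_diff_ineq[of "fst z" "h *\<^sub>R w t (fst z)"]
        hw[of "fst z"] True e big by linarith
    ultimately show ?thesis by (simp add: g_def bump0)
  qed
  have fK: "compact (cball (0::'a) 1 \<times> cball (0::'a) (M + 2))"
    and gK: "compact (cball (0::'a) (M + 2) \<times> cball (0::'a) M)" by (intro compact_Times compact_cball)+
  have fin: "(LBINT q. f (a, q)) = bump e a * defect t h (\<lambda>q. U (q + a))" for a
    by (simp add: f_def defect_def)
  have gin: "(LBINT q. g (q, b)) = U b * defect t h (\<lambda>q. bump e (q - b))" for b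
    by (simp add: g_def defect_def)
  \<comment> \<open>Substitution \<open>b = x + a\<close>, together with the evenness of the
    bump.\<close>
  have conv: "(LBINT a. bump e a * U (x + a)) = (LBINT b. bump e (x - b) * U b)"
    and iconv: "integrable lborel (\<lambda>a. bump e a * U (x + a))"
    and iconv': "integrable lborel (\<lambda>b. bump e (x - b) * U b)" for x
  proof -
    have bm: "(\<lambda>b. bump e (x - b) * U b) \<in> borel_measurable borel"
      by (intro borel_measurable_continuous_onI continuous_intros Uc)
    have "(LBINT b. bump e (x - b) * U b) = (LBINT a. bump e (x - (a + x)) * U (a + x))"
      by (rule lborel_integral_shift[OF bm, of x, symmetric])
    then show "(LBINT a. bump e a * U (x + a)) = (LBINT b. bump e (x - b) * U b)"
      by (simp add: add.commute)
    show "integrable lborel (\<lambda>a. bump e a * U (x + a))"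
      by (rule integrable_compact_support[of _ "cball 0 e"])
         (auto intro!: continuous_intros Uc simp: bump0)
    show "integrable lborel (\<lambda>b. bump e (x - b) * U b)"
      by (rule integrable_compact_support[of _ "cball x e"])
         (auto intro!: continuous_intros Uc simp: bump0 dist_norm)
  qed
  have mid: "(LBINT a. f (a, q)) = (LBINT b. g (q, b))" for q
  proof -
    let ?x = "q + h *\<^sub>R w t q"
    have "(LBINT a. f (a, q)) = (LBINT a. (bump e a * U (q + a)) * (R (t + h) q - R t q)
        - (bump e a * U (?x + a) - bump e a * U (q + a)) * R t q)"
      by (simp add: f_def algebra_simps)
    also have "\<dots> = (LBINT a. bump e a * U (q + a)) * (R (t + h) q - R t q)
        - ((LBINT a. bump e a * U (?x + a)) - (LBINT a. bump e a * U (q + a))) * R t q"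
      by (simp only: Bochner_Integration.integral_diff integral_mult_left_zero iconv
          Bochner_Integration.integrable_diff integrable_mult_left simp_thms)
    also have "\<dots> = (LBINT b. bump e (q - b) * U b) * (R (t + h) q - R t q)
        - ((LBINT b. bump e (?x - b) * U b) - (LBINT b. bump e (q - b) * U b)) * R t q"
      unfolding conv ..
    also have "\<dots> = (LBINT b. (bump e (q - b) * U b) * (R (t + h) q - R t q)
        - (bump e (?x - b) * U b - bump e (q - b) * U b) * R t q)"
      by (simp only: Bochner_Integration.integral_diff integral_mult_left_zero iconv'
          Bochner_Integration.integrable_diff integrable_mult_left simp_thms)
    also have "\<dots> = (LBINT b. g (q, b))"
      by (simp add: g_def algebra_simps)
    finally show ?thesis .
  qed
  have main: "(LBINT a. bump e a * defect t h (\<lambda>q. U (q + a))) = (LBINT b. U b * defect t h (\<lambda>q. bump e (q - b)))"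
    using Fubini_compact_support[OF fc fK f0] Fubini_compact_support[OF gc gK g0]
    by (simp add: fin gin mid)
  have idf: "integrable lborel (\<lambda>a. bump e a * defect t h (\<lambda>q. U (q + a)))"
    using integrable_inner_compact_support[OF fc fK f0] by (simp add: fin)
  have "continuous_on UNIV (\<lambda>z. g (snd z, fst z))"
    by (rule continuous_on_compose2[OF gc]) (auto intro!: continuous_intros)
  from integrable_inner_compact_support[OF this compact_Times[OF compact_cball compact_cball], of 0 M 0 "M + 2"]
  have idg: "integrable lborel (\<lambda>b. U b * defect t h (\<lambda>q. bump e (q - b)))"
    using g0 by (fastforce simp: gin)
  have ib: "integrable lborel (\<lambda>a::'a. bump e a * x)" for x
    by (rule integrable_compact_support[of _ "cball 0 e"]) (auto intro!: continuous_intros simp: bump0)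
  have D: "Z * defect t h U - (LBINT a. bump e a * defect t h (\<lambda>q. U (q + a)))
      = (LBINT a. bump e a * (defect t h U - defect t h (\<lambda>q. U (q + a))))"
    unfolding right_diff_distrib Z_def
    by (subst Bochner_Integration.integral_diff[OF ib idf]) simp
  have "\<bar>LBINT a. bump e a * (defect t h U - defect t h (\<lambda>q. U (q + a)))\<bar>
      \<le> (LBINT a. \<bar>bump e a * (defect t h U - defect t h (\<lambda>q. U (q + a)))\<bar>)"
    by (rule integral_abs_bound)
  also have "\<dots> \<le> (LBINT a. bump e (a::'a) * K1)"
  proof (rule integral_mono[OF _ ib])
    show "integrable lborel (\<lambda>a. \<bar>bump e a * (defect t h U - defect t h (\<lambda>q. U (q + a)))\<bar>)"
      unfolding right_diff_distrib by (rule integrable_abs[OF Bochner_Integration.integrable_diff[OF ib idf]])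
    fix a :: 'a
    show "\<bar>bump e a * (defect t h U - defect t h (\<lambda>q. U (q + a)))\<bar> \<le> bump e a * K1"
    proof (cases "norm a \<le> e")
      case True
      have "\<bar>defect t h U - defect t h (\<lambda>q. U (q + a))\<bar> \<le> K1"
        unfolding K1_def by (rule defect_shift[OF e(2) True U_lip suppM h])
      then show ?thesis by (simp add: abs_mult mult_left_mono)
    qed (simp add: bump0)
  qed
  also have "\<dots> = Z * K1" by (simp add: Z_def)
  finally have 1: "\<bar>Z * defect t h U - (LBINT b. U b * defect t h (\<lambda>q. bump e (q - b)))\<bar> \<le> Z * K1"
    unfolding D[symmetric] main .
  have "\<bar>LBINT b. U b * defect t h (\<lambda>q. bump e (q - b))\<bar> \<le> (B * (defect_const e * h\<^sup>2)) * vol M"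
    unfolding vol_def
  proof (rule integral_bounded_support[where b = 0])
    show "(\<lambda>b. U b * defect t h (\<lambda>q. bump e (q - b))) \<in> borel_measurable borel"
      using borel_measurable_integrable[OF idg] by simp
    show "\<bar>U b * defect t h (\<lambda>q. bump e (q - b))\<bar> \<le> B * (defect_const e * h\<^sup>2)" for b
    proof (cases "b \<in> S")
      case True
      show ?thesis unfolding abs_mult
        by (intro mult_mono U_le defect_bump[OF e(1) ball[OF True] pos[OF True] t h N] B) auto
    next
      case False
      then show ?thesis using B defect_const_nonneg[OF e(1)] by (simp add: supp)
    qed
  qed (simp add: suppM)
  with 1 have "Z * \<bar>defect t h U\<bar> \<le> Z * K1 + (B * (defect_const e * h\<^sup>2)) * vol M"
    using Z by (simp add: abs_mult[symmetric] abs_le_iff) linarith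
  then have "\<bar>defect t h U\<bar> \<le> (Z * K1 + (B * (defect_const e * h\<^sup>2)) * vol M) / Z"
    using Z by (simp add: pos_le_divide_eq mult.commute)
  also have "\<dots> = K1 + B * vol M * defect_const e / Z * h\<^sup>2"
    using Z by (simp add: add_divide_distrib)
  finally show ?thesis unfolding K1_def Z_def .
qed

end

section \<open>Transport of mass along the flow\<close>

context transport
begin

definition good :: "(real \<times> 'a) set" where
  "good = {z. snd z \<in> \<Omega> \<and> d < R (fst z) (snd z)}"

definition surv :: "real \<Rightarrow> 'a set" where
  "surv T = {q. \<forall>s\<in>{0..T}. (s, fl 0 s q) \<in> good}"

lemma open_good: "open good"
proof -
  have "open (snd -` \<Omega> \<inter> {z::real \<times> 'a. d < R (fst z) (snd z)})"
    by (intro open_Int open_vimage open_\<Omega> open_Collect_less continuous_on_snd continuous_on_const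
        continuous_on_R continuous_on_id)
  then show ?thesis by (simp add: good_def vimage_def Int_def)
qed

lemma surv_subset: "0 \<le> T \<Longrightarrow> surv T \<subseteq> \<Omega>"
  by (force simp: surv_def good_def)

text \<open>Rescaling time to \<open>[0, 1]\<close> makes the range of the quantifier a fixed compact set.\<close>

lemma open_surv_joint: "open {z. \<forall>l\<in>{0..1}. (l * fst z, fl 0 (l * fst z) (snd z)) \<in> good}"
proof -
  have "open ((\<lambda>z::real \<times> real \<times> 'a. (fst z * fst (snd z), fl 0 (fst z * fst (snd z)) (snd (snd z)))) -` good)"
    by (rule open_vimage[OF open_good]) (intro continuous_intros)
  then have "closed (- ((\<lambda>z::real \<times> real \<times> 'a. (fst z * fst (snd z), fl 0 (fst z * fst (snd z)) (snd (snd z)))) -` good))"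
    by (simp add: closed_Compl)
  \<comment> \<open>The set of failures is the projection of a closed set along a compact interval,
    hence closed.\<close>
  from closed_compact_projection[OF compact_Icc[of 0 "1::real"] this]
  have "open (- {z::real \<times> 'a. \<exists>l. l \<in> {0..1} \<and> (l, z) \<in> - ((\<lambda>z::real \<times> real \<times> 'a. (fst z * fst (snd z), fl 0 (fst z * fst (snd z)) (snd (snd z)))) -` good)})"
    by (rule open_Compl)
  also have "\<dots> = {z. \<forall>l\<in>{0..1}. (l * fst z, fl 0 (l * fst z) (snd z)) \<in> good}" (is "_ = ?S")
    by (auto simp: vimage_def)
  finally show ?thesis .
qed

lemma surv_rescale:
  assumes "0 \<le> T"
  shows "q \<in> surv T \<longleftrightarrow> (\<forall>l\<in>{0..1}. (l * T, fl 0 (l * T) q) \<in> good)"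
proof
  assume "q \<in> surv T"
  then show "\<forall>l\<in>{0..1}. (l * T, fl 0 (l * T) q) \<in> good"
    using assms by (auto simp: surv_def mult_left_le_one_le)
next
  assume *: "\<forall>l\<in>{0..1}. (l * T, fl 0 (l * T) q) \<in> good"
  show "q \<in> surv T" unfolding surv_def
  proof (intro CollectI ballI)
    fix s assume s: "s \<in> {0..T}"
    show "(s, fl 0 s q) \<in> good"
    proof (cases "T = 0")
      case True
      then show ?thesis using s bspec[OF *, of 0] by simp
    next
      case False
      then show ?thesis using s assms bspec[OF *, of "s / T"] by (simp add: field_simps)
    qed
  qed
qed

lemma open_surv:
  assumes "0 \<le> T"
  shows "open (surv T)"
proof -
  have "surv T = Pair T -` {z. \<forall>l\<in>{0..1}. (l * fst z, fl 0 (l * fst z) (snd z)) \<in> good}"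
    using surv_rescale[OF assms] by auto
  also have "open \<dots>"
    by (rule open_vimage[OF open_surv_joint]) (intro continuous_intros)
  finally show ?thesis .
qed

text \<open>The functional \<open>F t\<close> tests \<open>R t\<close> with \<open>g\<close>
  transported along the flow and joins the two sides. Since \<open>fl (t + h) 0\<close> after
  \<open>fl t (t + h)\<close> is \<open>fl t 0\<close>, an increment of \<open>F\<close> is the
  defect of the later test function plus the discrepancy between an Euler step and the true flow,
  and both are negligible.\<close>

lemma transport_identity:
  assumes T: "0 \<le> T" "T \<le> N"
    and g_lip: "\<And>p q. \<bar>g p - g q\<bar> \<le> Lg * norm (p - q)" and g_le: "\<And>q. \<bar>g q\<bar> \<le> B"
    and S: "compact S" "S \<subseteq> surv T" and supp: "\<And>q. q \<notin> S \<Longrightarrow> g q = 0"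
  shows "(LBINT p. g (fl T 0 p) * R T p) = (LBINT q. g q * R 0 q)"
proof -
  define F where "F t = (LBINT p. g (fl t 0 p) * R t p)" for t
  \<comment> \<open>The tube of all trajectories starting in \<open>S\<close>. Being compact inside
    the open good set, it has a uniform margin \<open>r\<close>, and every transported test function
    is supported in its time slices.\<close>
  define K where "K = (\<lambda>z. (fst z, fl 0 (fst z) (snd z))) ` ({0..T} \<times> S)"
  have Lg: "0 \<le> Lg" by (rule lipschitz_const_nonneg[OF g_lip])
  have B: "0 \<le> B" using order_trans[OF abs_ge_zero g_le[of 0]] .
  have gc: "continuous_on X f \<Longrightarrow> continuous_on X (\<lambda>x. g (f x))" for X and f :: "'a \<Rightarrow> 'a"
    by (rule continuous_on_lipschitz_compose[OF g_lip])
  have K: "compact K" unfolding K_def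
    by (intro compact_continuous_image compact_Times S compact_Icc continuous_intros)
  have "K \<subseteq> good" using S by (auto simp: K_def surv_def)
  then obtain r where r: "0 < r" "(\<Union>x\<in>K. ball x r) \<subseteq> good"
    using compact_subset_open_imp_ball_epsilon_subset[OF K open_good] by blast
  obtain M where M: "\<And>z. z \<in> K \<Longrightarrow> norm z \<le> M"
    using compact_imp_bounded[OF K] unfolding bounded_iff by blast
  define Lu where "Lu = Lg * exp (L * T)"
  define A where "A = Lu * (LR + L * BR + C * LR) * vol (M + 2)"
  define U where "U u p = g (fl u 0 p)" for u p
  have U_lip: "\<bar>U u p - U u q\<bar> \<le> Lu * norm (p - q)" if "0 \<le> u" "u \<le> T" for u p q
  proof -
    have "\<bar>U u p - U u q\<bar> \<le> Lg * norm (fl u 0 p - fl u 0 q)" unfolding U_def by (rule g_lip)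
    also have "\<dots> \<le> Lg * (exp (L * T) * norm (p - q))"
    proof (intro mult_left_mono Lg order_trans[OF fl_lipschitz] mult_right_mono)
      show "exp (L * \<bar>0 - u\<bar>) \<le> exp (L * T)" using that L_pos by simp
    qed auto
    finally show ?thesis by (simp add: Lu_def)
  qed
  have U_supp: "(u, p) \<in> K" if "U u p \<noteq> 0" "0 \<le> u" "u \<le> T" for u p
  proof -
    have "fl u 0 p \<in> S" using supp that by (auto simp: U_def)
    then show ?thesis unfolding K_def using that
      by (intro image_eqI[of _ _ "(u, fl u 0 p)"]) auto
  qed
  have normK: "norm p \<le> M" if "(u, p) \<in> K" for u p
    using M[OF that] norm_snd_le[of p u] by simp
  have "F T = F 0"
  proof (rule zero_increments_imp_eq[OF T(1)])
    show "0 < min 1 (r / 2)" using r by simp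
    fix e assume e: "0 < e" "e < min 1 (r / 2)"
    define Kc where "Kc = Lu * (L * (1 + C)) * BR * vol (M + 1)
      + B * vol M * defect_const e / (LBINT q. bump e (q::'a))"
    \<comment> \<open>Half of the margin \<open>r\<close> is left for the time shift and half for
      the bump radius \<open>e\<close>; the second bound ensures
      \<open>h * C \<le> 1\<close>.\<close>
    define h0 where "h0 = min (r / 2) (1 / (C + 1))"
    have h0: "0 < h0" using r C_nonneg by (simp add: h0_def)
    have "\<bar>F (t + h) - F t\<bar> \<le> A * e * h + Kc * h\<^sup>2" if t: "0 \<le> t" and h: "0 \<le> h" "h < h0" and tT: "t + h \<le> T" for t h
    proof -
      have "h * (C + 1) \<le> 1 / (C + 1) * (C + 1)"
        using h C_nonneg by (intro mult_right_mono) (auto simp: h0_def)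
      then have hC: "h * C \<le> 1" using C_nonneg h by (simp add: algebra_simps)
      have tN: "t + h \<le> N" using tT T by simp
      have th: "0 \<le> t + h" using t h by simp
      define u where "u = U (t + h)"
      have u_lip: "\<bar>u p - u q\<bar> \<le> Lu * norm (p - q)" for p q unfolding u_def by (rule U_lip[OF th tT])
      have uc: "continuous_on UNIV u" unfolding u_def U_def by (intro gc continuous_intros)
      have uc': "continuous_on X f \<Longrightarrow> continuous_on X (\<lambda>x. u (f x))" for X and f :: "'a \<Rightarrow> 'a"
        by (rule continuous_on_compose2[OF uc]) auto
      have near: "(t, p) \<in> good" if b: "(t + h, b) \<in> K" and p: "p \<in> cball b e" for b p
      proof -
        have "dist (t + h, b) (t, p) \<le> h + dist b p"
          unfolding dist_Pair_Pair using h sqrt_sum_squares_le_sum[of h "dist b p"] by (simp add: dist_real_def)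
        also have "\<dots> < r" using p e h by (simp add: h0_def)
        finally have "(t, p) \<in> ball (t + h, b) r" by simp
        then show ?thesis using r(2) b by blast
      qed
      have defect: "\<bar>defect t h u\<bar> \<le> Lu * (LR + L * BR + C * LR) * e * h * vol (M + 2)
          + B * vol M * defect_const e / (LBINT q. bump e (q::'a)) * h\<^sup>2"
      proof (rule defect_lipschitz[where S = "{b. (t + h, b) \<in> K}", OF _ _ u_lip])
        show "u q = 0" if "q \<notin> {b. (t + h, b) \<in> K}" for q
          using U_supp[of "t + h" q] that th tT by (auto simp: u_def)
        show "\<bar>u q\<bar> \<le> B" for q unfolding u_def U_def by (rule g_le)
        show "{b. (t + h, b) \<in> K} \<subseteq> cball 0 M" using normK by auto
        show "cball b e \<subseteq> \<Omega>" if "b \<in> {b. (t + h, b) \<in> K}" for b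
          using near[of b] that by (auto simp: good_def)
        show "d < R t q" if "b \<in> {b. (t + h, b) \<in> K}" "q \<in> cball b e" for b q
          using near[of b q] that by (auto simp: good_def)
      qed (use e t h hC tN in auto)
      have hw: "norm (h *\<^sub>R w t q) \<le> h * C" for q
        using h w_bound[of t q] by (simp add: mult_left_mono)
      have u0: "u q = 0" if "M < norm q" for q
        using U_supp[of "t + h" q] normK[of "t + h" q] that th tT by (auto simp: u_def)
      have u1: "u (q + h *\<^sub>R w t q) = 0" if "M + 1 < norm q" for q
        by (rule u0) (use norm_diff_ineq[of q "h *\<^sub>R w t q"] hw[of q] hC that in linarith)
      have u2: "u (fl t (t + h) q) = 0" if "M + 1 < norm q" for q
      proof (rule u0)
        have "norm (fl t (t + h) q - q) \<le> h * C" using fl_bound[of t "t + h" q] h by (simp add: mult.commute)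
        moreover have "norm q - norm (fl t (t + h) q - q) \<le> norm (fl t (t + h) q)"
          using norm_triangle_ineq2[of q "q - fl t (t + h) q"] by (simp add: norm_minus_commute)
        ultimately show "M < norm (fl t (t + h) q)" using hC that by linarith
      qed
      have int: "integrable lborel f" if "continuous_on UNIV f" "\<And>q. M + 1 < norm q \<Longrightarrow> f q = 0" for f :: "'a \<Rightarrow> real"
        by (rule integrable_compact_support[OF that(1) compact_cball[of 0 "M + 1"]]) (use that(2) in auto)
      have i1: "integrable lborel (\<lambda>q. u q * R (t + h) q)"
        by (rule int) (intro continuous_intros uc', simp add: u0)
      have i2: "integrable lborel (\<lambda>q. u (fl t (t + h) q) * R t q)"
        by (rule int) (intro continuous_intros uc', simp add: u2)
      \<comment> \<open>The Euler step against the true flow: of order \<open>h\<^sup>2\<close> by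
        \<open>fl_first_order\<close>.\<close>
      define E where "E q = (u (q + h *\<^sub>R w t q) - u (fl t (t + h) q)) * R t q" for q
      have iE: "integrable lborel E" unfolding E_def
        by (rule int) (intro continuous_intros uc', simp add: u1 u2)
      have i3: "integrable lborel (\<lambda>q. u q * (R (t + h) q - R t q) - (u (q + h *\<^sub>R w t q) - u q) * R t q)"
        by (rule int) (intro continuous_intros uc', simp add: u1 u0)
      have "F (t + h) - F t = (LBINT q. u q * R (t + h) q - u (fl t (t + h) q) * R t q)"
        using i1 i2 by (simp add: F_def u_def U_def fl_trans)
      also have "\<dots> = (LBINT q. (u q * (R (t + h) q - R t q) - (u (q + h *\<^sub>R w t q) - u q) * R t q) + E q)"
        by (intro Bochner_Integration.integral_cong refl) (simp add: E_def algebra_simps)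
      also have "\<dots> = defect t h u + (LBINT q. E q)"
        unfolding defect_def by (rule Bochner_Integration.integral_add[OF i3 iE])
      finally have F: "F (t + h) - F t = defect t h u + (LBINT q. E q)" .
      have "\<bar>LBINT q. E q\<bar> \<le> (Lu * (L * (1 + C) * h\<^sup>2) * BR) * vol (M + 1)"
        unfolding vol_def
      proof (rule integral_bounded_support[where b = 0])
        show "E \<in> borel_measurable borel" using borel_measurable_integrable[OF iE] by simp
        fix q
        have "\<bar>u (q + h *\<^sub>R w t q) - u (fl t (t + h) q)\<bar> \<le> Lu * norm (q + h *\<^sub>R w t q - fl t (t + h) q)"
          by (rule u_lip)
        also have "\<dots> \<le> Lu * (L * (1 + C) * h\<^sup>2)"
        proof (rule mult_left_mono)
          have "norm (q + h *\<^sub>R w t q - fl t (t + h) q) = norm (fl t (t + h) q - q - h *\<^sub>R w t q)"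
            by (metis diff_diff_eq norm_minus_commute)
          then show "norm (q + h *\<^sub>R w t q - fl t (t + h) q) \<le> L * (1 + C) * h\<^sup>2"
            using fl_first_order[OF h(1), of t q] by simp
        qed (use Lg in \<open>simp add: Lu_def\<close>)
        finally show "\<bar>E q\<bar> \<le> Lu * (L * (1 + C) * h\<^sup>2) * BR"
          unfolding E_def abs_mult using R_le[of t q] R_nonneg[of t q] by (intro mult_mono) auto
      qed (simp add: E_def u1 u2)
      moreover have "A * e * h + Kc * h\<^sup>2 = (Lu * (LR + L * BR + C * LR) * e * h * vol (M + 2)
          + B * vol M * defect_const e / (LBINT q. bump e (q::'a)) * h\<^sup>2) + (Lu * (L * (1 + C) * h\<^sup>2) * BR) * vol (M + 1)"
        unfolding A_def Kc_def by (simp add: algebra_simps)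
      ultimately show ?thesis using defect unfolding F by linarith
    qed
    then show "\<exists>K. \<exists>h0>0. \<forall>t h. 0 \<le> t \<longrightarrow> 0 \<le> h \<longrightarrow> h < h0 \<longrightarrow> t + h \<le> T \<longrightarrow>
      \<bar>F (t + h) - F t\<bar> \<le> A * e * h + K * h\<^sup>2" using h0 by blast
  qed
  then show ?thesis by (simp add: F_def)
qed

end

section \<open>From Lipschitz test functions to an identity of measures\<close>

locale bounded_transport = transport +
  assumes bounded_\<Omega>: "bounded \<Omega>"
begin

text \<open>The indicator of an open set is the increasing limit of Lipschitz functions with compact
  support in it, built from the distance to the complement, so monotone convergence applies.\<close>

lemma nn_integral_transport_open:
  assumes T: "0 \<le> T" "T \<le> N" and V: "open V" "V \<subseteq> surv T"
  shows "(\<integral>\<^sup>+p. ennreal (indicator V (fl T 0 p) * R T p) \<partial>lborel) = (\<integral>\<^sup>+q. ennreal (indicator V q * R 0 q) \<partial>lborel)"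
proof -
  have bV: "bounded V" using bounded_subset[OF bounded_\<Omega>] V(2) surv_subset[OF T(1)] by blast
  \<comment> \<open>The value of \<open>infdist\<close> to the empty set is 0, so the complement
    must be nonempty for \<open>D\<close> to be positive on \<open>V\<close>.\<close>
  have ne: "- V \<noteq> {}"
  proof
    assume "- V = {}"
    then have "V = UNIV" by blast
    with bV not_bounded_UNIV show False by simp
  qed
  define D where "D q = infdist q (- V)" for q
  have D0: "0 \<le> D q" for q by (simp add: D_def infdist_nonneg)
  have D_pos: "0 < D q" if "q \<in> V" for q
    unfolding D_def by (rule infdist_pos_not_in_closed) (use V ne that in auto)
  have D_zero: "D q = 0" if "q \<notin> V" for q
    using that by (simp add: D_def)
  have D_lip: "\<bar>D p - D q\<bar> \<le> norm (p - q)" for p q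
    using infdist_triangle_abs[of p "- V" q] by (simp add: D_def dist_norm)
  \<comment> \<open>Subtracting 1 confines the support to points at distance at least
    \<open>1 / k\<close> from the complement, a compact subset of the bounded set
    \<open>V\<close>.\<close>
  define g where "g k q = max 0 (min 1 (real k * D q - 1))" for k :: nat and q
  have g_lip: "\<bar>g k p - g k q\<bar> \<le> real k * norm (p - q)" for k p q
  proof -
    have "\<bar>g k p - g k q\<bar> \<le> \<bar>(real k * D p - 1) - (real k * D q - 1)\<bar>" unfolding g_def by linarith
    also have "\<dots> = real k * \<bar>D p - D q\<bar>" by (simp add: abs_mult flip: right_diff_distrib)
    finally show ?thesis using mult_left_mono[OF D_lip[of p q], of "real k"] by simp
  qed
  have g01: "0 \<le> g k q" "g k q \<le> 1" for k q by (auto simp: g_def)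
  have gc: "continuous_on X (g k)" for X k
    unfolding g_def D_def by (intro continuous_intros)
  then have gc': "continuous_on X f \<Longrightarrow> continuous_on X (\<lambda>x. g k (f x))" for X k and f :: "'a \<Rightarrow> 'a"
    by (rule continuous_on_compose2[of UNIV]) auto
  have g_inc: "g k q \<le> g (Suc k) q" for k q
    unfolding g_def using D0[of q] by (simp add: algebra_simps max_def min_def)
  have lim: "(\<lambda>k. g k q) \<longlonglongrightarrow> indicator V q" for q
  proof (cases "q \<in> V")
    case True
    obtain k0 where k0: "2 / D q < real k0" using reals_Archimedean2 by blast
    have "g k q = 1" if "k0 \<le> k" for k
    proof -
      have "2 = (2 / D q) * D q" using D_pos[OF True] by simp
      also have "\<dots> \<le> real k * D q"
        using k0 that D0[of q] by (intro mult_right_mono) auto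
      finally show ?thesis by (simp add: g_def)
    qed
    then show ?thesis using True
      by (intro tendsto_eventually eventually_sequentiallyI[of k0]) auto
  next
    case False
    then show ?thesis by (simp add: g_def D_zero)
  qed
  have eq: "(\<integral>\<^sup>+p. ennreal (g k (fl T 0 p) * R T p) \<partial>lborel) = (\<integral>\<^sup>+q. ennreal (g k q * R 0 q) \<partial>lborel)" for k
  proof -
    define S where "S = {q. 1 \<le> real k * D q}"
    have "closed S" unfolding S_def D_def by (intro closed_Collect_le continuous_intros)
    moreover have SV: "S \<subseteq> V" using D_zero by (force simp: S_def)
    ultimately have S: "compact S" using bV bounded_subset compact_eq_bounded_closed by blast
    have supp: "g k q = 0" if "q \<notin> S" for q using that by (simp add: g_def S_def)
    have int0: "integrable lborel (\<lambda>q. g k q * R 0 q)"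
      by (rule integrable_compact_support[OF _ S]) (intro continuous_intros gc, simp add: supp)
    have cS: "compact (fl 0 T ` S)"
      by (intro compact_continuous_image S continuous_intros)
    have intT: "integrable lborel (\<lambda>p. g k (fl T 0 p) * R T p)"
    proof (rule integrable_compact_support[OF _ cS])
      show "g k (fl T 0 p) * R T p = 0" if "p \<notin> fl 0 T ` S" for p
      proof -
        have "fl T 0 p \<notin> S" using that image_eqI[of p "fl 0 T" "fl T 0 p" S] by auto
        then show ?thesis by (simp add: supp)
      qed
    qed (intro continuous_intros gc')
    have "(LBINT p. g k (fl T 0 p) * R T p) = (LBINT q. g k q * R 0 q)"
      by (rule transport_identity[OF T g_lip _ S _ supp, where B = 1]) (use g01 SV V in auto)
    then show ?thesis
      using nn_integral_eq_integral[OF int0] nn_integral_eq_integral[OF intT] g01 R_nonneg by simp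
  qed
  have [measurable]: "g k \<in> borel_measurable borel" "R s \<in> borel_measurable borel" "fl T 0 \<in> borel_measurable borel" for k s
    by (intro borel_measurable_continuous_onI continuous_intros gc)+
  have l0: "(\<lambda>k. \<integral>\<^sup>+q. ennreal (g k q * R 0 q) \<partial>lborel) \<longlonglongrightarrow> (\<integral>\<^sup>+q. ennreal (indicator V q * R 0 q) \<partial>lborel)"
  proof (rule nn_integral_LIMSEQ)
    show "incseq (\<lambda>k q. ennreal (g k q * R 0 q))"
      by (intro incseq_SucI le_funI ennreal_leI mult_right_mono g_inc R_nonneg)
    show "(\<lambda>k. ennreal (g k q * R 0 q)) \<longlonglongrightarrow> ennreal (indicator V q * R 0 q)" for q
      by (intro tendsto_ennrealI tendsto_intros lim)
  qed simp
  have lT: "(\<lambda>k. \<integral>\<^sup>+p. ennreal (g k (fl T 0 p) * R T p) \<partial>lborel) \<longlonglongrightarrow> (\<integral>\<^sup>+p. ennreal (indicator V (fl T 0 p) * R T p) \<partial>lborel)"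
  proof (rule nn_integral_LIMSEQ)
    show "incseq (\<lambda>k p. ennreal (g k (fl T 0 p) * R T p))"
      by (intro incseq_SucI le_funI ennreal_leI mult_right_mono g_inc R_nonneg)
    show "(\<lambda>k. ennreal (g k (fl T 0 p) * R T p)) \<longlonglongrightarrow> ennreal (indicator V (fl T 0 p) * R T p)" for p
      by (intro tendsto_ennrealI tendsto_intros lim)
  qed simp
  show ?thesis using LIMSEQ_unique[OF l0 lT[unfolded eq]] by simp
qed

text \<open>Open sets form an intersection-stable generator of the Borel sets and the measures
  involved are finite, so agreement on open sets extends to all Borel functions.\<close>

lemma nn_integral_transport:
  assumes T: "0 \<le> T" "T \<le> N" and f: "f \<in> borel_measurable borel"
  shows "(\<integral>\<^sup>+q. f q * ennreal (indicator (surv T) q * R 0 q) \<partial>lborel)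
    = (\<integral>\<^sup>+p. f (fl T 0 p) * ennreal (indicator (surv T) (fl T 0 p) * R T p) \<partial>lborel)"
proof -
  have os: "open (surv T)" by (rule open_surv[OF T(1)])
  have [measurable]: "surv T \<in> sets borel" using os by simp
  have [measurable]: "R s \<in> borel_measurable borel" "fl T 0 \<in> borel_measurable borel" for s
    by (intro borel_measurable_continuous_onI continuous_intros)+
  note f[measurable]
  define m0 where "m0 = density lborel (\<lambda>q. ennreal (indicator (surv T) q * R 0 q))"
  define m1 where "m1 = density lborel (\<lambda>p. ennreal (indicator (surv T) (fl T 0 p) * R T p))"
  have em0: "emeasure m0 X = (\<integral>\<^sup>+q. ennreal (indicator (surv T \<inter> X) q * R 0 q) \<partial>lborel)"
    if [measurable]: "X \<in> sets borel" for X
    unfolding m0_def by (subst emeasure_density) (auto intro!: nn_integral_cong simp: indicator_def)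
  have em1: "emeasure (distr m1 borel (fl T 0)) X = (\<integral>\<^sup>+p. ennreal (indicator (surv T \<inter> X) (fl T 0 p) * R T p) \<partial>lborel)"
    if X[measurable]: "X \<in> sets borel" for X
  proof -
    have "fl T 0 -` X \<in> sets borel" using measurable_sets_borel[of "fl T 0" borel X] X by simp
    then show ?thesis unfolding m1_def
      by (subst emeasure_distr; simp?) (subst emeasure_density; auto intro!: nn_integral_cong simp: indicator_def)
  qed
  have "m0 = distr m1 borel (fl T 0)"
  proof (rule measure_eqI_generator_eq[where E = "{X. open X}" and \<Omega> = UNIV and A = "\<lambda>_. UNIV"])
    show "emeasure m0 X = emeasure (distr m1 borel (fl T 0)) X" if "X \<in> {X. open X}" for X
      using nn_integral_transport_open[OF T open_Int[OF os, of X]] that by (simp add: em0 em1)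
    show "emeasure m0 UNIV \<noteq> \<infinity>"
    proof -
      obtain M where "\<forall>x\<in>\<Omega>. norm x \<le> M" using bounded_\<Omega> unfolding bounded_iff ..
      then have M: "\<Omega> \<subseteq> cball 0 M" by auto
      have "emeasure m0 UNIV = (\<integral>\<^sup>+q. ennreal (indicator (surv T \<inter> UNIV) q * R 0 q) \<partial>lborel)"
        by (rule em0) simp
      also have "\<dots> \<le> (\<integral>\<^sup>+q. ennreal BR * indicator (cball (0::'a) M) q \<partial>lborel)"
      proof (rule nn_integral_mono)
        fix q
        show "ennreal (indicator (surv T \<inter> UNIV) q * R 0 q) \<le> ennreal BR * indicator (cball 0 M) q"
          using surv_subset[OF T(1)] M ennreal_leI[OF R_le[of 0 q]] by (cases "q \<in> surv T") auto
      qed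
      also have "\<dots> = ennreal BR * emeasure lborel (cball (0::'a) M)"
        by (rule nn_integral_cmult_indicator) simp
      also have "\<dots> < \<infinity>" using emeasure_compact_finite[OF compact_cball, of "0::'a" M]
        by (simp add: ennreal_mult_less_top)
      finally show ?thesis by simp
    qed
    have "sets (borel :: 'a measure) = sigma_sets UNIV {X. open X}" by (simp add: borel_def)
    then show "sets m0 = sigma_sets UNIV {X. open X}" "sets (distr m1 borel (fl T 0)) = sigma_sets UNIV {X. open X}"
      by (simp_all add: m0_def)
  qed (auto simp: Int_stable_def)
  then have "(\<integral>\<^sup>+q. f q \<partial>m0) = (\<integral>\<^sup>+p. f (fl T 0 p) \<partial>m1)"
    by (simp add: nn_integral_distr m1_def)
  then show ?thesis
    unfolding m0_def m1_def by (simp add: nn_integral_density mult.commute)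
qed

text \<open>Survival is required up to \<open>s\<close> only, so the time integral runs up to the
  exit time or to \<open>T\<close>, whichever comes first.\<close>

definition inverse_density :: "real \<Rightarrow> real \<Rightarrow> 'a \<Rightarrow> real" where
  "inverse_density T s q = (if s \<in> {0..T} \<and> q \<in> surv s then 1 / R s (fl 0 s q) else 0)"

lemma measurable_inverse_density:
  "(\<lambda>z. ennreal (inverse_density T (fst z) (snd z))) \<in> borel_measurable borel"
proof -
  define V where "V = {z. \<forall>l\<in>{0..1}. (l * fst z, fl 0 (l * fst z) (snd z)) \<in> good}"
  have [measurable]: "V \<in> sets borel" unfolding V_def using open_surv_joint by (rule borel_open)
  have [measurable]: "{0..T} \<times> (UNIV::'a set) \<in> sets borel" by (intro borel_closed closed_Times) auto
  have [measurable]: "(\<lambda>z. R (fst z) (fl 0 (fst z) (snd z))) \<in> borel_measurable borel"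
    by (intro borel_measurable_continuous_onI continuous_intros)
  have "inverse_density T (fst z) (snd z) = indicator ({0..T} \<times> UNIV \<inter> V) z / R (fst z) (fl 0 (fst z) (snd z))" for z
    using surv_rescale[of "fst z" "snd z"]
    by (cases z) (auto simp: inverse_density_def V_def indicator_def)
  then show ?thesis by simp
qed

text \<open>The flow carries \<open>R 0\<close> to \<open>R s\<close>, which cancels the density in the denominator.\<close>

lemma nn_integral_inverse_density:
  assumes T: "0 \<le> T" "T \<le> N"
  shows "(\<integral>\<^sup>+q. (\<integral>\<^sup>+s. ennreal (inverse_density T s q) \<partial>lborel) * ennreal (indicator (ball 0 r) q * R 0 q) \<partial>lborel)
    \<le> ennreal T * emeasure lborel (cball (0::'a) (r + C * T))"
proof -
  note m [measurable] = measurable_inverse_density[of T]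
  have mp: "(\<lambda>z. ennreal (inverse_density T (fst z) (snd z))) \<in> borel_measurable (lborel \<Otimes>\<^sub>M lborel)"
    using m by (simp add: lborel_prod)
  have Rm [measurable]: "R s \<in> borel_measurable borel" for s
    by (intro borel_measurable_continuous_onI continuous_intros)
  have flm [measurable]: "fl s t \<in> borel_measurable borel" for s t
    by (intro borel_measurable_continuous_onI continuous_intros)
  have bm [measurable]: "ball (0::'a) r \<in> sets borel" by simp
  let ?a = "\<lambda>q. ennreal (indicator (ball 0 r) q * R 0 q)"
  have am: "?a \<in> borel_measurable lborel" by measurable
  have sm: "(\<lambda>s. ennreal (inverse_density T s q)) \<in> borel_measurable lborel" for q
    using measurable_Pair1[OF mp, of q] by simp
  have qm: "(\<lambda>q. ennreal (inverse_density T s q)) \<in> borel_measurable lborel" for s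
    using measurable_Pair2[OF mp, of s] by simp
  have am': "(\<lambda>z. ?a (snd z)) \<in> borel_measurable (lborel \<Otimes>\<^sub>M lborel)"
    by (rule measurable_compose[OF measurable_snd am])
  have "(\<integral>\<^sup>+q. (\<integral>\<^sup>+s. ennreal (inverse_density T s q) \<partial>lborel) * ?a q \<partial>lborel)
      = (\<integral>\<^sup>+q. (\<integral>\<^sup>+s. ennreal (inverse_density T s q) * ?a q \<partial>lborel) \<partial>lborel)"
    by (intro nn_integral_cong nn_integral_multc[symmetric] sm)
  also have "\<dots> = (\<integral>\<^sup>+s. (\<integral>\<^sup>+q. ennreal (inverse_density T s q) * ?a q \<partial>lborel) \<partial>lborel)"
    using lborel_pair.Fubini'[of "\<lambda>s q. ennreal (inverse_density T s q) * ?a q"] borel_measurable_times_ennreal[OF mp am']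
    by (simp add: split_beta')
  also have "\<dots> \<le> (\<integral>\<^sup>+s. emeasure lborel (cball (0::'a) (r + C * T)) * indicator {0..T} s \<partial>lborel)"
  proof (rule nn_integral_mono)
    fix s :: real
    show "(\<integral>\<^sup>+q. ennreal (inverse_density T s q) * ?a q \<partial>lborel)
        \<le> emeasure lborel (cball (0::'a) (r + C * T)) * indicator {0..T} s"
    proof (cases "s \<in> {0..T}")
      case True
      then have s: "0 \<le> s" "s \<le> T" "s \<le> N" using T by auto
      \<comment> \<open>After transport \<open>f\<close> is evaluated at \<open>fl s 0 p\<close>,
        its denominator becomes \<open>R s p\<close>, and the product with the density is at most
        1.\<close>
      define f where "f q = ennreal (indicator (ball 0 r) q / R s (fl 0 s q))" for q
      have fm: "f \<in> borel_measurable borel" unfolding f_def by measurable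
      have "(\<integral>\<^sup>+q. ennreal (inverse_density T s q) * ?a q \<partial>lborel)
          = (\<integral>\<^sup>+q. f q * ennreal (indicator (surv s) q * R 0 q) \<partial>lborel)"
        using True R_nonneg
        by (intro nn_integral_cong) (auto simp: inverse_density_def f_def indicator_def)
      also have "\<dots> = (\<integral>\<^sup>+p. f (fl s 0 p) * ennreal (indicator (surv s) (fl s 0 p) * R s p) \<partial>lborel)"
        by (rule nn_integral_transport[OF s(1,3) fm])
      also have "\<dots> \<le> (\<integral>\<^sup>+p. indicator (cball (0::'a) (r + C * T)) p \<partial>lborel)"
      proof (rule nn_integral_mono)
        fix p
        show "f (fl s 0 p) * ennreal (indicator (surv s) (fl s 0 p) * R s p) \<le> indicator (cball (0::'a) (r + C * T)) p"
        proof (cases "fl s 0 p \<in> ball 0 r")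
          case True
          \<comment> \<open>A point whose origin lies in the ball of radius \<open>r\<close> has
            moved by at most \<open>C * T\<close>, whence the radius of the final ball.\<close>
          have "norm (fl s 0 p - p) \<le> C * s" using fl_bound[of s 0 p] s by simp
          also have "\<dots> \<le> C * T" using s C_nonneg by (intro mult_left_mono) auto
          finally have "norm p \<le> r + C * T"
            using True norm_triangle_ineq3[of "fl s 0 p" p] by auto
          moreover have "f (fl s 0 p) * ennreal (indicator (surv s) (fl s 0 p) * R s p) \<le> 1"
            using R_nonneg[of s p] True
            by (auto simp: f_def indicator_def ennreal_mult[symmetric] simp flip: ennreal_1 intro!: ennreal_leI)
          ultimately show ?thesis by simp
        qed (simp add: f_def)
      qed
      also have "\<dots> = emeasure lborel (cball (0::'a) (r + C * T))" by simp
      finally show ?thesis using True by simp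
    next
      case False
      then have "inverse_density T s q = 0" for q by (auto simp: inverse_density_def)
      then show ?thesis by simp
    qed
  qed
  also have "\<dots> = emeasure lborel (cball (0::'a) (r + C * T)) * ennreal T"
    using T by (subst nn_integral_cmult_indicator) auto
  finally show ?thesis by (simp add: mult.commute)
qed

lemma measurable_residence [measurable]:
  "(\<lambda>q. \<integral>\<^sup>+s. ennreal (inverse_density T s q) \<partial>lborel) \<in> borel_measurable borel"
proof -
  have "(\<lambda>(q, s). ennreal (inverse_density T s q)) \<in> borel_measurable (lborel \<Otimes>\<^sub>M lborel)"
    using measurable_compose[OF measurable_pair_swap'[of lborel lborel], of "\<lambda>z. ennreal (inverse_density T (fst z) (snd z))" borel]
      measurable_inverse_density[of T]
    by (simp add: lborel_prod split_beta')
  from lborel.borel_measurable_nn_integral[OF this] show ?thesis by simp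
qed

end

text \<open>Pairs closer than a Lebesgue number \<open>r\<close> of a finite subcover lie in one
  ball and inherit its constant. For distant pairs the diameter of the image divided by
  \<open>r\<close> serves as constant.\<close>

lemma lipschitz_on_compact:
  fixes f :: "'a::metric_space \<Rightarrow> 'b::metric_space"
  assumes loc: "\<And>x. x \<in> S \<Longrightarrow> \<exists>e>0. \<exists>L. L-lipschitz_on (ball x e \<inter> S) f"
    and K: "compact K" "K \<subseteq> S"
  obtains L where "0 < L" "\<And>x y. x \<in> K \<Longrightarrow> y \<in> K \<Longrightarrow> dist (f x) (f y) \<le> L * dist x y"
proof -
  obtain e l where el: "\<And>x. x \<in> S \<Longrightarrow> 0 < e x \<and> (l x)-lipschitz_on (ball x (e x) \<inter> S) f"
    using loc by metis
  have "K \<subseteq> (\<Union>x\<in>K. ball x (e x))" using el K by force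
  then obtain D where D: "D \<subseteq> K" "finite D" "K \<subseteq> (\<Union>x\<in>D. ball x (e x))"
    using compactE_image[OF K(1), of K "\<lambda>x. ball x (e x)"] by auto
  obtain r where r: "0 < r" "\<And>x. x \<in> K \<Longrightarrow> \<exists>G\<in>(\<lambda>x. ball x (e x)) ` D. ball x r \<subseteq> G"
    by (rule Heine_Borel_lemma[OF K(1), of "(\<lambda>x. ball x (e x)) ` D"]) (use D in auto)
  have "bounded (\<Union>x\<in>D. f ` (ball x (e x) \<inter> S))"
  proof (intro bounded_UN D ballI)
    fix x assume x: "x \<in> D"
    then have xS: "x \<in> S" using D K by auto
    have "f ` (ball x (e x) \<inter> S) \<subseteq> cball (f x) (l x * e x)"
    proof safe
      fix y assume y: "y \<in> ball x (e x)" "y \<in> S"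
      have "dist (f x) (f y) \<le> l x * dist x y"
        by (rule lipschitz_onD[of "l x" "ball x (e x) \<inter> S"]) (use el[OF xS] xS y in auto)
      also have "\<dots> \<le> l x * e x"
        using y lipschitz_on_nonneg[of "l x"] el[OF xS] by (intro mult_left_mono) auto
      finally show "f y \<in> cball (f x) (l x * e x)" by simp
    qed
    then show "bounded (f ` (ball x (e x) \<inter> S))" using bounded_cball bounded_subset by blast
  qed
  then have bK: "bounded (f ` K)"
    by (rule bounded_subset) (use D K in blast)
  define L where "L = 1 + (\<Sum>x\<in>D. l x) + diameter (f ` K) / r"
  have l0: "0 \<le> l x" if "x \<in> D" for x
    using el[of x] that D K lipschitz_on_nonneg by blast
  have d0: "0 \<le> diameter (f ` K)" using diameter_ge_0[OF bK] .
  have s0: "0 \<le> (\<Sum>x\<in>D. l x)" by (rule sum_nonneg) (rule l0)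
  show ?thesis
  proof (rule that[of L])
    show "0 < L" unfolding L_def using s0 d0 r by (intro add_pos_nonneg) auto
    fix x y assume xy: "x \<in> K" "y \<in> K"
    show "dist (f x) (f y) \<le> L * dist x y"
    proof (cases "dist x y < r")
      case True
      obtain c where c: "c \<in> D" "ball x r \<subseteq> ball c (e c)" using r(2)[OF xy(1)] by auto
      have "x \<in> ball c (e c)" "y \<in> ball c (e c)"
        using c(2) r(1) True by (auto simp: subset_iff)
      then have "dist (f x) (f y) \<le> l c * dist x y"
        using el[of c] c D K xy by (intro lipschitz_onD[of "l c" "ball c (e c) \<inter> S"]) auto
      also have "\<dots> \<le> L * dist x y"
      proof (rule mult_right_mono)
        have "l c \<le> (\<Sum>x\<in>D. l x)" using c D l0 by (intro member_le_sum) auto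
        then show "l c \<le> L" unfolding L_def using d0 r(1) by (simp add: add_increasing2)
      qed simp
      finally show ?thesis .
    next
      case False
      have "dist (f x) (f y) \<le> diameter (f ` K)"
        by (rule diameter_bounded_bound[OF bK]) (use xy in auto)
      also have "\<dots> = diameter (f ` K) / r * r" using r by simp
      also have "\<dots> \<le> diameter (f ` K) / r * dist x y"
        using False d0 r by (intro mult_left_mono) auto
      also have "\<dots> \<le> L * dist x y"
        unfolding L_def using s0 by (intro mult_right_mono) auto
      finally show ?thesis .
    qed
  qed
qed

section \<open>Regularised densities and currents on the half-plane\<close>

lemma closure_QQ: "closure QQ = {p. fst p \<le> snd p}"
  using closure_halfspace_lt[of "(1, -1) :: pt" 0] by (simp add: zero_prod_def QQ_def inner_prod_def split_beta')

lemma frontier_QQ: "frontier QQ = {p. fst p = snd p}"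
  using frontier_halfspace_lt[of "(1, -1) :: pt" 0] by (simp add: zero_prod_def QQ_def inner_prod_def split_beta')

lemma open_QQ: "open QQ"
  using open_halfspace_lt[of "(1, -1) :: pt" 0] by (simp add: QQ_def inner_prod_def split_beta')

lemma convex_closure_QQ: "convex (closure QQ)"
  using convex_halfspace_le[of "(1, -1) :: pt" 0] by (simp add: closure_QQ inner_prod_def)

lemma QQ_subset_closure: "q \<in> QQ \<Longrightarrow> q \<in> closure QQ"
  by (rule subsetD[OF closure_subset])

locale regular_current =
  fixes \<rho> :: "real \<Rightarrow> pt \<Rightarrow> real" and J :: "real \<Rightarrow> pt \<Rightarrow> pt" and C :: real
  assumes rho_lip: "locally_lipschitz_on ({0..} \<times> closure QQ) (\<lambda>(t, q). \<rho> t q)"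
    and J_lip: "locally_lipschitz_on ({0..} \<times> closure QQ) (\<lambda>(t, q). J t q)"
    and rho_nonneg: "\<And>t q. 0 \<le> t \<Longrightarrow> q \<in> closure QQ \<Longrightarrow> 0 \<le> \<rho> t q"
    and cont_eq: "AE z in lebesgue. z \<in> {0<..} \<times> QQ \<longrightarrow>
                    cont_eq_at \<rho> J (fst z) (fst (snd z)) (snd (snd z))"
    and normalized: "\<And>t. 0 \<le> t \<Longrightarrow> (\<integral>\<^sup>+ q. ennreal (indicator QQ q * \<rho> t q) \<partial>lebesgue) = 1"
    and C_pos: "0 < C"
    and J_bound: "\<And>t q. 0 \<le> t \<Longrightarrow> q \<in> closure QQ \<Longrightarrow> norm (J t q) \<le> C * \<rho> t q"
    and boundary: "\<And>t q. 0 \<le> t \<Longrightarrow> q \<in> frontier QQ \<Longrightarrow> fst (J t q) = snd (J t q)"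
begin

lemma lipschitz_compact:
  assumes "compact K" "K \<subseteq> {0..} \<times> closure QQ"
  obtains L where "0 < L"
    "\<And>s p t q. (s, p) \<in> K \<Longrightarrow> (t, q) \<in> K \<Longrightarrow> \<bar>\<rho> s p - \<rho> t q\<bar> \<le> L * dist (s, p) (t, q)"
    "\<And>s p t q. (s, p) \<in> K \<Longrightarrow> (t, q) \<in> K \<Longrightarrow> norm (J s p - J t q) \<le> L * dist (s, p) (t, q)"
proof -
  obtain L1 where L1: "0 < L1" "\<And>x y. x \<in> K \<Longrightarrow> y \<in> K \<Longrightarrow> dist (case x of (t, q) \<Rightarrow> \<rho> t q) (case y of (t, q) \<Rightarrow> \<rho> t q) \<le> L1 * dist x y"
    by (rule lipschitz_on_compact[OF _ assms, of "\<lambda>(t, q). \<rho> t q"])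
       (use rho_lip in \<open>auto simp: locally_lipschitz_on_def\<close>)
  obtain L2 where L2: "0 < L2" "\<And>x y. x \<in> K \<Longrightarrow> y \<in> K \<Longrightarrow> dist (case x of (t, q) \<Rightarrow> J t q) (case y of (t, q) \<Rightarrow> J t q) \<le> L2 * dist x y"
    by (rule lipschitz_on_compact[OF _ assms, of "\<lambda>(t, q). J t q"])
       (use J_lip in \<open>auto simp: locally_lipschitz_on_def\<close>)
  show ?thesis
  proof (rule that[of "max L1 L2"])
    show "0 < max L1 L2" using L1 by simp
    fix s p t q assume st: "(s, p) \<in> K" "(t, q) \<in> K"
    show "\<bar>\<rho> s p - \<rho> t q\<bar> \<le> max L1 L2 * dist (s, p) (t, q)"
      using L1(2)[OF st] mult_right_mono[of L1 "max L1 L2" "dist (s, p) (t, q)"] by (simp add: dist_real_def)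
    show "norm (J s p - J t q) \<le> max L1 L2 * dist (s, p) (t, q)"
      using L2(2)[OF st] mult_right_mono[of L2 "max L1 L2" "dist (s, p) (t, q)"] by (simp add: dist_norm)
  qed
qed

text \<open>The nearest-point projection to the convex compact set \<open>region n\<close> extends \<open>\<rho>\<close> and \<open>J\<close> to globally
  Lipschitz functions; bounding the density from below by \<open>1 / n\<close> removes the nodes.\<close>

definition region :: "nat \<Rightarrow> (real \<times> pt) set" where
  "region n = {0..real n} \<times> (closure QQ \<inter> cball 0 (real n))"

definition rho_ext :: "nat \<Rightarrow> real \<Rightarrow> pt \<Rightarrow> real" where
  "rho_ext n t q = (case closest_point (region n) (t, q) of (s, p) \<Rightarrow> \<rho> s p)"

definition J_ext :: "nat \<Rightarrow> real \<Rightarrow> pt \<Rightarrow> pt" where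
  "J_ext n t q = (case closest_point (region n) (t, q) of (s, p) \<Rightarrow> J s p)"

definition vel :: "nat \<Rightarrow> real \<Rightarrow> pt \<Rightarrow> pt" where
  "vel n t q = (1 / max (rho_ext n t q) (1 / real n)) *\<^sub>R J_ext n t q"

lemma compact_region: "compact (region n)"
  unfolding region_def by (intro compact_Times closed_Int_compact closed_closure compact_cball compact_Icc)

lemma convex_region: "convex (region n)"
  unfolding region_def by (intro convex_Times convex_Int convex_closure_QQ convex_cball convex_real_interval)

lemma zero_in_region: "(0, 0) \<in> region n"
  by (simp add: region_def closure_QQ)

lemma closed_region: "closed (region n)"
  using compact_region by (rule compact_imp_closed)

lemma region_subset: "region n \<subseteq> {0..} \<times> closure QQ"
  by (auto simp: region_def)

lemma in_regionD: "(s, p) \<in> region n \<Longrightarrow> 0 \<le> s \<and> p \<in> closure QQ"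
  by (simp add: region_def)

lemma region_ne: "region n \<noteq> {}"
  using zero_in_region by blast

lemma proj_in_region: "closest_point (region n) z \<in> region n"
  by (rule closest_point_in_set[OF closed_region region_ne])

lemma ext_eq:
  assumes "(t, q) \<in> region n"
  shows "rho_ext n t q = \<rho> t q" "J_ext n t q = J t q"
  using assms by (simp_all add: rho_ext_def J_ext_def closest_point_self)

lemma proj_lipschitz:
  "dist (closest_point (region n) (s, p)) (closest_point (region n) (t, q)) \<le> \<bar>s - t\<bar> + norm (p - q)"
proof -
  have "dist (closest_point (region n) (s, p)) (closest_point (region n) (t, q)) \<le> dist (s, p) (t, q)"
    by (rule closest_point_lipschitz[OF convex_region closed_region region_ne])
  also have "\<dots> \<le> dist s t + dist p q"
    unfolding dist_Pair_Pair by (rule sqrt_sum_squares_le_sum) auto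
  finally show ?thesis by (simp add: dist_real_def dist_norm)
qed

lemma rho_ext_nonneg: "0 \<le> rho_ext n t q"
  using proj_in_region[of n "(t, q)"] by (auto simp: rho_ext_def split: prod.split intro!: rho_nonneg dest: in_regionD)

lemma J_ext_bound: "norm (J_ext n t q) \<le> C * rho_ext n t q"
  using proj_in_region[of n "(t, q)"]
  by (auto simp: rho_ext_def J_ext_def split: prod.split intro!: J_bound dest: in_regionD)

lemma ext_lipschitz:
  obtains L where "0 < L"
    "\<And>s p t q. \<bar>rho_ext n s p - rho_ext n t q\<bar> \<le> L * (\<bar>s - t\<bar> + norm (p - q))"
    "\<And>s p t q. norm (J_ext n s p - J_ext n t q) \<le> L * (\<bar>s - t\<bar> + norm (p - q))"
proof -
  obtain L where L: "0 < L"
    "\<And>s p t q. (s, p) \<in> region n \<Longrightarrow> (t, q) \<in> region n \<Longrightarrow> \<bar>\<rho> s p - \<rho> t q\<bar> \<le> L * dist (s, p) (t, q)"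
    "\<And>s p t q. (s, p) \<in> region n \<Longrightarrow> (t, q) \<in> region n \<Longrightarrow> norm (J s p - J t q) \<le> L * dist (s, p) (t, q)"
    using lipschitz_compact[OF compact_region region_subset] by blast
  show ?thesis
  proof (rule that[OF L(1)])
    fix s p t q
    obtain s' p' t' q' where P: "closest_point (region n) (s, p) = (s', p')" "closest_point (region n) (t, q) = (t', q')"
      by (meson surj_pair)
    have in_reg: "(s', p') \<in> region n" "(t', q') \<in> region n" using proj_in_region P by metis+
    have le: "L * dist (s', p') (t', q') \<le> L * (\<bar>s - t\<bar> + norm (p - q))"
      using proj_lipschitz[of n s p t q] L(1) unfolding P by (intro mult_left_mono) auto
    show "\<bar>rho_ext n s p - rho_ext n t q\<bar> \<le> L * (\<bar>s - t\<bar> + norm (p - q))"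
      using order_trans[OF L(2)[OF in_reg] le] by (simp add: rho_ext_def P)
    show "norm (J_ext n s p - J_ext n t q) \<le> L * (\<bar>s - t\<bar> + norm (p - q))"
      using order_trans[OF L(3)[OF in_reg] le] by (simp add: J_ext_def P)
  qed
qed

text \<open>Dividing by the larger denominator only lowers the speed, so the limit \<open>C\<close>
  is the same for every \<open>n\<close>; estimates of displacement survive the passage to the
  limit.\<close>

lemma vel_bound: 
  assumes n: "1 \<le> n" shows "norm (vel n t q) \<le> C"
proof -
  let ?m = "max (rho_ext n t q) (1 / real n)"
  have "0 < 1 / real n" using n by simp
  then have m: "0 < ?m" by (rule less_le_trans) simp
  have "norm (vel n t q) = norm (J_ext n t q) / ?m" using m by (simp add: vel_def)
  also have "\<dots> \<le> C * ?m / ?m"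
    using m C_pos order_trans[OF J_ext_bound[of n t q], of "C * ?m"]
    by (intro divide_right_mono) (auto intro: mult_left_mono)
  finally show ?thesis using m by simp
qed

text \<open>Changing the numerator costs \<open>n * D\<close>, since \<open>1 / m \<le> n\<close>.
  Changing the denominator costs \<open>n * D * C\<close>, because the current divided by the other
  denominator is at most \<open>C\<close>.\<close>

lemma vel_lipschitz:
  assumes n: "1 \<le> n"
    and L: "\<bar>rho_ext n s p - rho_ext n t q\<bar> \<le> D" "norm (J_ext n s p - J_ext n t q) \<le> D"
  shows "norm (vel n s p - vel n t q) \<le> real n * (1 + C) * D"
proof -
  define m where "m = max (rho_ext n s p) (1 / real n)"
  define m' where "m' = max (rho_ext n t q) (1 / real n)"
  have n0: "0 < 1 / real n" using n by simp
  have m: "1 / real n \<le> m" "1 / real n \<le> m'" by (auto simp: m_def m'_def)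
  then have pos: "0 < m" "0 < m'" using n0 by linarith+
  have inv: "1 / m \<le> real n" using m(1) n pos by (simp add: field_simps)
  have D: "0 \<le> D" using order_trans[OF abs_ge_zero L(1)] .
  have J': "norm (J_ext n t q) \<le> C * m'"
    by (rule order_trans[OF J_ext_bound]) (use C_pos in \<open>auto simp: m'_def\<close>)
  have "vel n s p - vel n t q = (1 / m) *\<^sub>R (J_ext n s p - J_ext n t q) + (1 / m - 1 / m') *\<^sub>R J_ext n t q"
    unfolding vel_def m_def[symmetric] m'_def[symmetric] by (simp add: algebra_simps)
  also have "norm \<dots> \<le> norm ((1 / m) *\<^sub>R (J_ext n s p - J_ext n t q)) + norm ((1 / m - 1 / m') *\<^sub>R J_ext n t q)"
    by (rule norm_triangle_ineq)
  also have "norm ((1 / m) *\<^sub>R (J_ext n s p - J_ext n t q)) \<le> real n * D"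
    using pos inv L(2) by (simp add: mult_mono divide_inverse mult.commute[of "norm _"])
  also have "norm ((1 / m - 1 / m') *\<^sub>R J_ext n t q) \<le> real n * (C * D)"
  proof -
    have "1 / m - 1 / m' = (m' - m) * (1 / m) * (1 / m')" using pos by (simp add: field_simps)
    then have "norm ((1 / m - 1 / m') *\<^sub>R J_ext n t q) = \<bar>m' - m\<bar> * (1 / m) * ((1 / m') * norm (J_ext n t q))"
      using pos by (simp add: abs_mult)
    also have "\<dots> \<le> D * real n * C"
    proof (intro mult_mono inv)
      show "\<bar>m' - m\<bar> \<le> D" using L(1) by (auto simp: m_def m'_def)
      show "1 / m' * norm (J_ext n t q) \<le> C" using J' pos by (simp add: field_simps)
    qed (use pos D C_pos in auto)
    finally show ?thesis by (simp add: mult_ac)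
  qed
  finally show ?thesis by (simp add: algebra_simps)
qed

lemma sum_Basis_pt: "(\<Sum>i\<in>Basis. f i) = f (1, 0) + f (0, 1)" for f :: "pt \<Rightarrow> real"
  by (simp add: Basis_prod_def sum.union_disjoint)

text \<open>Around an interior point of \<open>region n\<close> the extensions coincide with
  \<open>\<rho>\<close> and \<open>J\<close>, so for large \<open>k\<close> the difference quotients
  are the original ones and converge to the partial derivatives.\<close>

lemma ext_continuity_eq:
  "AE z in lborel. 0 < fst z \<and> fst z < real n \<and> snd z \<in> QQ \<inter> ball 0 (real n) \<longrightarrow>
    (\<lambda>k. (rho_ext n (fst z + 1 / Suc k) (snd z) - rho_ext n (fst z) (snd z)) / (1 / Suc k)
      + (\<Sum>i\<in>Basis. (J_ext n (fst z) (snd z + (1 / Suc k) *\<^sub>R i) \<bullet> i - J_ext n (fst z) (snd z) \<bullet> i) / (1 / Suc k)))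
    \<longlonglongrightarrow> 0"
proof -
  have "AE z in lborel. z \<in> {0<..} \<times> QQ \<longrightarrow> cont_eq_at \<rho> J (fst z) (fst (snd z)) (snd (snd z))"
    using cont_eq by (simp only: AE_completion_iff)
  then show ?thesis
  proof eventually_elim
    case (elim z)
    show ?case
    proof
      assume *: "0 < fst z \<and> fst z < real n \<and> snd z \<in> QQ \<inter> ball 0 (real n)"
      obtain t x y where z: "z = (t, x, y)" by (cases z) auto
      have t: "0 < t" "t < real n" and xy: "(x, y) \<in> QQ \<inter> ball 0 (real n)" using * z by auto
      obtain a b c where abc: "((\<lambda>s. \<rho> s (x, y)) has_real_derivative a) (at t)"
        "((\<lambda>u. fst (J t (u, y))) has_real_derivative b) (at x)"
        "((\<lambda>v. snd (J t (x, v))) has_real_derivative c) (at y)" "a + b + c = 0"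
        using elim t xy unfolding z cont_eq_at_def by auto
      have ka: "filterlim (\<lambda>k. 1 / real (Suc k)) (at 0) sequentially"
        unfolding filterlim_at by (intro conjI LIMSEQ_Suc[OF lim_1_over_n]) auto
      have ka0: "(\<lambda>k. 1 / real (Suc k)) \<longlonglongrightarrow> 0" by (rule LIMSEQ_Suc[OF lim_1_over_n])
      have "open ({0<..<real n} \<times> (QQ \<inter> ball 0 (real n)))"
        by (intro open_Times open_Int open_QQ) auto
      moreover have "(t, x, y) \<in> {0<..<real n} \<times> (QQ \<inter> ball 0 (real n))" using t xy by auto
      ultimately have nhd: "eventually (\<lambda>v. v \<in> {0<..<real n} \<times> (QQ \<inter> ball 0 (real n))) (nhds (t, x, y))"
        by (rule eventually_nhds_in_open)
      have sub: "v \<in> {0<..<real n} \<times> (QQ \<inter> ball 0 (real n)) \<Longrightarrow> v \<in> region n" for v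
        using QQ_subset_closure by (cases v) (auto simp: region_def)
      have ev: "eventually (\<lambda>k. (t + 1 / Suc k * r, x + 1 / Suc k * u, y + 1 / Suc k * v) \<in> region n) sequentially" for r u v
      proof -
        have "(\<lambda>k. (t + 1 / Suc k * r, x + 1 / Suc k * u, y + 1 / Suc k * v)) \<longlonglongrightarrow> (t + 0 * r, x + 0 * u, y + 0 * v)"
          by (intro tendsto_intros ka0)
        then have "filterlim (\<lambda>k. (t + 1 / Suc k * r, x + 1 / Suc k * u, y + 1 / Suc k * v)) (nhds (t, x, y)) sequentially"
          by simp
        from eventually_compose_filterlim[OF nhd this] show ?thesis
          by (rule eventually_mono) (rule sub)
      qed
      have base: "(t, x, y) \<in> region n" using sub t xy by auto
      have 1: "(\<lambda>k. (rho_ext n (t + 1 / Suc k) (x, y) - rho_ext n t (x, y)) / (1 / Suc k)) \<longlonglongrightarrow> a"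
      proof (rule Lim_transform_eventually)
        show "(\<lambda>k. (\<rho> (t + 1 / Suc k) (x, y) - \<rho> t (x, y)) / (1 / Suc k)) \<longlonglongrightarrow> a"
          using filterlim_compose[OF abc(1)[unfolded DERIV_def] ka] .
        show "eventually (\<lambda>k. (\<rho> (t + 1 / Suc k) (x, y) - \<rho> t (x, y)) / (1 / Suc k) =
          (rho_ext n (t + 1 / Suc k) (x, y) - rho_ext n t (x, y)) / (1 / Suc k)) sequentially"
          using ev[of 1 0 0] by eventually_elim (simp add: ext_eq base)
      qed
      have 2: "(\<lambda>k. (J_ext n t ((x, y) + (1 / Suc k) *\<^sub>R (1, 0)) \<bullet> (1, 0) - J_ext n t (x, y) \<bullet> (1, 0)) / (1 / Suc k)) \<longlonglongrightarrow> b"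
      proof (rule Lim_transform_eventually)
        show "(\<lambda>k. (fst (J t (x + 1 / Suc k, y)) - fst (J t (x, y))) / (1 / Suc k)) \<longlonglongrightarrow> b"
          using filterlim_compose[OF abc(2)[unfolded DERIV_def] ka] .
        show "eventually (\<lambda>k. (fst (J t (x + 1 / Suc k, y)) - fst (J t (x, y))) / (1 / Suc k) =
          (J_ext n t ((x, y) + (1 / Suc k) *\<^sub>R (1, 0)) \<bullet> (1, 0) - J_ext n t (x, y) \<bullet> (1, 0)) / (1 / Suc k)) sequentially"
          using ev[of 0 1 0] by eventually_elim (simp add: ext_eq base inner_prod_def)
      qed
      have 3: "(\<lambda>k. (J_ext n t ((x, y) + (1 / Suc k) *\<^sub>R (0, 1)) \<bullet> (0, 1) - J_ext n t (x, y) \<bullet> (0, 1)) / (1 / Suc k)) \<longlonglongrightarrow> c"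
      proof (rule Lim_transform_eventually)
        show "(\<lambda>k. (snd (J t (x, y + 1 / Suc k)) - snd (J t (x, y))) / (1 / Suc k)) \<longlonglongrightarrow> c"
          using filterlim_compose[OF abc(3)[unfolded DERIV_def] ka] .
        show "eventually (\<lambda>k. (snd (J t (x, y + 1 / Suc k)) - snd (J t (x, y))) / (1 / Suc k) =
          (J_ext n t ((x, y) + (1 / Suc k) *\<^sub>R (0, 1)) \<bullet> (0, 1) - J_ext n t (x, y) \<bullet> (0, 1)) / (1 / Suc k)) sequentially"
          using ev[of 0 0 1] by eventually_elim (simp add: ext_eq base inner_prod_def)
      qed
      show "(\<lambda>k. (rho_ext n (fst z + 1 / Suc k) (snd z) - rho_ext n (fst z) (snd z)) / (1 / Suc k)
        + (\<Sum>i\<in>Basis. (J_ext n (fst z) (snd z + (1 / Suc k) *\<^sub>R i) \<bullet> i - J_ext n (fst z) (snd z) \<bullet> i) / (1 / Suc k)))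
        \<longlonglongrightarrow> 0"
        unfolding z fst_conv snd_conv sum_Basis_pt
        using tendsto_add[OF 1 tendsto_add[OF 2 3]] abc(4) by (simp only: add.assoc)
    qed
  qed
qed

lemma bounded_transport_ext:
  assumes n: "1 \<le> n"
  obtains L LR BR LJ BJ where "bounded_transport (vel n) L C (rho_ext n) (J_ext n) LR BR LJ BJ (1 / real n) (real n) (QQ \<inter> ball 0 (real n))"
proof -
  obtain K where K: "0 < K"
    "\<And>s p t q. \<bar>rho_ext n s p - rho_ext n t q\<bar> \<le> K * (\<bar>s - t\<bar> + norm (p - q))"
    "\<And>s p t q. norm (J_ext n s p - J_ext n t q) \<le> K * (\<bar>s - t\<bar> + norm (p - q))"
    by (rule ext_lipschitz[of n]) (rule that; assumption)
  obtain L where L: "0 < L"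
    "\<And>s p t q. (s, p) \<in> region n \<Longrightarrow> (t, q) \<in> region n \<Longrightarrow> \<bar>\<rho> s p - \<rho> t q\<bar> \<le> L * dist (s, p) (t, q)"
    by (rule lipschitz_compact[OF compact_region[of n] region_subset]) (rule that; assumption)
  define B where "B = \<rho> 0 0 + L * diameter (region n)"
  have B: "rho_ext n t q \<le> B" for t q
  proof -
    obtain s p where P: "closest_point (region n) (t, q) = (s, p)" by (meson surj_pair)
    have in_reg: "(s, p) \<in> region n" using proj_in_region P by metis
    have "\<bar>\<rho> s p - \<rho> 0 0\<bar> \<le> L * dist (s, p) (0, 0)" by (rule L(2)[OF in_reg zero_in_region])
    also have "\<dots> \<le> L * diameter (region n)"
      using L(1) diameter_bounded_bound[OF compact_imp_bounded[OF compact_region] in_reg zero_in_region]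
      by (intro mult_left_mono) auto
    finally show ?thesis by (simp add: rho_ext_def P B_def)
  qed
  have "bounded_transport (vel n) (real n * (1 + C) * K) C (rho_ext n) (J_ext n) K B K (C * B) (1 / real n) (real n) (QQ \<inter> ball 0 (real n))"
  proof
    show "0 < real n * (1 + C) * K" using n C_pos K by simp
    show "0 \<le> C" using C_pos by simp
    show "norm (vel n s x - vel n t y) \<le> real n * (1 + C) * K * (\<bar>s - t\<bar> + norm (x - y))" for s x t y
      using vel_lipschitz[OF n K(2) K(3)[of s x t y]] by (simp add: mult.assoc)
    show "norm (vel n t x) \<le> C" for t x by (rule vel_bound[OF n])
    show "norm (J_ext n t q) \<le> C * B" for t q
      using order_trans[OF J_ext_bound mult_left_mono[OF B]] C_pos by simp
    show "rho_ext n t q *\<^sub>R vel n t q = J_ext n t q" if "1 / real n < rho_ext n t q" for t q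
    proof -
      have "0 < rho_ext n t q" using that n by (meson divide_nonneg_nonneg of_nat_0_le_iff order_le_less_trans zero_le_one)
      then show ?thesis using that by (simp add: vel_def max_def)
    qed
    show "bounded (QQ \<inter> ball 0 (real n))" by (simp add: bounded_Int)
    show "open (QQ \<inter> ball 0 (real n))" by (intro open_Int open_QQ open_ball)
  qed (rule K B rho_ext_nonneg ext_continuity_eq | simp)+
  then show ?thesis by (rule that)
qed

section \<open>Survival of trajectories\<close>

text \<open>The Lipschitz constants and bounds for each \<open>n\<close> are merely known to exist,
  so \<open>bounded_transport\<close> can be interpreted only inside a proof. This and the next
  three definitions name its objects without these constants, so that different \<open>n\<close> can
  be compared.\<close>

definition Fl :: "nat \<Rightarrow> real \<Rightarrow> pt \<Rightarrow> pt" where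
  "Fl n t q = lipschitz_field.fl (vel n) 0 t q"

definition Good :: "nat \<Rightarrow> (real \<times> pt) set" where
  "Good n = {z. snd z \<in> QQ \<and> norm (snd z) < real n \<and> 1 / real n < rho_ext n (fst z) (snd z)}"

definition Surv :: "nat \<Rightarrow> real \<Rightarrow> pt set" where
  "Surv n T = {q. \<forall>s\<in>{0..T}. (s, Fl n s q) \<in> Good n}"

definition residence :: "nat \<Rightarrow> real \<Rightarrow> pt \<Rightarrow> ennreal" where
  "residence n T q = (\<integral>\<^sup>+s. ennreal (if s \<in> {0..T} \<and> q \<in> Surv n s then 1 / rho_ext n s (Fl n s q) else 0) \<partial>lborel)"

lemma
  assumes n: "1 \<le> n"
  shows Fl_0: "Fl n 0 q = q"
    and Fl_has_vector_derivative: "((\<lambda>t. Fl n t q) has_vector_derivative vel n t (Fl n t q)) (at t within S)"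
    and continuous_on_Fl: "continuous_on S (\<lambda>t. Fl n t q)"
    and Fl_unique: "0 \<le> t \<Longrightarrow> continuous_on {0..t} x \<Longrightarrow> x 0 = q \<Longrightarrow>
      (\<And>r. 0 < r \<Longrightarrow> r < t \<Longrightarrow> (x has_vector_derivative vel n r (x r)) (at r)) \<Longrightarrow> x t = Fl n t q"
    and Fl_time_lipschitz: "norm (Fl n t q - Fl n u q) \<le> C * \<bar>t - u\<bar>"
    and borel_measurable_Fl: "Fl n t \<in> borel_measurable borel"
    and open_Good: "open (Good n)"
    and open_Surv: "0 \<le> T \<Longrightarrow> open (Surv n T)"
    and measurable_residence: "residence n T \<in> borel_measurable borel"
    and residence_bound: "0 \<le> T \<Longrightarrow> T \<le> real n \<Longrightarrow>
      (\<integral>\<^sup>+q. residence n T q * ennreal (indicator (ball 0 r) q * rho_ext n 0 q) \<partial>lborel)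
        \<le> ennreal T * emeasure lborel (cball (0::pt) (r + C * T))"
    and Surv_transport: "0 \<le> T \<Longrightarrow> T \<le> real n \<Longrightarrow> B \<in> sets borel \<Longrightarrow>
      (\<integral>\<^sup>+q. ennreal (indicator {q \<in> Surv n T. Fl n T q \<in> B} q * rho_ext n 0 q) \<partial>lborel)
        \<le> (\<integral>\<^sup>+p. ennreal (indicator {p \<in> B. (T, p) \<in> Good n} p * rho_ext n T p) \<partial>lborel)"
proof -
  obtain L LR BR LJ BJ where "bounded_transport (vel n) L C (rho_ext n) (J_ext n) LR BR LJ BJ (1 / real n) (real n) (QQ \<inter> ball 0 (real n))"
    using bounded_transport_ext[OF n] by blast
  then interpret T: bounded_transport "vel n" L C "rho_ext n" "J_ext n" LR BR LJ BJ "1 / real n" "real n" "QQ \<inter> ball 0 (real n)" .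
  have Fl: "Fl n t = T.fl 0 t" for t by (simp add: Fl_def fun_eq_iff)
  have Good: "Good n = T.good" by (auto simp: Good_def T.good_def)
  have Surv: "Surv n = T.surv" by (simp add: Surv_def T.surv_def Good Fl fun_eq_iff)
  have res: "residence n T q = (\<integral>\<^sup>+s. ennreal (T.inverse_density T s q) \<partial>lborel)" for T q
    unfolding residence_def T.inverse_density_def Surv Fl ..
  show "Fl n 0 q = q" by (simp add: Fl)
  show "((\<lambda>t. Fl n t q) has_vector_derivative vel n t (Fl n t q)) (at t within S)"
    unfolding Fl by (rule T.fl_has_vector_derivative)
  show "continuous_on S (\<lambda>t. Fl n t q)" unfolding Fl by (rule T.continuous_on_fl_time)
  show "x t = Fl n t q" if "0 \<le> t" "continuous_on {0..t} x" "x 0 = q"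
    "\<And>r. 0 < r \<Longrightarrow> r < t \<Longrightarrow> (x has_vector_derivative vel n r (x r)) (at r)"
    unfolding Fl by (rule T.fl_unique[OF that])
  show "norm (Fl n t q - Fl n u q) \<le> C * \<bar>t - u\<bar>" unfolding Fl by (rule T.fl_time_lipschitz)
  have meas: "T.fl s t \<in> borel_measurable borel" for s t
    by (intro borel_measurable_continuous_onI continuous_intros)
  show Flm: "Fl n t \<in> borel_measurable borel" unfolding Fl by (rule meas)
  show "open (Good n)" unfolding Good by (rule T.open_good)
  show "open (Surv n T)" if "0 \<le> T" using T.open_surv[OF that] by (simp add: Surv)
  show "residence n T \<in> borel_measurable borel"
    unfolding res[abs_def] by (rule T.measurable_residence)
  show "(\<integral>\<^sup>+q. residence n T q * ennreal (indicator (ball 0 r) q * rho_ext n 0 q) \<partial>lborel)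
        \<le> ennreal T * emeasure lborel (cball (0::pt) (r + C * T))" if "0 \<le> T" "T \<le> real n"
    unfolding res by (rule T.nn_integral_inverse_density[OF that])
  show "(\<integral>\<^sup>+q. ennreal (indicator {q \<in> Surv n T. Fl n T q \<in> B} q * rho_ext n 0 q) \<partial>lborel)
        \<le> (\<integral>\<^sup>+p. ennreal (indicator {p \<in> B. (T, p) \<in> Good n} p * rho_ext n T p) \<partial>lborel)"
    if T: "0 \<le> T" "T \<le> real n" and B: "B \<in> sets borel"
  proof -
    have f: "(\<lambda>q. indicator B (T.fl 0 T q)) \<in> borel_measurable borel"
      using measurable_compose[OF meas borel_measurable_indicator[OF B]] .
    have "(\<integral>\<^sup>+q. ennreal (indicator {q \<in> Surv n T. Fl n T q \<in> B} q * rho_ext n 0 q) \<partial>lborel)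
        = (\<integral>\<^sup>+q. indicator B (T.fl 0 T q) * ennreal (indicator (T.surv T) q * rho_ext n 0 q) \<partial>lborel)"
      unfolding Surv Fl by (intro nn_integral_cong) (auto simp: indicator_def)
    also have "\<dots> = (\<integral>\<^sup>+p. indicator B (T.fl 0 T (T.fl T 0 p)) * ennreal (indicator (T.surv T) (T.fl T 0 p) * rho_ext n T p) \<partial>lborel)"
      by (rule T.nn_integral_transport[OF T f])
    \<comment> \<open>Equality is lost here: a point good at time \<open>T\<close> may have a past
      outside the good set.\<close>
    also have "\<dots> \<le> (\<integral>\<^sup>+p. ennreal (indicator {p \<in> B. (T, p) \<in> Good n} p * rho_ext n T p) \<partial>lborel)"
    proof (rule nn_integral_mono)
      fix p
      have "(T, p) \<in> Good n" if "T.fl T 0 p \<in> T.surv T"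
        using that T unfolding T.surv_def Good by (force dest: bspec[of _ _ T])
      then show "indicator B (T.fl 0 T (T.fl T 0 p)) * ennreal (indicator (T.surv T) (T.fl T 0 p) * rho_ext n T p)
        \<le> ennreal (indicator {p \<in> B. (T, p) \<in> Good n} p * rho_ext n T p)"
        by (auto simp: indicator_def)
    qed
    finally show ?thesis .
  qed
qed

lemma Good_rho:
  assumes "(t, p) \<in> Good n" "0 \<le> t" "t \<le> real n"
  shows "rho_ext n t p = \<rho> t p" "p \<in> QQ" "norm p < real n" "1 / real n < \<rho> t p"
    "vel n t p = (1 / \<rho> t p) *\<^sub>R J t p" "(t, p) \<in> region n"
proof -
  have p: "p \<in> QQ" "norm p < real n" "1 / real n < rho_ext n t p"
    using assms(1) by (auto simp: Good_def)
  then show reg: "(t, p) \<in> region n"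
    using assms QQ_subset_closure by (auto simp: region_def)
  show eq: "rho_ext n t p = \<rho> t p" by (rule ext_eq[OF reg])
  show "p \<in> QQ" "norm p < real n" by fact+
  show "1 / real n < \<rho> t p" using p eq by simp
  show "vel n t p = (1 / \<rho> t p) *\<^sub>R J t p"
    using p by (simp add: vel_def ext_eq[OF reg] max_def)
qed

lemma Good_iff:
  assumes "0 \<le> t" "t \<le> real n"
  shows "(t, p) \<in> Good n \<longleftrightarrow> p \<in> QQ \<and> norm p < real n \<and> 1 / real n < \<rho> t p"
proof
  show "(t, p) \<in> Good n \<Longrightarrow> p \<in> QQ \<and> norm p < real n \<and> 1 / real n < \<rho> t p"
    using Good_rho[OF _ assms] by blast
  assume p: "p \<in> QQ \<and> norm p < real n \<and> 1 / real n < \<rho> t p"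
  then have "(t, p) \<in> region n"
    using assms QQ_subset_closure by (auto simp: region_def)
  then show "(t, p) \<in> Good n" using p by (simp add: Good_def ext_eq)
qed

text \<open>The point is compared with its orthogonal projection to the diagonal, where the normal
  component vanishes. The projection does not increase the norm and so stays in
  \<open>region n\<close>; the factor 2 bounds a difference of coordinates by the norm.\<close>

lemma normal_flux_bound:
  assumes L: "\<And>s p t q. (s, p) \<in> region n \<Longrightarrow> (t, q) \<in> region n \<Longrightarrow> norm (J s p - J t q) \<le> L * dist (s, p) (t, q)"
    and L0: "0 < L" and z: "(t, p) \<in> region n"
  shows "\<bar>snd (J t p) - fst (J t p)\<bar> \<le> 2 * L * \<bar>snd p - fst p\<bar>"
proof -
  obtain x y where p: "p = (x, y)" by (cases p)
  define b where "b = ((x + y) / 2, (x + y) / 2)"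
  have "norm b \<le> norm p"
  proof -
    have "((x + y) / 2)\<^sup>2 + ((x + y) / 2)\<^sup>2 \<le> x\<^sup>2 + y\<^sup>2"
      using zero_le_power2[of "x - y"] by (simp add: power2_eq_square field_simps)
    then show ?thesis by (simp add: p b_def norm_Pair power_divide)
  qed
  then have b: "(t, b) \<in> region n"
    using z by (auto simp: region_def closure_QQ b_def)
  have "fst (J t b) = snd (J t b)"
    using z by (intro boundary) (auto simp: region_def frontier_QQ b_def)
  then have "snd (J t p) - fst (J t p) = snd (J t p - J t b) - fst (J t p - J t b)" by simp
  also have "\<bar>\<dots>\<bar> \<le> 2 * norm (J t p - J t b)"
  proof -
    have "\<bar>snd v - fst v\<bar> \<le> 2 * norm v" for v :: pt
      using norm_fst_le[of "fst v" "snd v"] norm_snd_le[of "snd v" "fst v"] by simp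
    then show ?thesis .
  qed
  also have "norm (J t p - J t b) \<le> L * dist (t, p) (t, b)" by (rule L[OF z b])
  also have "dist (t, p) (t, b) \<le> \<bar>snd p - fst p\<bar>"
  proof -
    have "dist (t, p) (t, b) = dist p b" by (simp add: dist_Pair_Pair)
    also have "\<dots> \<le> dist (fst p) (fst b) + dist (snd p) (snd b)"
      unfolding dist_prod_def by (rule sqrt_sum_squares_le_sum) auto
    also have "\<dots> = \<bar>snd p - fst p\<bar>"
      by (simp add: p b_def dist_real_def field_simps abs_if)
    finally show ?thesis .
  qed
  finally show ?thesis using L0 by (simp add: mult_left_mono)
qed

text \<open>If the trajectory left the good set at time \<open>\<sigma>\<close> with density \<open>\<beta>\<close>, the Lipschitz bound
  \<open>r s \<le> \<beta> + K (\<sigma> - s)\<close> on the density along it would make the residence integral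
  at least \<open>ln ((\<beta> + K \<sigma>) / \<beta>) / K\<close>, so \<open>\<beta>\<close> cannot be small; the boundary is not
  reached because the normal component of the velocity is at most a multiple of the distance to it.\<close>

lemma survival_criterion:
  assumes n: "1 \<le> n" and T: "0 \<le> T" "T \<le> real n" and q: "q \<in> QQ"
    and M: "norm q + C * T \<le> M" "M < real n"
    and Lip: "\<And>s p t p'. (s, p) \<in> {0..T} \<times> (closure QQ \<inter> cball 0 M) \<Longrightarrow> (t, p') \<in> {0..T} \<times> (closure QQ \<inter> cball 0 M) \<Longrightarrow>
      \<bar>\<rho> s p - \<rho> t p'\<bar> \<le> Lr * dist (s, p) (t, p')" and Lr: "0 < Lr"
    and res: "residence n T q \<le> ennreal c" and c: "0 \<le> c"
    and small: "1 / real n < \<rho> 0 q * exp (- (Lr * (1 + C) * c))"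
  shows "q \<in> Surv n T"
proof (rule ccontr)
  assume nS: "q \<notin> Surv n T"
  define X where "X s = Fl n s q" for s
  define K where "K = Lr * (1 + C)"
  have K: "0 < K" using Lr C_pos by (simp add: K_def)
  have Xc: "continuous_on S X" for S unfolding X_def by (rule continuous_on_Fl[OF n])
  have X0: "X 0 = q" by (simp add: X_def Fl_0[OF n])
  \<comment> \<open>The bad times form a compact set, so there is a first one,
    \<open>\<sigma>\<close>; the aim is to show that it is good.\<close>
  define E where "E = {0..T} \<inter> (\<lambda>s. (s, X s)) -` (- Good n)"
  have "closed E" unfolding E_def
    by (intro continuous_closed_preimage continuous_intros Xc) (simp_all add: open_Good[OF n] closed_Compl)
  then have "compact E"
    unfolding E_def by (metis E_def bounded_closed_interval bounded_subset compact_eq_bounded_closed inf_le1)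
  moreover have "E \<noteq> {}" using nS by (auto simp: Surv_def E_def X_def)
  ultimately obtain \<sigma> where \<sigma>: "\<sigma> \<in> E" "\<And>s. s \<in> E \<Longrightarrow> \<sigma> \<le> s"
    using compact_attains_inf[of E] by blast
  have \<sigma>T: "0 \<le> \<sigma>" "\<sigma> \<le> T" using \<sigma>(1) by (auto simp: E_def)
  have before: "(s, X s) \<in> Good n" if "0 \<le> s" "s < \<sigma>" for s
    using \<sigma>(2)[of s] that \<sigma>T by (force simp: E_def)
  have norm_X: "norm (X s) \<le> M" if "0 \<le> s" "s \<le> \<sigma>" for s
  proof -
    have "norm (X s - q) \<le> C * s" using Fl_time_lipschitz[OF n, of s q 0] that by (simp add: X_def Fl_0[OF n])
    also have "\<dots> \<le> C * T" using that \<sigma>T C_pos by (intro mult_left_mono) auto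
    finally show ?thesis using M(1) norm_triangle_sub[of "X s" q] by linarith
  qed
  have rho_q: "1 / real n < \<rho> 0 q"
  proof -
    have "0 \<le> \<rho> 0 q" using q by (intro rho_nonneg QQ_subset_closure) auto
    then have "\<rho> 0 q * exp (- (Lr * (1 + C) * c)) \<le> \<rho> 0 q * 1"
      using c K by (intro mult_left_mono) (auto simp: K_def)
    then show ?thesis using small by simp
  qed
  have \<sigma>0: "0 < \<sigma>"
  proof (rule ccontr)
    assume "\<not> 0 < \<sigma>"
    then have "\<sigma> = 0" using \<sigma>T by simp
    moreover have "norm q < real n" using norm_X[of 0] X0 M \<sigma>T by simp
    then have "(0, q) \<in> Good n" using q rho_q by (subst Good_iff) auto
    ultimately show False using \<sigma>(1) X0 by (simp add: E_def)
  qed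
  have cl: "closure {0..<\<sigma>} = {0..\<sigma>}" using \<sigma>0 by simp
  have in_cl: "X s \<in> closure QQ" if "0 \<le> s" "s \<le> \<sigma>" for s
  proof -
    have "fst (X s) - snd (X s) \<le> 0"
    proof (rule continuous_le_on_closure[of "{0..<\<sigma>}" "\<lambda>s. fst (X s) - snd (X s)"])
      show "continuous_on (closure {0..<\<sigma>}) (\<lambda>s. fst (X s) - snd (X s))" by (intro continuous_intros Xc)
      show "fst (X u) - snd (X u) \<le> 0" if "u \<in> {0..<\<sigma>}" for u
        using before[of u] that by (auto simp: Good_def QQ_def)
    qed (use cl that in simp)
    then show ?thesis by (simp add: closure_QQ)
  qed
  \<comment> \<open>At \<open>\<sigma>\<close> itself only closed conditions are available by
    continuity; they suffice to identify \<open>rho_ext\<close> with \<open>\<rho>\<close>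
    there.\<close>
  have reg: "(s, X s) \<in> region n" if "0 \<le> s" "s \<le> \<sigma>" for s
    using in_cl[OF that] norm_X[OF that] that \<sigma>T T M by (simp add: region_def)
  define r where "r s = \<rho> s (X s)" for s
  have r_ext: "rho_ext n s (X s) = r s" if "0 \<le> s" "s \<le> \<sigma>" for s
    using ext_eq[OF reg[OF that]] by (simp add: r_def)
  have r_lip: "\<bar>r s - r t\<bar> \<le> K * \<bar>s - t\<bar>" if "0 \<le> s" "s \<le> \<sigma>" "0 \<le> t" "t \<le> \<sigma>" for s t
  proof -
    have "\<bar>r s - r t\<bar> \<le> Lr * dist (s, X s) (t, X t)"
      unfolding r_def using in_cl norm_X that \<sigma>T by (intro Lip) auto
    also have "dist (s, X s) (t, X t) \<le> dist s t + dist (X s) (X t)"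
      unfolding dist_Pair_Pair by (rule sqrt_sum_squares_le_sum) auto
    also have "\<dots> \<le> \<bar>s - t\<bar> + C * \<bar>s - t\<bar>"
      using Fl_time_lipschitz[OF n, of s q t] by (simp add: dist_real_def dist_norm X_def)
    finally show ?thesis using Lr by (simp add: K_def algebra_simps mult_left_mono)
  qed
  have r_pos: "1 / real n \<le> r s" if "0 \<le> s" "s \<le> \<sigma>" for s
  proof (rule continuous_ge_on_closure[of "{0..<\<sigma>}" r])
    have "K-lipschitz_on {0..\<sigma>} r"
      by (rule lipschitz_onI) (use r_lip K in \<open>auto simp: dist_real_def\<close>)
    then show "continuous_on (closure {0..<\<sigma>}) r" unfolding cl by (rule lipschitz_on_continuous_on)
    show "1 / real n \<le> r u" if "u \<in> {0..<\<sigma>}" for u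
      using before[of u] r_ext[of u] that by (auto simp: Good_def)
  qed (use cl that in simp)
  define \<beta> where "\<beta> = r \<sigma>"
  have n0: "0 < 1 / real n" using n by simp
  have \<beta>: "0 < \<beta>" using less_le_trans[OF n0 r_pos[of \<sigma>]] \<sigma>0 by (simp add: \<beta>_def)
  have den: "0 < \<beta> + K * (\<sigma> - s)" if "s \<le> \<sigma>" for s
    using \<beta> K that by (intro add_pos_nonneg) auto
  have "ennreal (- ln (\<beta> + K * (\<sigma> - \<sigma>)) / K - - ln (\<beta> + K * (\<sigma> - 0)) / K)
      = (\<integral>\<^sup>+s. ennreal (1 / (\<beta> + K * (\<sigma> - s))) * indicator {0..\<sigma>} s \<partial>lborel)"
  proof (rule nn_integral_FTC_Icc[symmetric])
    show "((\<lambda>s. - ln (\<beta> + K * (\<sigma> - s)) / K) has_real_derivative 1 / (\<beta> + K * (\<sigma> - s))) (at s)" if "s \<in> {0..\<sigma>}" for s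
      using den[of s] that K by (auto intro!: derivative_eq_intros)
    show "0 \<le> 1 / (\<beta> + K * (\<sigma> - s))" if "s \<in> {0..\<sigma>}" for s
      using den[of s] that by simp
  qed (use \<sigma>0 in auto)
  also have "\<dots> \<le> residence n T q"
    unfolding residence_def
  proof (rule nn_integral_mono_AE)
    show "AE s in lborel. ennreal (1 / (\<beta> + K * (\<sigma> - s))) * indicator {0..\<sigma>} s
      \<le> ennreal (if s \<in> {0..T} \<and> q \<in> Surv n s then 1 / rho_ext n s (Fl n s q) else 0)"
      \<comment> \<open>At \<open>s = \<sigma>\<close> the trajectory no longer survives and the
        residence integrand is 0; this single time is discarded.\<close>
      using AE_lborel_singleton[of \<sigma>]
    proof eventually_elim
      case (elim s)
      show ?case
      proof (cases "s \<in> {0..\<sigma>}")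
        case True
        with elim have s: "0 \<le> s" "s < \<sigma>" by auto
        have "q \<in> Surv n s" using before s by (auto simp: Surv_def X_def)
        moreover have "r s \<le> \<beta> + K * (\<sigma> - s)"
          using r_lip[of s \<sigma>] s \<sigma>0 by (simp add: \<beta>_def)
        then have "1 / (\<beta> + K * (\<sigma> - s)) \<le> 1 / r s"
          using less_le_trans[OF n0 r_pos[of s]] s by (intro divide_left_mono mult_pos_pos den) auto
        moreover have "rho_ext n s (Fl n s q) = r s" using r_ext[of s] s by (simp add: X_def)
        ultimately show ?thesis using True s \<sigma>T by (simp add: ennreal_leI)
      qed simp
    qed
  qed
  also have "\<dots> \<le> ennreal c" by (rule res)
  finally have "(ln (\<beta> + K * \<sigma>) - ln \<beta>) / K \<le> c"
    using c by (simp add: ennreal_le_iff diff_divide_distrib)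
  then have "ln (\<beta> + K * \<sigma>) \<le> ln \<beta> + K * c" using K by (simp add: field_simps)
  then have "exp (ln (\<beta> + K * \<sigma>)) \<le> exp (ln \<beta> + K * c)" by simp
  then have "\<beta> + K * \<sigma> \<le> \<beta> * exp (K * c)" using \<beta> den[of 0] \<sigma>0 by (simp add: exp_add)
  moreover have "\<rho> 0 q \<le> \<beta> + K * \<sigma>" using r_lip[of 0 \<sigma>] \<sigma>0 by (simp add: \<beta>_def r_def X0)
  ultimately have "\<rho> 0 q * exp (- (K * c)) \<le> \<beta> * exp (K * c) * exp (- (K * c))"
    by (intro mult_right_mono) auto
  then have "\<rho> 0 q * exp (- (K * c)) \<le> \<beta>" by (simp add: mult.assoc flip: exp_add)
  with small have dens: "1 / real n < \<beta>" by (simp add: K_def)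
  obtain Lj where Lj: "0 < Lj"
    "\<And>s p t q. (s, p) \<in> region n \<Longrightarrow> (t, q) \<in> region n \<Longrightarrow> norm (J s p - J t q) \<le> Lj * dist (s, p) (t, q)"
    by (rule lipschitz_compact[OF compact_region[of n] region_subset]) (rule that; assumption)
  define z where "z s = snd (X s) - fst (X s)" for s
  define z' where "z' s = snd (vel n s (X s)) - fst (vel n s (X s))" for s
  have "norm (z 0) \<le> exp (real n * (2 * Lj) * (\<sigma> - 0)) * norm (z \<sigma>)"
  \<comment> \<open>The backward estimate bounds the initial gap \<open>z 0 > 0\<close> by a
    multiple of the gap at \<open>\<sigma>\<close>, so the latter is nonzero. The rate depends on
    \<open>n\<close>, which is harmless while \<open>n\<close> is fixed.\<close>
  proof (rule gronwall_pair(2)[where z' = z'])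
    show "0 \<le> \<sigma>" using \<sigma>0 by simp
    show "continuous_on {0..\<sigma>} z" unfolding z_def by (intro continuous_intros Xc)
    fix s assume s: "0 < s" "s < \<sigma>"
    have d: "(X has_vector_derivative vel n s (X s)) (at s)"
      unfolding X_def by (rule Fl_has_vector_derivative[OF n])
    show "(z has_vector_derivative z' s) (at s)" unfolding z_def z'_def
      by (intro has_vector_derivative_diff bounded_linear.has_vector_derivative[OF bounded_linear_snd d]
          bounded_linear.has_vector_derivative[OF bounded_linear_fst d])
    have g: "(s, X s) \<in> Good n" using before s by simp
    have sn: "0 \<le> s" "s \<le> real n" using s \<sigma>T T by auto
    note G = Good_rho[OF g sn]
    have rp: "0 < \<rho> s (X s)" using G(4) n0 by linarith
    have "z' s = (snd (J s (X s)) - fst (J s (X s))) / \<rho> s (X s)"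
      unfolding z'_def G(5) by (simp add: diff_divide_distrib)
    then have "norm (z' s) = \<bar>snd (J s (X s)) - fst (J s (X s))\<bar> * (1 / \<rho> s (X s))" using rp by simp
    also have "\<dots> \<le> (2 * Lj * \<bar>z s\<bar>) * real n"
    proof (rule mult_mono)
      show "\<bar>snd (J s (X s)) - fst (J s (X s))\<bar> \<le> 2 * Lj * \<bar>z s\<bar>"
        using normal_flux_bound[OF Lj(2,1) G(6)] by (simp add: z_def)
      show "1 / \<rho> s (X s) \<le> real n" using G(4) rp n by (simp add: field_simps)
    qed (use Lj rp in auto)
    finally show "norm (z' s) \<le> real n * (2 * Lj) * norm (z s)" by (simp add: mult_ac)
  qed
  moreover have "0 < z 0" using q by (auto simp: z_def X0 QQ_def)
  ultimately have "z \<sigma> \<noteq> 0" by auto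
  moreover have "0 \<le> z \<sigma>" using in_cl[of \<sigma>] \<sigma>0 by (simp add: z_def closure_QQ)
  ultimately have "X \<sigma> \<in> QQ" by (simp add: z_def QQ_def split_beta')
  moreover have "norm (X \<sigma>) < real n" using norm_X[of \<sigma>] \<sigma>0 M by simp
  ultimately have "(\<sigma>, X \<sigma>) \<in> Good n"
    using dens \<sigma>T T by (subst Good_iff) (auto simp: \<beta>_def r_def)
  then show False using \<sigma>(1) by (simp add: E_def)
qed

text \<open>The residence bound is uniform in \<open>n\<close>, so Fatou makes the
  \<open>liminf\<close> of the weighted residence integrals finite almost everywhere. A finite
  \<open>liminf\<close> leaves one bound valid for arbitrarily large \<open>n\<close>.\<close>

lemma residence_finite_AE:
  "AE q in lborel. q \<in> QQ \<and> norm q < r \<and> 0 < \<rho> 0 q \<longrightarrow>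
    (\<exists>c\<ge>0. \<forall>N. \<exists>n\<ge>N. residence n (real T) q \<le> ennreal c)"
proof -
  \<comment> \<open>Indices from \<open>m\<close> on are positive, cover the time \<open>T\<close>,
    and have a region containing the part of \<open>QQ\<close> in the ball of radius
    \<open>r\<close>, where \<open>rho_ext\<close> is \<open>\<rho>\<close>.\<close>
  define m where "m = nat \<lceil>r\<rceil> + T + 1"
  have m: "1 \<le> m" "real T \<le> real m" "r \<le> real m"
    using real_nat_ceiling_ge[of r] by (auto simp: m_def)
  define a where "a n q = ennreal (indicator (ball 0 r) q * rho_ext n 0 q)" for n and q :: pt
  have am: "a n \<in> borel_measurable borel" for n
  proof -
    obtain L where L: "0 < L" "\<And>s p t q. \<bar>rho_ext n s p - rho_ext n t q\<bar> \<le> L * (\<bar>s - t\<bar> + norm (p - q))"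
      by (rule ext_lipschitz[of n]) (rule that; assumption)
    have "L-lipschitz_on UNIV (rho_ext n 0)"
      by (rule lipschitz_onI) (use L(1) L(2)[of 0 _ 0] in \<open>auto simp: dist_norm\<close>)
    then have [measurable]: "rho_ext n 0 \<in> borel_measurable borel"
      by (intro borel_measurable_continuous_onI lipschitz_on_continuous_on)
    have [measurable]: "ball (0::pt) r \<in> sets borel" by simp
    show ?thesis unfolding a_def by measurable
  qed
  define f where "f n q = residence (n + m) (real T) q * a (n + m) q" for n q
  have fm: "f n \<in> borel_measurable lborel" for n
    using borel_measurable_times_ennreal[OF measurable_residence[of "n + m" "real T"] am[of "n + m"]] m
    by (simp add: f_def[abs_def])
  define V where "V = ennreal (real T) * emeasure lborel (cball (0::pt) (r + C * real T))"
  have V: "V < \<infinity>"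
    using emeasure_compact_finite[OF compact_cball, of "0::pt" "r + C * real T"]
    by (simp add: V_def ennreal_mult_less_top)
  have f_le: "(\<integral>\<^sup>+q. f n q \<partial>lborel) \<le> V" for n
    unfolding f_def a_def V_def using m by (intro residence_bound) auto
  have "(\<integral>\<^sup>+q. liminf (\<lambda>n. f n q) \<partial>lborel) \<le> liminf (\<lambda>n. \<integral>\<^sup>+q. f n q \<partial>lborel)"
    by (rule nn_integral_liminf[OF fm])
  also have "\<dots> \<le> V"
    using Liminf_mono[of "\<lambda>n. \<integral>\<^sup>+q. f n q \<partial>lborel" "\<lambda>_. V" sequentially] f_le
    by (simp add: Liminf_const)
  finally have "(\<integral>\<^sup>+q. liminf (\<lambda>n. f n q) \<partial>lborel) \<noteq> \<infinity>" using V by auto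
  then have "AE q in lborel. liminf (\<lambda>n. f n q) \<noteq> \<infinity>"
    by (intro nn_integral_PInf_AE borel_measurable_liminf fm)
  then show ?thesis
  proof eventually_elim
    case (elim q)
    show ?case
    proof
      assume q: "q \<in> QQ \<and> norm q < r \<and> 0 < \<rho> 0 q"
      obtain b where b: "0 \<le> b" "liminf (\<lambda>n. f n q) = ennreal b"
        using elim by (cases "liminf (\<lambda>n. f n q)") auto
      have a: "a (n + m) q = ennreal (\<rho> 0 q)" for n
      proof -
        have "(0, q) \<in> region (n + m)"
          using q m QQ_subset_closure[of q] by (auto simp: region_def)
        then show ?thesis using q by (simp add: a_def ext_eq)
      qed
      have "\<exists>n\<ge>N. residence n (real T) q \<le> ennreal ((b + 1) / \<rho> 0 q)" for N
      proof -
        \<comment> \<open>Otherwise the \<open>liminf\<close> would be at least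
          \<open>b + 1\<close>.\<close>
        have "\<not> eventually (\<lambda>n. ennreal (b + 1) \<le> f n q) sequentially"
        proof
          assume "eventually (\<lambda>n. ennreal (b + 1) \<le> f n q) sequentially"
          then have "ennreal (b + 1) \<le> ennreal b" using Liminf_bounded b(2) by metis
          then show False using b(1) by (simp add: ennreal_le_iff)
        qed
        then obtain n where n: "N \<le> n" "f n q < ennreal (b + 1)"
          by (auto simp: eventually_sequentially not_le)
        have "residence (n + m) (real T) q \<le> ennreal ((b + 1) / \<rho> 0 q)"
        proof (cases "residence (n + m) (real T) q")
          case (real x)
          then have "ennreal (x * \<rho> 0 q) < ennreal (b + 1)"
            using n(2) q by (simp add: f_def a ennreal_mult)
          then have "x * \<rho> 0 q < b + 1" by (subst (asm) ennreal_less_iff) (use real q in auto)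
          then show ?thesis using real q by (simp add: ennreal_leI pos_le_divide_eq)
        next
          case top
          then show ?thesis using n(2) q by (simp add: f_def a ennreal_top_mult)
        qed
        then show ?thesis using n(1) by (intro exI[of _ "n + m"]) auto
      qed
      then show "\<exists>c\<ge>0. \<forall>N. \<exists>n\<ge>N. residence n (real T) q \<le> ennreal c"
        using b q by (intro exI[of _ "(b + 1) / \<rho> 0 q"]) auto
    qed
  qed
qed

text \<open>Natural radii and times suffice, so the exceptional null sets are countably many. For a
  typical point the threshold of \<open>survival_criterion\<close> is fixed first, and then a large
  \<open>n\<close> with bounded residence integral is chosen.\<close>

lemma survival_AE:
  "AE q in lborel. q \<in> QQ \<and> 0 < \<rho> 0 q \<longrightarrow> (\<forall>T. \<exists>n\<ge>1. T < real n \<and> q \<in> Surv n T)"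
proof -
  have "AE q in lborel. \<forall>r T. q \<in> QQ \<and> norm q < real r \<and> 0 < \<rho> 0 q \<longrightarrow>
    (\<exists>c\<ge>0. \<forall>N. \<exists>n\<ge>N. residence n (real T) q \<le> ennreal c)" for r :: nat
    unfolding AE_all_countable by (intro allI residence_finite_AE)
  then show ?thesis
  proof eventually_elim
    case (elim q)
    show ?case
    proof (intro impI allI)
      fix T' :: real
      assume q: "q \<in> QQ \<and> 0 < \<rho> 0 q"
      obtain r :: nat where r: "norm q < real r" using reals_Archimedean2 by blast
      obtain T :: nat where T: "T' < real T" using reals_Archimedean2 by blast
      obtain c where c: "0 \<le> c" "\<And>N. \<exists>n\<ge>N. residence n (real T) q \<le> ennreal c"
        using elim q r by blast
      \<comment> \<open>The trajectory cannot leave this ball for any \<open>n\<close>, so the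
        Lipschitz constant \<open>L0\<close> and the threshold \<open>x\<close> do not depend on
        \<open>n\<close>.\<close>
      define M where "M = norm q + C * real T"
      have "compact ({0..real T} \<times> (closure QQ \<inter> cball 0 M))"
        by (intro compact_Times closed_Int_compact closed_closure compact_cball compact_Icc)
      then obtain L0 where L0: "0 < L0" "\<And>s p t q. (s, p) \<in> {0..real T} \<times> (closure QQ \<inter> cball 0 M) \<Longrightarrow>
        (t, q) \<in> {0..real T} \<times> (closure QQ \<inter> cball 0 M) \<Longrightarrow> \<bar>\<rho> s p - \<rho> t q\<bar> \<le> L0 * dist (s, p) (t, q)"
        by (rule lipschitz_compact[of "{0..real T} \<times> (closure QQ \<inter> cball 0 M)"]) (auto intro: that)
      define x where "x = \<rho> 0 q * exp (- (L0 * (1 + C) * c))"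
      have x: "0 < x" using q by (simp add: x_def)
      obtain N :: nat where N: "max (1 / x) (max M (real T)) < real N" using reals_Archimedean2 by blast
      obtain n where n: "N + 1 \<le> n" "residence n (real T) q \<le> ennreal c" using c(2) by blast
      have nN: "1 / x < real n" "M < real n" "real T < real n" "1 \<le> n" using n(1) N by auto
      have "1 / real n < x" using nN(1) x nN(4) by (simp add: field_simps)
      then have "q \<in> Surv n (real T)"
        using nN q c n(2) L0
        by (intro survival_criterion[where M = M and Lr = L0 and c = c]) (auto simp: M_def x_def)
      then have "q \<in> Surv n T'" using T by (auto simp: Surv_def)
      then show "\<exists>n\<ge>1. T' < real n \<and> q \<in> Surv n T'" using nN T by (intro exI[of _ n]) auto
    qed
  qed
qed

section \<open>Regularised flows and genuine solutions\<close>

lemma follow_solution: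
  assumes n: "1 \<le> n" and T: "0 \<le> T" "T \<le> real n"
    and X: "continuous_on {0..T} X" "X 0 = q" "\<And>s. 0 \<le> s \<Longrightarrow> s \<le> T \<Longrightarrow> (s, X s) \<in> Good n"
    and D: "\<And>s. 0 < s \<Longrightarrow> s < T \<Longrightarrow> (X has_vector_derivative (1 / \<rho> s (X s)) *\<^sub>R J s (X s)) (at s)"
  shows "q \<in> Surv n T" "0 \<le> s \<Longrightarrow> s \<le> T \<Longrightarrow> X s = Fl n s q"
proof -
  \<comment> \<open>On the good set the regularised velocity is \<open>J / \<rho>\<close>, so
    \<open>X\<close> solves the regularised equation and uniqueness applies.\<close>
  have *: "X s = Fl n s q" if s: "0 \<le> s" "s \<le> T" for s
  proof (rule Fl_unique[where x = X, OF n s(1) _ X(2)])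
    show "continuous_on {0..s} X" by (rule continuous_on_subset[OF X(1)]) (use s in auto)
    show "(X has_vector_derivative vel n r (X r)) (at r)" if "0 < r" "r < s" for r
      using D[of r] Good_rho(5)[OF X(3)[of r]] that s T by simp
  qed
  then show "0 \<le> s \<Longrightarrow> s \<le> T \<Longrightarrow> X s = Fl n s q" .
  show "q \<in> Surv n T" using X(3) * by (auto simp: Surv_def)
qed

lemma Fl_solution:
  assumes n: "1 \<le> n" and s: "0 \<le> s" "s \<le> real n" "(s, Fl n s q) \<in> Good n"
  shows "((\<lambda>s. Fl n s q) has_vector_derivative (1 / \<rho> s (Fl n s q)) *\<^sub>R J s (Fl n s q)) (at s within S)"
  using Fl_has_vector_derivative[OF n, of q s S] Good_rho(5)[OF s(3,1,2)] by simp

text \<open>The good sets grow with \<open>n\<close> at the times considered, and a trajectory of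
  the smaller one follows the true velocity, hence is also the trajectory for
  \<open>m\<close>.\<close>

lemma Surv_mono:
  assumes n: "1 \<le> n" "n \<le> m" and T: "0 \<le> T" "T \<le> real n" and q: "q \<in> Surv n T"
  shows "q \<in> Surv m T" "0 \<le> s \<Longrightarrow> s \<le> T \<Longrightarrow> Fl n s q = Fl m s q"
proof -
  have m: "1 \<le> m" "T \<le> real m" using n T by auto
  have inv: "1 / real m \<le> 1 / real n" using n by (simp add: frac_le)
  have g: "(s, Fl n s q) \<in> Good n" if "0 \<le> s" "s \<le> T" for s using q that by (simp add: Surv_def)
  have G: "(s, Fl n s q) \<in> Good m" if s: "0 \<le> s" "s \<le> T" for s
  proof -
    have sn: "s \<le> real n" "s \<le> real m" using s T m by auto
    have "Fl n s q \<in> QQ \<and> norm (Fl n s q) < real n \<and> 1 / real n < \<rho> s (Fl n s q)"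
      using g[OF s] Good_iff[OF s(1) sn(1)] by blast
    then show ?thesis using Good_iff[OF s(1) sn(2)] n inv by auto
  qed
  have D: "((\<lambda>s. Fl n s q) has_vector_derivative (1 / \<rho> s (Fl n s q)) *\<^sub>R J s (Fl n s q)) (at s)"
    if "0 < s" "s < T" for s
    by (rule Fl_solution[OF n(1)]) (use that T g in auto)
  note f = follow_solution[OF m(1) T(1) m(2) continuous_on_Fl[OF n(1)] Fl_0[OF n(1)] G D]
  show "q \<in> Surv m T" by (rule f(1))
  show "0 \<le> s \<Longrightarrow> s \<le> T \<Longrightarrow> Fl n s q = Fl m s q" by (rule f(2))
qed

text \<open>Survival concerns the closed interval up to \<open>T\<close>, whereas
  \<open>flow\<close> asks for a solution on a half-open interval reaching beyond it; openness of
  the good set supplies the extra time.\<close>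

lemma Surv_imp_is_sol:
  assumes n: "1 \<le> n" and T: "0 \<le> T" "T < real n" and q: "q \<in> Surv n T"
  obtains S where "T < S" "is_sol \<rho> J q S (\<lambda>s. Fl n s q)"
proof -
  have "open ((\<lambda>s. (s, Fl n s q)) -` Good n)"
    by (rule open_vimage[OF open_Good[OF n]]) (intro continuous_intros continuous_on_Fl[OF n])
  then have "open ((\<lambda>s. (s, Fl n s q)) -` Good n \<inter> {..<real n})" by (intro open_Int) auto
  moreover have "T \<in> (\<lambda>s. (s, Fl n s q)) -` Good n \<inter> {..<real n}" using q T by (auto simp: Surv_def)
  ultimately obtain e where e: "0 < e" "ball T e \<subseteq> (\<lambda>s. (s, Fl n s q)) -` Good n \<inter> {..<real n}"
    using open_contains_ball by blast
  have G: "(s, Fl n s q) \<in> Good n \<and> s \<le> real n" if "0 \<le> s" "s < T + e" for s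
  proof (cases "s \<le> T")
    case True
    then show ?thesis using q that T by (auto simp: Surv_def)
  next
    case False
    then have "s \<in> ball T e" using that by (simp add: dist_real_def)
    then show ?thesis using e(2) by auto
  qed
  have "is_sol \<rho> J q (T + e) (\<lambda>s. Fl n s q)"
    unfolding is_sol_def
  proof (intro conjI ballI)
    show "Fl n 0 q = q" by (rule Fl_0[OF n])
    fix t assume "t \<in> {0..<T + e}"
    then have t: "0 \<le> t" "t \<le> real n" "(t, Fl n t q) \<in> Good n" using G[of t] by auto
    show "Fl n t q \<in> QQ" by (rule Good_rho(2)[OF t(3,1,2)])
    have "0 < 1 / real n" using n by simp
    then show "\<rho> t (Fl n t q) \<noteq> 0" using Good_rho(4)[OF t(3,1,2)] by linarith
    show "((\<lambda>s. Fl n s q) has_vector_derivative (1 / \<rho> t (Fl n t q)) *\<^sub>R J t (Fl n t q)) (at t within {0..<T + e})"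
      by (rule Fl_solution[OF n t])
  qed
  then show ?thesis using e(1) by (intro that[of "T + e"]) auto
qed

text \<open>On the compact interval up to \<open>T\<close> the solution stays bounded and the
  density along it has a positive minimum, so every sufficiently large \<open>n\<close> has it
  inside the good set.\<close>

lemma is_sol_imp_Surv:
  assumes sol: "is_sol \<rho> J q S X" and T: "0 \<le> T" "T < S"
  obtains n0 where "1 \<le> n0" "T < real n0" "\<And>n. n0 \<le> n \<Longrightarrow> q \<in> Surv n T \<and> Fl n T q = X T"
proof -
  have X: "X 0 = q" "\<And>t. 0 \<le> t \<Longrightarrow> t < S \<Longrightarrow> X t \<in> QQ" "\<And>t. 0 \<le> t \<Longrightarrow> t < S \<Longrightarrow> \<rho> t (X t) \<noteq> 0"
    "\<And>t. 0 \<le> t \<Longrightarrow> t < S \<Longrightarrow> (X has_vector_derivative ((1 / \<rho> t (X t)) *\<^sub>R J t (X t))) (at t within {0..<S})"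
    using sol by (auto simp: is_sol_def)
  have Xc: "continuous_on {0..T} X"
  proof -
    have "continuous_on {0..<S} X"
      unfolding continuous_on_eq_continuous_within
      by (intro ballI has_vector_derivative_continuous[OF X(4)]) auto
    then show ?thesis by (rule continuous_on_subset) (use T in auto)
  qed
  define K where "K = (\<lambda>s. (s, X s)) ` {0..T}"
  have Kc: "compact K" unfolding K_def
    by (intro compact_continuous_image continuous_intros Xc compact_Icc)
  have Ksub: "K \<subseteq> {0..} \<times> closure QQ"
    unfolding K_def by (intro image_subsetI SigmaI QQ_subset_closure X(2)) (use T in auto)
  obtain L where L: "0 < L" "\<And>s p t q. (s, p) \<in> K \<Longrightarrow> (t, q) \<in> K \<Longrightarrow> \<bar>\<rho> s p - \<rho> t q\<bar> \<le> L * dist (s, p) (t, q)"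
    by (rule lipschitz_compact[OF Kc Ksub]) (rule that; assumption)
  have "L-lipschitz_on K (\<lambda>z. \<rho> (fst z) (snd z))"
    by (rule lipschitz_onI) (use L in \<open>auto simp: dist_real_def\<close>)
  then have rc: "continuous_on K (\<lambda>z. \<rho> (fst z) (snd z))" by (rule lipschitz_on_continuous_on)
  have Kne: "K \<noteq> {}" using T by (auto simp: K_def)
  obtain z where z: "z \<in> K" "\<And>y. y \<in> K \<Longrightarrow> \<rho> (fst z) (snd z) \<le> \<rho> (fst y) (snd y)"
    using continuous_attains_inf[OF Kc Kne rc] by blast
  define m where "m = \<rho> (fst z) (snd z)"
  have "0 \<le> m" unfolding m_def using z(1) Ksub by (intro rho_nonneg) auto
  moreover have "m \<noteq> 0" using z(1) X(3) T by (auto simp: m_def K_def)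
  ultimately have m: "0 < m" by simp
  have rm: "m \<le> \<rho> s (X s)" if "0 \<le> s" "s \<le> T" for s
    using z(2)[of "(s, X s)"] that by (auto simp: m_def K_def)
  obtain B where B: "\<And>y. y \<in> K \<Longrightarrow> norm y \<le> B"
    using compact_imp_bounded[OF Kc] unfolding bounded_iff by blast
  have XB: "norm (X s) \<le> B" if "0 \<le> s" "s \<le> T" for s
    using B[of "(s, X s)"] norm_snd_le[of "X s" s] that by (force simp: K_def)
  obtain N :: nat where N: "max (1 / m) (max B T) < real N" using reals_Archimedean2 by blast
  show ?thesis
  proof (rule that[of "N + 1"])
    show "1 \<le> N + 1" "T < real (N + 1)" using N by auto
    fix n assume nN: "N + 1 \<le> n"
    then have n: "1 \<le> n" "1 / m < real n" "B < real n" "T < real n" using N by auto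
    have inv: "1 / real n < m" using n(2) m n(1) by (simp add: field_simps)
    have G: "(s, X s) \<in> Good n" if s: "0 \<le> s" "s \<le> T" for s
    proof -
      have "s \<le> real n" using s n by simp
      then show ?thesis
        using Good_iff[OF s(1)] X(2)[of s] XB[OF s] rm[OF s] inv s T n by auto
    qed
    have D: "(X has_vector_derivative (1 / \<rho> s (X s)) *\<^sub>R J s (X s)) (at s)" if "0 < s" "s < T" for s
    proof -
      have "at s within {0..<S} = at s" using that T by (intro at_within_interior) simp
      then show ?thesis using X(4)[of s] that T by simp
    qed
    have Tn: "T \<le> real n" using n by simp
    note f = follow_solution[OF n(1) T(1) Tn Xc X(1) G D]
    show "q \<in> Surv n T \<and> Fl n T q = X T"
      using f(1) f(2)[of T] T by auto
  qed
qed

lemma flow_eq_Fl: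
  assumes n: "1 \<le> n" and t: "0 \<le> t" "t < real n" and q: "q \<in> Surv n t"
  shows "flow \<rho> J t q = Some (Fl n t q)"
proof (cases "t = 0 \<and> q \<in> QQ")
  case True
  then show ?thesis by (simp add: flow_def Fl_0[OF n])
next
  case False
  obtain S where S: "t < S" "is_sol \<rho> J q S (\<lambda>s. Fl n s q)" by (rule Surv_imp_is_sol[OF n t q])
  have uniq: "y = Fl n t q" if "\<exists>T X. t < T \<and> is_sol \<rho> J q T X \<and> X t = y" for y
  proof -
    obtain T X where TX: "t < T" "is_sol \<rho> J q T X" "X t = y" using \<open>\<exists>T X. _\<close> by blast
    obtain n0 where n0: "1 \<le> n0" "t < real n0" "\<And>n. n0 \<le> n \<Longrightarrow> q \<in> Surv n t \<and> Fl n t q = X t"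
      by (rule is_sol_imp_Surv[OF TX(2) t(1) TX(1)]) (rule that; assumption)
    \<comment> \<open>A competing solution is a regularised trajectory only from its own index
      \<open>n0\<close> on, so both are compared at the larger index.\<close>
    have "Fl n t q = Fl (max n n0) t q"
      by (rule Surv_mono(2)[OF n _ t(1) _ q]) (use t in auto)
    then show ?thesis using n0(3)[of "max n n0"] TX(3) by simp
  qed
  have "(THE y. \<exists>T X. t < T \<and> is_sol \<rho> J q T X \<and> X t = y) = Fl n t q"
    by (rule the_equality) (use S uniq in blast)+
  moreover have "\<exists>T X. t < T \<and> is_sol \<rho> J q T X" using S by blast
  ultimately show ?thesis using False by (auto simp: flow_def)
qed

lemma flow_Some_imp:
  assumes t: "0 < t" and y: "flow \<rho> J t q = Some y"
  obtains n0 where "1 \<le> n0" "t < real n0" "\<And>n. n0 \<le> n \<Longrightarrow> q \<in> Surv n t \<and> Fl n t q = y"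
proof -
  have "\<exists>T X. t < T \<and> is_sol \<rho> J q T X"
    using y t by (auto simp: flow_def split: if_splits)
  then obtain T X where TX: "t < T" "is_sol \<rho> J q T X" by blast
  have t0: "0 \<le> t" using t by simp
  obtain n0 where n0: "1 \<le> n0" "t < real n0" "\<And>n. n0 \<le> n \<Longrightarrow> q \<in> Surv n t \<and> Fl n t q = X t"
    by (rule is_sol_imp_Surv[OF TX(2) t0 TX(1)]) (rule that; assumption)
  have "q \<in> Surv n0 t" "Fl n0 t q = X t" using n0(3)[of n0] by auto
  then have "y = X t" using flow_eq_Fl[OF n0(1) t0 n0(2)] y by simp
  then show ?thesis using n0 by (intro that[of n0]) auto
qed

section \<open>Equivariance\<close>

definition dens :: "real \<Rightarrow> pt \<Rightarrow> real" where
  "dens t q = indicator QQ q * \<rho> t q"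

definition reach :: "real \<Rightarrow> pt set \<Rightarrow> pt set" where
  "reach t A = {q. flow \<rho> J t q \<in> Some ` A}"

lemma QQ_borel [measurable]: "QQ \<in> sets borel"
  using open_QQ by simp

lemma measurable_dens [measurable]:
  assumes t: "0 \<le> t" shows "dens t \<in> borel_measurable borel"
proof -
  have "continuous_on QQ (\<rho> t)"
  proof (rule continuous_on_subset[where s = "closure QQ"])
    show "continuous_on (closure QQ) (\<rho> t)"
      unfolding continuous_on_eq_continuous_within
    proof
      fix q assume q: "q \<in> closure QQ"
      have "(t, q) \<in> {0..} \<times> closure QQ" using t q by simp
      then obtain e L where e: "0 < e" and
        L: "L-lipschitz_on (ball (t, q) e \<inter> {0..} \<times> closure QQ) (\<lambda>(t, q). \<rho> t q)"
        using rho_lip unfolding locally_lipschitz_on_def by blast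
      have "L-lipschitz_on (ball q e \<inter> closure QQ) (\<rho> t)"
      proof (rule lipschitz_onI)
        fix x y assume "x \<in> ball q e \<inter> closure QQ" "y \<in> ball q e \<inter> closure QQ"
        then show "dist (\<rho> t x) (\<rho> t y) \<le> L * dist x y"
          using lipschitz_onD[OF L, of "(t, x)" "(t, y)"] t by (simp add: dist_Pair_Pair)
      qed (rule lipschitz_on_nonneg[OF L])
      then have "continuous_on (ball q e \<inter> closure QQ) (\<rho> t)" by (rule lipschitz_on_continuous_on)
      then have "continuous (at q within ball q e \<inter> closure QQ) (\<rho> t)"
        using q e by (auto simp: continuous_on_eq_continuous_within)
      moreover have "at q within ball q e \<inter> closure QQ = at q within closure QQ"
        using e by (intro at_within_nhd[of q "ball q e"]) auto
      ultimately show "continuous (at q within closure QQ) (\<rho> t)" by simp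
    qed
  qed (rule closure_subset)
  from borel_measurable_continuous_on_indicator[OF QQ_borel this]
  show ?thesis by (simp add: dens_def[abs_def])
qed

lemma dens_nonneg: "0 \<le> t \<Longrightarrow> 0 \<le> dens t q"
  using rho_nonneg QQ_subset_closure by (auto simp: dens_def indicator_def)

lemma mu_eq: "mu \<rho> t = density lebesgue (\<lambda>q. ennreal (dens t q))"
  by (simp add: mu_def dens_def)

lemma dens_lebesgue: "0 \<le> t \<Longrightarrow> (\<lambda>q. ennreal (dens t q)) \<in> borel_measurable lebesgue"
  by (intro measurable_completion) simp

lemma sets_mu [simp]: "sets (mu \<rho> t) = sets lebesgue"
  by (simp add: mu_eq)

lemma emeasure_mu:
  assumes "0 \<le> t" "A \<in> sets borel"
  shows "emeasure (mu \<rho> t) A = (\<integral>\<^sup>+q. ennreal (indicator A q * dens t q) \<partial>lborel)"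
proof -
  have "emeasure (mu \<rho> t) A = (\<integral>\<^sup>+q. ennreal (dens t q) * indicator A q \<partial>lebesgue)"
    unfolding mu_eq using assms by (intro emeasure_density dens_lebesgue) auto
  also have "\<dots> = (\<integral>\<^sup>+q. ennreal (dens t q) * indicator A q \<partial>lborel)"
    by (rule nn_integral_completion)
  also have "\<dots> = (\<integral>\<^sup>+q. ennreal (indicator A q * dens t q) \<partial>lborel)"
    by (intro nn_integral_cong) (simp add: indicator_def)
  finally show ?thesis .
qed

lemma emeasure_mu_QQ: "0 \<le> t \<Longrightarrow> emeasure (mu \<rho> t) QQ = 1"
  using normalized[of t]
  by (simp add: emeasure_mu QQ_borel dens_def nn_integral_completion mult.assoc[symmetric] flip: indicator_inter_arith)

text \<open>Time 0 is treated apart because \<open>flow\<close> keeps the nodes there, although no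
  trajectory starts from them.\<close>

lemma flow_0: "reach 0 A = A" if "A \<subseteq> QQ"
proof -
  have "flow \<rho> J 0 q = None" if "q \<notin> QQ" for q
  proof -
    have "\<not> (\<exists>T X. 0 < T \<and> is_sol \<rho> J q T X)"
      using that by (fastforce simp: is_sol_def)
    then show ?thesis using that by (simp add: flow_def)
  qed
  moreover have "flow \<rho> J 0 q = Some q" if "q \<in> QQ" for q
    using that by (simp add: flow_def)
  ultimately have "q \<in> reach 0 A \<longleftrightarrow> q \<in> A" for q
    using that by (cases "q \<in> QQ") (auto simp: reach_def image_iff simp del: split_paired_All split_paired_Ex)
  then show ?thesis by blast
qed

text \<open>Expresses the preimage under the flow by sets whose measurability and mass are
  controlled for each regularisation; the shift by \<open>k\<close> makes all indices positive and
  larger than \<open>t\<close>.\<close>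

lemma reach_eq_Union:
  assumes t: "0 < t" and k: "1 \<le> k" "t < real k"
  shows "reach t A = (\<Union>n. {q \<in> Surv (n + k) t. Fl (n + k) t q \<in> A})"
proof (intro set_eqI iffI)
  fix q assume "q \<in> reach t A"
  then obtain y where y: "y \<in> A" "flow \<rho> J t q = Some y" by (auto simp: reach_def)
  obtain n0 where n0: "1 \<le> n0" "t < real n0" "\<And>n. n0 \<le> n \<Longrightarrow> q \<in> Surv n t \<and> Fl n t q = y"
    by (rule flow_Some_imp[OF t y(2)]) (rule that; assumption)
  then show "q \<in> (\<Union>n. {q \<in> Surv (n + k) t. Fl (n + k) t q \<in> A})"
    using n0(3)[of "n0 + k"] y(1) by (intro UN_I[of n0]) simp_all
next
  fix q assume "q \<in> (\<Union>n. {q \<in> Surv (n + k) t. Fl (n + k) t q \<in> A})"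
  then obtain n where n: "q \<in> Surv (n + k) t" "Fl (n + k) t q \<in> A" by auto
  have "flow \<rho> J t q = Some (Fl (n + k) t q)"
    by (rule flow_eq_Fl) (use n k t in auto)
  then show "q \<in> reach t A" using n by (simp add: reach_def)
qed

lemma Surv_pos:
  assumes "1 \<le> n" "0 \<le> T" "q \<in> Surv n T"
  shows "q \<in> QQ" "0 < \<rho> 0 q"
proof -
  have "(0, Fl n 0 q) \<in> Good n" using assms by (auto simp: Surv_def)
  then have *: "(0, q) \<in> Good n" by (simp add: Fl_0[OF assms(1)])
  have "0 < 1 / real n" using assms(1) by simp
  also have "1 / real n < \<rho> 0 q" by (rule Good_rho(4)[OF *]) auto
  finally show "0 < \<rho> 0 q" .
  show "q \<in> QQ" by (rule Good_rho(2)[OF *]) auto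
qed

lemma borel_Surv_vimage:
  assumes "1 \<le> n" "0 \<le> t" "B \<in> sets borel"
  shows "{q \<in> Surv n t. Fl n t q \<in> B} \<in> sets borel"
proof -
  have "Surv n t \<inter> Fl n t -` B \<in> sets borel"
    using measurable_sets_borel[OF borel_measurable_Fl[OF assms(1)] assms(3)]
    by (rule sets.Int[OF borel_open[OF open_Surv[OF assms(1,2)]]])
  then show ?thesis by (simp add: vimage_def Int_def)
qed

lemma borel_reach:
  assumes t: "0 < t" and B: "B \<in> sets borel"
  shows "reach t B \<in> sets borel"
proof -
  obtain k :: nat where "max 1 t < real k" using reals_Archimedean2 by blast
  then have k: "1 \<le> k" "t < real k" by auto
  show ?thesis unfolding reach_eq_Union[OF t k]
    using t k B by (intro sets.countable_UN image_subsetI borel_Surv_vimage) auto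
qed

text \<open>The pieces of the union increase with \<open>n\<close>. Each is bounded by mass
  conservation of its regularised flow, and continuity from below passes to the union.\<close>

lemma emeasure_reach_le:
  assumes t: "0 < t" and B: "B \<in> sets borel"
  shows "emeasure (mu \<rho> 0) (reach t B) \<le> emeasure (mu \<rho> t) B"
proof -
  obtain k :: nat where "max 1 t < real k" using reals_Archimedean2 by blast
  then have k: "1 \<le> k" "t < real k" by auto
  define D where "D n = {q \<in> Surv (n + k) t. Fl (n + k) t q \<in> B}" for n
  have Db: "D n \<in> sets borel" for n
    unfolding D_def using t k B by (intro borel_Surv_vimage) auto
  have "incseq D"
  proof (rule incseq_SucI, rule subsetI)
    fix n q assume "q \<in> D n"
    then show "q \<in> D (Suc n)"
      using Surv_mono[of "n + k" "Suc n + k" t q] k t unfolding D_def by auto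
  qed
  moreover have "range D \<subseteq> sets (mu \<rho> 0)" using Db by auto
  ultimately have "emeasure (mu \<rho> 0) (reach t B) = (SUP n. emeasure (mu \<rho> 0) (D n))"
    unfolding reach_eq_Union[OF t k] D_def[symmetric] by (intro SUP_emeasure_incseq[symmetric])
  also have "\<dots> \<le> emeasure (mu \<rho> t) B"
  proof (rule SUP_least)
    fix n
    have nk: "1 \<le> n + k" "0 \<le> t" "t \<le> real (n + k)" using t k by auto
    have "emeasure (mu \<rho> 0) (D n) = (\<integral>\<^sup>+q. ennreal (indicator (D n) q * dens 0 q) \<partial>lborel)"
      by (rule emeasure_mu[OF order_refl Db])
    also have "\<dots> = (\<integral>\<^sup>+q. ennreal (indicator {q \<in> Surv (n + k) t. Fl (n + k) t q \<in> B} q * rho_ext (n + k) 0 q) \<partial>lborel)"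
    proof (intro nn_integral_cong)
      fix q
      show "ennreal (indicator (D n) q * dens 0 q) = ennreal (indicator {q \<in> Surv (n + k) t. Fl (n + k) t q \<in> B} q * rho_ext (n + k) 0 q)"
      proof (cases "q \<in> D n")
        case True
        then have q: "q \<in> Surv (n + k) t" by (simp add: D_def)
        then have "(0, Fl (n + k) 0 q) \<in> Good (n + k)" using t by (auto simp: Surv_def)
        then have "rho_ext (n + k) 0 q = \<rho> 0 q" "q \<in> QQ"
          using Good_rho(1,2)[of 0 q "n + k"] by (auto simp: Fl_0[OF nk(1)])
        then show ?thesis using True by (simp add: D_def dens_def)
      qed (simp add: D_def)
    qed
    also have "\<dots> \<le> (\<integral>\<^sup>+p. ennreal (indicator {p \<in> B. (t, p) \<in> Good (n + k)} p * rho_ext (n + k) t p) \<partial>lborel)"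
      by (rule Surv_transport[OF nk B])
    also have "\<dots> \<le> (\<integral>\<^sup>+p. ennreal (indicator B p * dens t p) \<partial>lborel)"
    proof (rule nn_integral_mono)
      fix p
      show "ennreal (indicator {p \<in> B. (t, p) \<in> Good (n + k)} p * rho_ext (n + k) t p) \<le> ennreal (indicator B p * dens t p)"
        using Good_rho(1,2)[of t p "n + k"] nk dens_nonneg[OF nk(2), of p]
        by (cases "p \<in> B \<and> (t, p) \<in> Good (n + k)") (auto simp: dens_def)
    qed
    also have "\<dots> = emeasure (mu \<rho> t) B" by (rule emeasure_mu[OF nk(2) B, symmetric])
    finally show "emeasure (mu \<rho> 0) (D n) \<le> emeasure (mu \<rho> t) B" .
  qed
  finally show ?thesis .
qed

text \<open>Almost sure survival: no mass is lost to the graveyard.\<close>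

lemma emeasure_reach_QQ:
  assumes t: "0 < t"
  shows "emeasure (mu \<rho> 0) (reach t QQ) = 1"
proof -
  have "emeasure (mu \<rho> 0) (reach t QQ) = (\<integral>\<^sup>+q. ennreal (indicator (reach t QQ) q * dens 0 q) \<partial>lborel)"
    by (rule emeasure_mu[OF order_refl borel_reach[OF t QQ_borel]])
  also have "\<dots> = (\<integral>\<^sup>+q. ennreal (indicator QQ q * dens 0 q) \<partial>lborel)"
  proof (rule nn_integral_cong_AE)
    show "AE q in lborel. ennreal (indicator (reach t QQ) q * dens 0 q) = ennreal (indicator QQ q * dens 0 q)"
      using survival_AE
    proof eventually_elim
      case (elim q)
      show ?case
      proof (cases "q \<in> QQ \<and> 0 < \<rho> 0 q")
        case True
        then obtain n where n: "1 \<le> n" "t < real n" "q \<in> Surv n t" using elim by blast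
        have "(t, Fl n t q) \<in> Good n" using n t by (auto simp: Surv_def)
        then have "Fl n t q \<in> QQ" using Good_rho(2)[of t] n t by auto
        then have "q \<in> reach t QQ"
          using flow_eq_Fl[OF n(1) _ n(2,3)] t by (simp add: reach_def)
        then show ?thesis using True by simp
      next
        case False
        then have "dens 0 q = 0"
          using dens_nonneg[OF order_refl, of q] by (auto simp: dens_def indicator_def split: if_splits)
        then show ?thesis by simp
      qed
    qed
  qed
  also have "\<dots> = emeasure (mu \<rho> 0) QQ" by (rule emeasure_mu[OF order_refl QQ_borel, symmetric])
  finally show ?thesis by (simp add: emeasure_mu_QQ)
qed

text \<open>The one-sided estimate holds for \<open>B\<close> and for \<open>QQ - B\<close>. Both
  pairs of masses add up to 1, so neither inequality can be strict.\<close>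

lemma emeasure_reach_borel:
  assumes t: "0 < t" and B: "B \<in> sets borel" "B \<subseteq> QQ"
  shows "emeasure (mu \<rho> 0) (reach t B) = emeasure (mu \<rho> t) B"
proof -
  have B': "QQ - B \<in> sets borel" using B by (intro sets.Diff) auto
  have un: "reach t QQ = reach t B \<union> reach t (QQ - B)" and dis: "reach t B \<inter> reach t (QQ - B) = {}"
    using B(2) by (auto simp: reach_def)
  have 1: "emeasure (mu \<rho> 0) (reach t B) + emeasure (mu \<rho> 0) (reach t (QQ - B)) = 1"
    using plus_emeasure[of "reach t B" "mu \<rho> 0" "reach t (QQ - B)"] borel_reach[OF t] B(1) B' dis
      emeasure_reach_QQ[OF t] unfolding un by simp
  have "B \<union> (QQ - B) = QQ" using B(2) by auto
  then have 2: "emeasure (mu \<rho> t) B + emeasure (mu \<rho> t) (QQ - B) = 1"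
    using plus_emeasure[of B "mu \<rho> t" "QQ - B"] B(1) B' emeasure_mu_QQ[of t] t by simp
  note le = emeasure_reach_le[OF t B(1)] emeasure_reach_le[OF t B']
  have fin: "x \<noteq> \<infinity>" "y \<noteq> \<infinity>" if "x + y = (1::ennreal)" for x y using that by auto
  have ext: "a = a'" if "a + b = (1::ennreal)" "a' + b' = 1" "a \<le> a'" "b \<le> b'" for a b a' b'
    using fin[OF that(1)] fin[OF that(2)] that
    by (cases a; cases b; cases a'; cases b') (auto simp: ennreal_le_iff simp flip: ennreal_plus ennreal_1)
  show ?thesis by (rule ext[OF 1 2 le])
qed

text \<open>The one-sided estimate makes the preimage null for the initial measure. Initial points
  of trajectories have positive density, so it is also Lebesgue null, which lets completion be
  handled.\<close>

lemma reach_null: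
  assumes t: "0 < t" and N: "N \<in> null_sets lborel" "N \<subseteq> QQ"
  shows "reach t N \<in> null_sets lborel"
proof -
  have Nb: "N \<in> sets borel" using N(1) by auto
  have Rb: "reach t N \<in> sets borel" by (rule borel_reach[OF t Nb])
  have t0: "0 \<le> t" using t by simp
  have "(\<integral>\<^sup>+q. ennreal (indicator N q * dens t q) \<partial>lborel) = 0"
  proof -
    have "AE q in lborel. q \<notin> N" using N(1) by (rule AE_not_in)
    then have "AE q in lborel. ennreal (indicator N q * dens t q) = 0" by eventually_elim simp
    then show ?thesis by (subst nn_integral_cong_AE) auto
  qed
  then have "emeasure (mu \<rho> 0) (reach t N) = 0"
    using emeasure_reach_le[OF t Nb] emeasure_mu[OF t0 Nb] by simp
  then have "(\<integral>\<^sup>+q. ennreal (indicator (reach t N) q * dens 0 q) \<partial>lborel) = 0"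
    using emeasure_mu[OF order_refl Rb] by simp
  moreover have "(\<lambda>q. ennreal (indicator (reach t N) q * dens 0 q)) \<in> borel_measurable lborel"
    using borel_measurable_times[OF borel_measurable_indicator[OF Rb] measurable_dens[OF order_refl]] by simp
  ultimately have ae: "AE q in lborel. ennreal (indicator (reach t N) q * dens 0 q) = 0"
    by (subst (asm) nn_integral_0_iff_AE) auto
  have pos: "0 < dens 0 q" if "q \<in> reach t N" for q
  proof -
    obtain y where y: "flow \<rho> J t q = Some y" using \<open>q \<in> reach t N\<close> by (auto simp: reach_def)
    obtain n0 where n0: "1 \<le> n0" "t < real n0" "\<And>n. n0 \<le> n \<Longrightarrow> q \<in> Surv n t \<and> Fl n t q = y"
      by (rule flow_Some_imp[OF t y]) (rule that; assumption)
    have "q \<in> Surv n0 t" using n0(3)[of n0] by simp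
    from Surv_pos[OF n0(1) t0 this] show ?thesis by (simp add: dens_def)
  qed
  have out: "ennreal (indicator (reach t N) q * dens 0 q) = 0 \<Longrightarrow> q \<notin> reach t N" for q
    using pos[of q] by (cases "q \<in> reach t N") (auto simp: ennreal_eq_0_iff)
  from ae have "AE q in lborel. q \<notin> reach t N" by eventually_elim (rule out)
  then show ?thesis using Rb by (subst AE_iff_null_sets) auto
qed

text \<open>A Lebesgue set is a Borel set up to a subset of a Borel null set. The null set is first
  cut down to \<open>QQ\<close>, so that \<open>reach_null\<close> applies.\<close>

lemma equivariant_flow: "equivariant \<rho> J"
  unfolding equivariant_def reach_def[symmetric]
proof (intro allI impI ballI)
  fix t :: real and A :: "pt set"
  assume t: "0 \<le> t" and A: "A \<in> sets lebesgue" "A \<subseteq> QQ"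
  show "reach t A \<in> sets (mu \<rho> 0) \<and> emeasure (mu \<rho> 0) (reach t A) = emeasure (mu \<rho> t) A"
  proof (cases "t = 0")
    case True
    then show ?thesis using A by (simp add: flow_0)
  next
    case False
    then have t0: "0 < t" using t by simp
    obtain B N N' where BN: "A = B \<union> N" "N \<subseteq> N'" "N' \<in> null_sets lborel" "B \<in> sets lborel"
      by (rule sets_completionE[OF A(1)]) (rule that; assumption)
    have N'Q: "N' \<inter> QQ \<in> null_sets lborel" "N' \<inter> QQ \<subseteq> QQ"
      using BN(3) by (auto intro: null_set_Int2)
    have BQ: "B \<in> sets borel" "B \<subseteq> QQ" using BN A by auto
    have null: "reach t (N' \<inter> QQ) \<in> null_sets lborel" by (rule reach_null[OF t0 N'Q])
    have un: "reach t A = reach t B \<union> reach t N" by (auto simp: reach_def BN(1))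
    have Nsub: "reach t N \<subseteq> reach t (N' \<inter> QQ)" using BN A by (auto simp: reach_def)
    have "reach t N \<in> null_sets lebesgue"
      by (rule null_sets_completion_subset[OF Nsub null_sets_completionI[OF null]])
    then have RN: "reach t N \<in> null_sets (mu \<rho> 0)"
      unfolding mu_eq by (subst null_sets_density_iff[OF dens_lebesgue[OF order_refl]])
        (auto dest: AE_not_in elim: eventually_mono)
    have "N \<in> null_sets lebesgue"
      by (rule null_sets_completion_subset[OF BN(2) null_sets_completionI[OF BN(3)]])
    then have NN: "N \<in> null_sets (mu \<rho> t)"
      unfolding mu_eq by (subst null_sets_density_iff[OF dens_lebesgue[OF t]])
        (auto dest: AE_not_in elim: eventually_mono)
    have RB: "reach t B \<in> sets (mu \<rho> 0)" using borel_reach[OF t0 BQ(1)] by simp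
    have "emeasure (mu \<rho> 0) (reach t A) = emeasure (mu \<rho> 0) (reach t B)"
      unfolding un by (rule emeasure_Un_null_set[OF RB RN])
    also have "\<dots> = emeasure (mu \<rho> t) B" by (rule emeasure_reach_borel[OF t0 BQ])
    also have "\<dots> = emeasure (mu \<rho> t) A"
      unfolding BN(1) using BQ by (intro emeasure_Un_null_set[symmetric] NN) simp
    finally show ?thesis
      using RB RN by (auto simp: un)
  qed
qed

section \<open>Global existence for almost every initial point\<close>

lemma global_existence_AE:
  "AE q in mu \<rho> 0. q \<in> QQ \<longrightarrow>
    (\<exists>X. (\<forall>T>0. is_sol \<rho> J q T X) \<and> (\<forall>t\<ge>0. X t \<in> QQ \<and> flow \<rho> J t q = Some (X t)))"
proof -
  have "AE q in lborel. 0 < ennreal (dens 0 q) \<longrightarrow> (q \<in> QQ \<longrightarrow>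
    (\<exists>X. (\<forall>T>0. is_sol \<rho> J q T X) \<and> (\<forall>t\<ge>0. X t \<in> QQ \<and> flow \<rho> J t q = Some (X t))))"
    using survival_AE
  proof eventually_elim
    case (elim q)
    show ?case
    proof (intro impI)
      assume q: "0 < ennreal (dens 0 q)" "q \<in> QQ"
      then have surv: "\<exists>n\<ge>1. T < real n \<and> q \<in> Surv n T" for T
        using elim by (auto simp: dens_def)
      \<comment> \<open>Reading the trajectory off \<open>flow\<close> gives one function for all
        times, while the index \<open>n\<close> that represents it may change with the time
        horizon.\<close>
      define X where "X t = the (flow \<rho> J t q)" for t
      have X: "X s = Fl n s q" if "1 \<le> n" "0 \<le> s" "s \<le> T" "T < real n" "q \<in> Surv n T" for s n T
      proof -
        have "q \<in> Surv n s" using that by (auto simp: Surv_def)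
        then show ?thesis using flow_eq_Fl[of n s q] that by (simp add: X_def)
      qed
      have "X t \<in> QQ \<and> flow \<rho> J t q = Some (X t)" if t: "0 \<le> t" for t
      proof -
        obtain n where n: "1 \<le> n" "t < real n" "q \<in> Surv n t" using surv by blast
        have "(t, Fl n t q) \<in> Good n" using n t by (auto simp: Surv_def)
        then have "Fl n t q \<in> QQ" using Good_rho(2)[of t] n t by auto
        then show ?thesis using X[OF n(1) t order_refl n(2,3)] flow_eq_Fl[OF n(1) t n(2,3)] by simp
      qed
      moreover have "is_sol \<rho> J q T X" if T: "0 < T" for T
      proof -
        obtain n where n: "1 \<le> n" "T < real n" "q \<in> Surv n T" using surv by blast
        have G: "(s, Fl n s q) \<in> Good n" if "0 \<le> s" "s \<le> T" for s
          using n(3) that by (simp add: Surv_def)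
        have XF: "X s = Fl n s q" if "0 \<le> s" "s \<le> T" for s
          by (rule X[OF n(1) that n(2,3)])
        show ?thesis unfolding is_sol_def
        proof (intro conjI ballI)
          show "X 0 = q" using XF[of 0] T by (simp add: Fl_0[OF n(1)])
          fix t assume tT: "t \<in> {0..<T}"
          then have t: "0 \<le> t" "t \<le> T" "t \<le> real n" using n by auto
          have eq: "X t = Fl n t q" by (rule XF[OF t(1,2)])
          note g = G[OF t(1,2)]
          have "0 < 1 / real n" using n(1) by simp
          then show "X t \<in> QQ" "\<rho> t (X t) \<noteq> 0"
            unfolding eq using Good_rho(2,4)[OF g t(1,3)] by auto
          show "(X has_vector_derivative (1 / \<rho> t (X t)) *\<^sub>R J t (X t)) (at t within {0..<T})"
            unfolding eq
            by (rule has_vector_derivative_transform[OF tT _ Fl_solution[OF n(1) t(1,3) g]]) (use XF in auto)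
        qed
      qed
      ultimately show "\<exists>X. (\<forall>T>0. is_sol \<rho> J q T X) \<and> (\<forall>t\<ge>0. X t \<in> QQ \<and> flow \<rho> J t q = Some (X t))"
        by blast
    qed
  qed
  then show ?thesis
    unfolding mu_eq by (subst AE_density[OF dens_lebesgue[OF order_refl]]) (rule AE_completion)
qed

end

theorem theorem3:
  fixes \<rho> :: "real \<Rightarrow> real \<times> real \<Rightarrow> real"
    and J :: "real \<Rightarrow> real \<times> real \<Rightarrow> real \<times> real"
  assumes rho_lip: "locally_lipschitz_on ({0..} \<times> closure QQ) (\<lambda>(t, q). \<rho> t q)"
    and J_lip: "locally_lipschitz_on ({0..} \<times> closure QQ) (\<lambda>(t, q). J t q)"
    and rho_nonneg: "\<forall>t\<ge>0. \<forall>q\<in>closure QQ. \<rho> t q \<ge> 0"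
    and cont_eq: "AE z in lebesgue. z \<in> {0<..} \<times> QQ \<longrightarrow>
                    cont_eq_at \<rho> J (fst z) (fst (snd z)) (snd (snd z))"
    and rho_pos: "\<forall>t\<ge>0. \<forall>q\<in>closure QQ. \<rho> t q \<noteq> 0 \<longrightarrow> \<rho> t q > 0"
    and normalized: "\<forall>t\<ge>0. (\<integral>\<^sup>+ q. ennreal (indicator QQ q * \<rho> t q) \<partial>lebesgue) = 1"
    and J_bound: "\<exists>C>0. \<forall>t\<ge>0. \<forall>q\<in>closure QQ. norm (J t q) \<le> C * \<rho> t q"
    and bounded_sets: "\<forall>B. bounded B \<longrightarrow> (\<exists>M. \<forall>t x y.
           (t, (x, y)) \<in> B \<longrightarrow>
           (t \<ge> 0 \<and> (x, y) \<in> closure QQ \<longrightarrow> norm (J t (x, y)) \<le> M) \<and>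
           (t > 0 \<and> (x, y) \<in> QQ \<longrightarrow>
              (\<forall>d. ((\<lambda>s. \<rho> s (x, y)) has_real_derivative d) (at t) \<longrightarrow> \<bar>d\<bar> \<le> M) \<and>
              (\<forall>d. ((\<lambda>u. \<rho> t (u, y)) has_real_derivative d) (at x) \<longrightarrow> \<bar>d\<bar> \<le> M) \<and>
              (\<forall>d. ((\<lambda>v. \<rho> t (x, v)) has_real_derivative d) (at y) \<longrightarrow> \<bar>d\<bar> \<le> M)))"
    and boundary: "\<forall>t\<ge>0. \<forall>q\<in>frontier QQ. \<bar>fst (J t q) - snd (J t q)\<bar> = 0"
  shows "(AE q in mu \<rho> 0. q \<in> QQ \<longrightarrow>
            (\<exists>X. (\<forall>T>0. is_sol \<rho> J q T X) \<and>
                 (\<forall>t\<ge>0. X t \<in> QQ \<and> flow \<rho> J t q = Some (X t))))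
         \<and> equivariant \<rho> J"
proof -
  obtain C where C: "0 < C" "\<And>t q. 0 \<le> t \<Longrightarrow> q \<in> closure QQ \<Longrightarrow> norm (J t q) \<le> C * \<rho> t q"
    using J_bound by blast
  interpret regular_current \<rho> J C
    by unfold_locales (use rho_lip J_lip rho_nonneg cont_eq normalized C boundary in auto)
  show ?thesis using global_existence_AE equivariant_flow by blast
qed

end
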